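(* Let $\mathcal{A}_{stp}$ be a polynomial-time $\rho$-approximation algorithm for the Steiner tree problem. Then Algorithm APX (defined in the context), using $\mathcal{A}_{stp}$ as a subroutine, is a $(\rho+4)$-approximation algorithm for the clustered selected-internal Steiner tree problem (CSISTP) on metric instances with $|R_i\setminus R'_i|\ge 2$ for every $i$. That is, it runs in polynomial time, and on every such instance $(G,c,R,R',\mathcal{R},\mathcal{R}')$ it outputs a clustered selected-internal Steiner tree $\mathcal{T}$ for $R$ and $R'$ in $G$ with $$c(\mathcal{T})\le(\rho+4)\,c(T_{opt}),$$ where $T_{opt}$ is a minimum-cost clustered selected-internal Steiner tree for $R$ and $R'$ in $G$.
   Context: **Instance of the CSISTP.** A complete (finite, simple, undirected) graph $G=(V,E)$ with edge costs $c:E\to\mathbb{R}_{\ge 0}$; subsets $R\subset V$ and $R'\subset R$; a partition $\mathcal{R}=\{R_1,\dots,R_k\}$ of $R$ (pairwise disjoint clusters); and $\mathcal{R}'=\{R'_1,\dots,R'_k\}$ partitioning $R'$ with $R'_i\subset R_i$ for each $i$. The instance is metric if $c(u,v)\le c(u,w)+c(w,v)$ for all distinct $u,v,w\in V$. The cost $c(T)$ of a tree $T$ is the sum of the costs of its edges. **Feasible solutions.** A clustered Steiner tree for $R$ is a tree $T$ in $G$ spanning all vertices of $R$ (it may also use vertices of $V\setminus R$) that can be cut into $k$ subtrees $T_1,\dots,T_k$ by removing $k-1$ edges so that each $T_i$ spans all vertices in $R_i$. The local tree of $R_i$ on $T$, also denoted $T_i$, is the minimal subtree of $T$ that spans all vertices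 in $R_i$. A clustered selected-internal Steiner tree for $R$ and $R'$ is a clustered Steiner tree for $R$ such that, for each $1\le i\le k$, all vertices in $R'_i$ are internal vertices (i.e. non-leaf vertices) of $T_i$. The CSISTP asks for a clustered selected-internal Steiner tree of minimum cost. **Steiner tree problem.** Given a graph with nonnegative edge costs and a set of terminals, find a minimum-cost tree in the graph that spans all terminals. $\mathcal{A}_{stp}(H,S)$ denotes the output of the $\rho$-approximation algorithm on graph $H$ with terminal set $S$: a Steiner tree of cost at most $\rho$ times the minimum. (In the paper $\rho$ is the best-known performance ratio for the Steiner tree problem, $\ln 4+\epsilon$.) **Contraction.** Contracting an edge $(u,v)$ replaces $u,v$ by a new vertex $w$, with $c(w,x)=\min\{c(u,x),c(v,x)\}$ for every other vertex $x$. $G/R$ denotes the graph obtained from $G$ by contracting every cluster $R_i$ into a single vertex $r_i$ (contracting all edges of the induced subgraph $G[R_i]$), $1\le i\le k$. Each edge of $G/R$ corresponds to an edge of $G$ of the same cost. **Cube of a tree.** For a tree $T$, the cube $T^3$ is the graph on the same vertex set in which two distinct vertices are adjacent if and only if they are joined by a path in $T$ with at most three edges. **Algorithm $A_h(T,v_a,v_b)$.** Input: a tree $T$ and two vertices $v_a,v_b$ of it (distinct unless $T$ has one vertex). Output: a Hamiltonian path between $v_a$ and $v_b$ in $T^3$. If $T$ has one vertex, return the trivial path. Otherwise: - If $v_a,v_b$ are not adjacent in $T$, let $P=(v_a,v_1,v_2,\dots,v_b)$ be the path between them in $T$. Remove the edge $(v_a,v_1)$ to get trees $T_{v_a}\ni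 v_a$ and $T_{v_b}\ni v_b$. Let $v_{a'}=v_a$ if $T_{v_a}$ has one vertex, and otherwise let $v_{a'}$ be a neighbor of $v_a$ in $T_{v_a}$. Let $v_{b'}=v_1$. - If $v_a,v_b$ are adjacent in $T$, remove the edge $(v_a,v_b)$ to get trees $T_{v_a}\ni v_a$ and $T_{v_b}\ni v_b$. Let $v_{a'}=v_a$ if $T_{v_a}$ has one vertex, and otherwise a neighbor of $v_a$ in $T_{v_a}$. Let $v_{b'}=v_b$ if $T_{v_b}$ has one vertex, and otherwise a neighbor of $v_b$ in $T_{v_b}$. - In either case, recursively compute $P_{v_a}=A_h(T_{v_a},v_a,v_{a'})$ and $P_{v_b}=A_h(T_{v_b},v_{b'},v_b)$, and connect them by the edge $(v_{a'},v_{b'})$. **Algorithm APX.** 1. For each $i$, find a minimum spanning tree $T^s_i$ of the induced subgraph $G[R_i]$. 2. For each $i$, select any two (distinct) vertices $u,v\in R_i\setminus R'_i$ and let $T^h_i=A_h(T^s_i,u,v)$, a Hamiltonian path of $R_i$ between $u$ and $v$ in the cube of $T^s_i$. 3. Construct $G/R$ and let $\widetilde{R}=\{r_i : 1\le i\le k\}$. 4. Compute $\mathcal{A}_{stp}(G/R,\widetilde{R})$, an inter-cluster tree spanning $\widetilde{R}$. 5. Replace each $r_i$ by $T^h_i$ (replacing each edge of the inter-cluster tree by its corresponding edge of $G$) to obtain $\mathcal{T}$. A $\beta$-approximation algorithm for a minimization problem is a polynomial-time algorithm that always outputs a feasible solution of cost at most $\beta$ times the optimum. *)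

theory Defs
  imports
    Complex_Main
    "HOL-Library.Monad_Syntax"
    "HOL-Computational_Algebra.Polynomial"
begin

section \<open>Graphs and trees\<close>

text \<open>An undirected edge is the two-element set of its ends.\<close>

type_synonym 'v graph = "'v set \<times> 'v set set"

definition all_edges :: "'v set \<Rightarrow> 'v set set" where
  "all_edges V = {e. e \<subseteq> V \<and> card e = 2}"

definition simple_graph :: "'v graph \<Rightarrow> bool" where
  "simple_graph G \<longleftrightarrow> finite (fst G) \<and> snd G \<subseteq> all_edges (fst G)"

definition complete_graph :: "'v graph \<Rightarrow> bool" where
  "complete_graph G \<longleftrightarrow> finite (fst G) \<and> snd G = all_edges (fst G)"

definition adj :: "'v set set \<Rightarrow> 'v rel" where
  "adj E = {(u, v). {u, v} \<in> E}"

definition connected_graph :: "'v graph \<Rightarrow> bool" where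
  "connected_graph G \<longleftrightarrow>
     fst G \<noteq> {} \<and> (\<forall>u\<in>fst G. \<forall>v\<in>fst G. (u, v) \<in> (adj (snd G))\<^sup>*)"

definition is_cycle :: "'v set set \<Rightarrow> 'v list \<Rightarrow> bool" where
  "is_cycle E xs \<longleftrightarrow> length xs \<ge> 3 \<and> distinct xs \<and>
     successively (\<lambda>u v. {u, v} \<in> E) xs \<and> {last xs, hd xs} \<in> E"

definition is_tree :: "'v graph \<Rightarrow> bool" where
  "is_tree T \<longleftrightarrow> simple_graph T \<and> connected_graph T \<and> (\<nexists>xs. is_cycle (snd T) xs)"

definition subgraph :: "'v graph \<Rightarrow> 'v graph \<Rightarrow> bool" where
  "subgraph H G \<longleftrightarrow> fst H \<subseteq> fst G \<and> snd H \<subseteq> snd G"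

definition components :: "'v graph \<Rightarrow> 'v set set" where
  "components G = fst G // ((adj (snd G))\<^sup>* \<inter> fst G \<times> fst G)"

definition degree_in :: "'v graph \<Rightarrow> 'v \<Rightarrow> nat" where
  "degree_in G v = card {e \<in> snd G. v \<in> e}"

definition internal_vertex :: "'v graph \<Rightarrow> 'v \<Rightarrow> bool" where
  "internal_vertex T v \<longleftrightarrow> v \<in> fst T \<and> degree_in T v \<noteq> 1"

definition graph_cost :: "('v set \<Rightarrow> real) \<Rightarrow> 'v graph \<Rightarrow> real" where
  "graph_cost c G = (\<Sum>e\<in>snd G. c e)"

definition spanning_tree :: "'v graph \<Rightarrow> 'v graph \<Rightarrow> bool" where
  "spanning_tree G T \<longleftrightarrow> is_tree T \<and> subgraph T G \<and> fst T = fst G"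

definition steiner_tree :: "'v graph \<Rightarrow> 'v set \<Rightarrow> 'v graph \<Rightarrow> bool" where
  "steiner_tree G S T \<longleftrightarrow> is_tree T \<and> subgraph T G \<and> S \<subseteq> fst T"

text \<open>The clusters are \<open>R 0, \<dots>, R (k - 1)\<close>.  Cutting a tree means deleting a set \<open>F\<close> of edges;
  the resulting subtrees are the connected components of what is left.\<close>

definition clustered_steiner_tree ::
  "'v graph \<Rightarrow> nat \<Rightarrow> (nat \<Rightarrow> 'v set) \<Rightarrow> 'v graph \<Rightarrow> bool" where
  "clustered_steiner_tree G k R T \<longleftrightarrow>
     steiner_tree G (\<Union>i<k. R i) T \<and>
     (\<exists>F C. F \<subseteq> snd T \<and> card F = k - 1 \<and>
        bij_betw C {..<k} (components (fst T, snd T - F)) \<and> (\<forall>i<k. R i \<subseteq> C i))"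

definition local_tree :: "'v graph \<Rightarrow> 'v set \<Rightarrow> 'v graph \<Rightarrow> bool" where
  "local_tree T S L \<longleftrightarrow> steiner_tree T S L \<and>
     (\<forall>L'. steiner_tree T S L' \<and> subgraph L' L \<longrightarrow> L' = L)"

definition clustered_selected_internal_steiner_tree ::
  "'v graph \<Rightarrow> nat \<Rightarrow> (nat \<Rightarrow> 'v set) \<Rightarrow> (nat \<Rightarrow> 'v set) \<Rightarrow> 'v graph \<Rightarrow> bool" where
  "clustered_selected_internal_steiner_tree G k R R' T \<longleftrightarrow>
     clustered_steiner_tree G k R T \<and>
     (\<forall>i<k. \<exists>L. local_tree T (R i) L \<and> (\<forall>v\<in>R' i. internal_vertex L v))"


section \<open>Nondeterministic computations with a step count\<close>

text \<open>
  \<open>Runs S\<close> is a computation all of whose executions succeed, where \<open>(x, t) \<in> S\<close> means that some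
  execution returns \<open>x\<close> after \<open>t\<close> steps; \<open>Fail\<close> is one that has a failing execution.
  Nondeterminism is demonic: an execution cannot avoid a failure by choosing well.

  Convention for step counts: every \<^emph>\<open>return\<close> is one step, and between two of them a program
  only performs a bounded number of elementary operations: constructors and destructors of lists
  and pairs, tests of vertices and edges for equality and incidence, and array look-ups and
  updates.  Functions, such as a cost function or a map on vertices, that are part of the data are
  arrays.  Everything else, in particular every list traversal, is an explicit recursion.
  Comparing numbers is charged with the lengths of their encodings, as measured by a parameter
  \<open>len\<close>; the constant function \<open>len\<close> gives the unit-cost real RAM.
\<close>

datatype 'a comp = Fail | Runs "('a \<times> nat) set"

primrec runs :: "'a comp \<Rightarrow> ('a \<times> nat) set" where
  "runs Fail = {}"
| "runs (Runs S) = S"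

definition return :: "'a \<Rightarrow> 'a comp" where
  "return x = Runs {(x, 1)}"

definition bind :: "'a comp \<Rightarrow> ('a \<Rightarrow> 'b comp) \<Rightarrow> 'b comp" where
  "bind m f =
     (if m = Fail \<or> (\<exists>(x, t)\<in>runs m. f x = Fail) then Fail
      else Runs (\<Union>(x, t)\<in>runs m. (\<lambda>(y, t'). (y, t + t')) ` runs (f x)))"

adhoc_overloading Monad_Syntax.bind \<rightleftharpoons> bind

definition pick :: "'a list \<Rightarrow> 'a comp" where
  "pick xs = (if xs = [] then Fail else Runs ((\<lambda>x. (x, length xs)) ` set xs))"

definition num_le :: "(real \<Rightarrow> nat) \<Rightarrow> real \<Rightarrow> real \<Rightarrow> bool comp" where
  "num_le len x y = Runs {(x \<le> y, 1 + len x + len y)}"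

definition num_eq :: "(real \<Rightarrow> nat) \<Rightarrow> real \<Rightarrow> real \<Rightarrow> bool comp" where
  "num_eq len x y = Runs {(x = y, 1 + len x + len y)}"

lemma bind_cong [fundef_cong]:
  assumes "m = m'" "\<And>x t. (x, t) \<in> runs m' \<Longrightarrow> f x = f' x"
  shows "bind m f = bind m' f'"
proof -
  have "(\<exists>(x, t)\<in>runs m'. f x = Fail) \<longleftrightarrow> (\<exists>(x, t)\<in>runs m'. f' x = Fail)"
    using assms(2) by fastforce
  moreover have "(\<Union>(x, t)\<in>runs m'. (\<lambda>(y, t'). (y, t + t')) ` runs (f x)) =
      (\<Union>(x, t)\<in>runs m'. (\<lambda>(y, t'). (y, t + t')) ` runs (f' x))"
    using assms(2) by (intro SUP_cong) auto
  ultimately show ?thesis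
    unfolding bind_def assms(1) by simp
qed

lemma runs_bind:
  assumes "(y, t) \<in> runs (bind m f)"
  obtains x t1 t2 where "(x, t1) \<in> runs m" "(y, t2) \<in> runs (f x)" "t = t1 + t2"
  using assms by (auto simp: bind_def split: if_splits)

lemma runs_return [simp]: "p \<in> runs (return x) \<longleftrightarrow> p = (x, 1)"
  by (simp add: return_def)

lemma runs_pick: "(x, t) \<in> runs (pick xs) \<Longrightarrow> x \<in> set xs"
  by (auto simp: pick_def split: if_splits)

fun filter_c :: "('a \<Rightarrow> bool comp) \<Rightarrow> 'a list \<Rightarrow> 'a list comp" where
  "filter_c P [] = return []"
| "filter_c P (x # xs) = do {
     b \<leftarrow> P x;
     ys \<leftarrow> filter_c P xs;
     return (if b then x # ys else ys)
   }"

fun map_c :: "('a \<Rightarrow> 'b comp) \<Rightarrow> 'a list \<Rightarrow> 'b list comp" where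
  "map_c f [] = return []"
| "map_c f (x # xs) = do {
     y \<leftarrow> f x;
     ys \<leftarrow> map_c f xs;
     return (y # ys)
   }"

fun fold_c :: "('a \<Rightarrow> 's \<Rightarrow> 's comp) \<Rightarrow> 'a list \<Rightarrow> 's \<Rightarrow> 's comp" where
  "fold_c f [] s = return s"
| "fold_c f (x # xs) s = do {
     s' \<leftarrow> f x s;
     fold_c f xs s'
   }"

fun append_c :: "'a list \<Rightarrow> 'a list \<Rightarrow> 'a list comp" where
  "append_c [] ys = return ys"
| "append_c (x # xs) ys = do {
     zs \<leftarrow> append_c xs ys;
     return (x # zs)
   }"

definition remove_c :: "'a \<Rightarrow> 'a list \<Rightarrow> 'a list comp" where
  "remove_c x xs = filter_c (\<lambda>y. return (y \<noteq> x)) xs"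

definition member_c :: "'a \<Rightarrow> 'a list \<Rightarrow> bool comp" where
  "member_c x xs = do {
     hits \<leftarrow> filter_c (\<lambda>y. return (y = x)) xs;
     return (hits \<noteq> [])
   }"

definition minus_c :: "'a list \<Rightarrow> 'a list \<Rightarrow> 'a list comp" where
  "minus_c xs ys = filter_c (\<lambda>x. do { b \<leftarrow> member_c x ys; return (\<not> b) }) xs"

lemma runs_filter_c:
  "(ys, t) \<in> runs (filter_c P xs) \<Longrightarrow> length ys \<le> length xs \<and> set ys \<subseteq> set xs"
proof (induction xs arbitrary: ys t)
  case (Cons x xs)
  from Cons.prems obtain b zs t' where
    "(zs, t') \<in> runs (filter_c P xs)" "ys = (if b then x # zs else zs)"
    by (auto elim!: runs_bind)
  with Cons.IH[of zs t'] show ?case by auto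
qed simp

lemma runs_filter_c_return:
  "(ys, t) \<in> runs (filter_c (\<lambda>x. return (Q x)) xs) \<Longrightarrow> ys = filter Q xs"
proof (induction xs arbitrary: ys t)
  case (Cons x xs)
  from Cons.prems show ?case
    by (auto elim!: runs_bind split: if_splits dest: Cons.IH)
qed simp

lemma runs_remove_c: "(ys, t) \<in> runs (remove_c x xs) \<Longrightarrow> ys = filter (\<lambda>y. y \<noteq> x) xs"
  unfolding remove_c_def by (rule runs_filter_c_return)

lemma runs_member_c: "(b, t) \<in> runs (member_c x xs) \<Longrightarrow> b \<longleftrightarrow> x \<in> set xs"
  unfolding member_c_def
  by (auto elim!: runs_bind dest!: runs_filter_c_return simp: filter_empty_conv)


section \<open>Polynomial-time approximation algorithms\<close>

type_synonym 'v graph_code = "'v list \<times> 'v set list"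

definition graph_of :: "'v graph_code \<Rightarrow> 'v graph" where
  "graph_of T = (set (fst T), set (snd T))"

definition irredundant :: "'v graph_code \<Rightarrow> bool" where
  "irredundant T \<longleftrightarrow> distinct (fst T) \<and> distinct (snd T)"

text \<open>For minimisation problems whose feasible solutions are graphs.  An algorithm is any function
  into computations, so a subroutine that is a parameter of an algorithm only enters through
  its possible outputs and its step counts.\<close>

definition poly_time_approximation ::
  "('i \<Rightarrow> bool) \<Rightarrow> ('i \<Rightarrow> nat) \<Rightarrow> ('i \<Rightarrow> 'v graph \<Rightarrow> bool) \<Rightarrow> ('i \<Rightarrow> 'v graph \<Rightarrow> real) \<Rightarrow>
   real \<Rightarrow> ('i \<Rightarrow> 'v graph_code comp) \<Rightarrow> bool" where
  "poly_time_approximation inst isize feasible cost \<beta> alg \<longleftrightarrow>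
     (\<exists>p :: nat poly. \<forall>I. inst I \<longrightarrow>
        (\<exists>S. alg I = Runs S \<and> S \<noteq> {} \<and>
          (\<forall>(T, t)\<in>S. t \<le> poly p (isize I) \<and> irredundant T \<and> feasible I (graph_of T) \<and>
            (\<forall>T_opt. is_arg_min (cost I) (feasible I) T_opt \<longrightarrow>
               cost I (graph_of T) \<le> \<beta> * cost I T_opt))))"

type_synonym 'v wgraph = "'v list \<times> 'v set list \<times> ('v set \<Rightarrow> real)"

fun wgraph :: "'v wgraph \<Rightarrow> 'v graph" where
  "wgraph (vs, es, c) = (set vs, set es)"

fun edge_cost :: "'v wgraph \<Rightarrow> 'v set \<Rightarrow> real" where
  "edge_cost (vs, es, c) = c"

fun nonneg_wgraph :: "'v wgraph \<Rightarrow> bool" where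
  "nonneg_wgraph (vs, es, c) \<longleftrightarrow> irredundant (vs, es) \<and> simple_graph (set vs, set es) \<and>
     (\<forall>e\<in>set es. 0 \<le> c e)"

fun wgraph_size :: "(real \<Rightarrow> nat) \<Rightarrow> 'v wgraph \<Rightarrow> nat" where
  "wgraph_size len (vs, es, c) = length vs + (\<Sum>e\<leftarrow>es. 1 + len (c e))"

text \<open>Minimum spanning trees; an exact algorithm is an approximation algorithm of ratio 1.\<close>

definition mst_instance :: "'v wgraph \<Rightarrow> bool" where
  "mst_instance G \<longleftrightarrow> nonneg_wgraph G \<and> connected_graph (wgraph G)"

definition poly_time_mst :: "(real \<Rightarrow> nat) \<Rightarrow> ('v wgraph \<Rightarrow> 'v graph_code comp) \<Rightarrow> bool" where
  "poly_time_mst len alg \<longleftrightarrow> poly_time_approximation mst_instance (wgraph_size len)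
     (\<lambda>G. spanning_tree (wgraph G)) (\<lambda>G. graph_cost (edge_cost G)) 1 alg"

text \<open>The Steiner tree problem: a graph and a list of terminals.\<close>

type_synonym 'v stp = "'v wgraph \<times> 'v list"

fun stp_instance :: "'v stp \<Rightarrow> bool" where
  "stp_instance (G, S) \<longleftrightarrow> nonneg_wgraph G \<and> distinct S \<and> S \<noteq> [] \<and> set S \<subseteq> fst (wgraph G) \<and>
     (\<exists>T. steiner_tree (wgraph G) (set S) T)"

fun stp_size :: "(real \<Rightarrow> nat) \<Rightarrow> 'v stp \<Rightarrow> nat" where
  "stp_size len (G, S) = wgraph_size len G + length S"

definition poly_time_stp_approximation ::
  "(real \<Rightarrow> nat) \<Rightarrow> real \<Rightarrow> ('v stp \<Rightarrow> 'v graph_code comp) \<Rightarrow> bool" where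
  "poly_time_stp_approximation len \<rho> alg \<longleftrightarrow> poly_time_approximation stp_instance (stp_size len)
     (\<lambda>(G, S). steiner_tree (wgraph G) (set S)) (\<lambda>(G, S). graph_cost (edge_cost G)) \<rho> alg"

text \<open>The CSISTP: a graph and the list of the pairs \<open>(R\<^sub>i, R'\<^sub>i)\<close>.  The inclusions \<open>R \<subseteq> V\<close> and
  \<open>R'\<^sub>i \<subseteq> R\<^sub>i\<close> need not be proper, and \<open>R'\<^sub>i\<close> may be empty.\<close>

type_synonym 'v csistp = "'v wgraph \<times> ('v list \<times> 'v list) list"

definition cluster :: "('v list \<times> 'v list) list \<Rightarrow> nat \<Rightarrow> 'v set" where
  "cluster Cs i = set (fst (Cs ! i))"

definition selected :: "('v list \<times> 'v list) list \<Rightarrow> nat \<Rightarrow> 'v set" where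
  "selected Cs i = set (snd (Cs ! i))"

fun csistp_instance :: "'v csistp \<Rightarrow> bool" where
  "csistp_instance (G, Cs) \<longleftrightarrow> nonneg_wgraph G \<and> complete_graph (wgraph G) \<and> Cs \<noteq> [] \<and>
     (\<forall>(R, R')\<in>set Cs. distinct R \<and> distinct R' \<and> R \<noteq> [] \<and>
        set R \<subseteq> fst (wgraph G) \<and> set R' \<subseteq> set R) \<and>
     (\<forall>i<length Cs. \<forall>j<length Cs. i \<noteq> j \<longrightarrow> cluster Cs i \<inter> cluster Cs j = {})"

fun metric_instance :: "'v csistp \<Rightarrow> bool" where
  "metric_instance (G, Cs) \<longleftrightarrow>
     (\<forall>u\<in>fst (wgraph G). \<forall>v\<in>fst (wgraph G). \<forall>w\<in>fst (wgraph G). distinct [u, v, w] \<longrightarrow>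
        edge_cost G {u, v} \<le> edge_cost G {u, w} + edge_cost G {w, v})"

fun two_unselected :: "'v csistp \<Rightarrow> bool" where
  "two_unselected (G, Cs) \<longleftrightarrow> (\<forall>i<length Cs. 2 \<le> card (cluster Cs i - selected Cs i))"

fun csistp_size :: "(real \<Rightarrow> nat) \<Rightarrow> 'v csistp \<Rightarrow> nat" where
  "csistp_size len (G, Cs) = wgraph_size len G + (\<Sum>(R, R')\<leftarrow>Cs. length R + length R')"

definition poly_time_csistp_approximation ::
  "(real \<Rightarrow> nat) \<Rightarrow> real \<Rightarrow> ('v csistp \<Rightarrow> 'v graph_code comp) \<Rightarrow> bool" where
  "poly_time_csistp_approximation len \<beta> alg \<longleftrightarrow>
     poly_time_approximation
       (\<lambda>I. csistp_instance I \<and> metric_instance I \<and> two_unselected I) (csistp_size len)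
       (\<lambda>(G, Cs). clustered_selected_internal_steiner_tree (wgraph G) (length Cs)
          (cluster Cs) (selected Cs))
       (\<lambda>(G, Cs). graph_cost (edge_cost G)) \<beta> alg"


section \<open>Hamiltonian paths in the cube of a tree\<close>

definition other_end :: "'v \<Rightarrow> 'v set \<Rightarrow> 'v" where
  "other_end x e = the_elem (e - {x})"

definition incident_c :: "'v \<Rightarrow> 'v set list \<Rightarrow> 'v set list comp" where
  "incident_c x es = filter_c (\<lambda>e. return (x \<in> e)) es"

definition ends_in_c :: "'v set \<Rightarrow> 'v list \<Rightarrow> 'v list comp" where
  "ends_in_c e xs = filter_c (\<lambda>x. return (x \<in> e)) xs"

text \<open>\<open>length es\<close> sweeps over the edges suffice to reach the whole component of \<open>a\<close>.\<close>

definition reachable_c :: "'v set list \<Rightarrow> 'v \<Rightarrow> 'v list comp" where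
  "reachable_c es a =
     fold_c (\<lambda>_. fold_c (\<lambda>e xs. do {
         hits \<leftarrow> ends_in_c e xs;
         return (case hits of [x] \<Rightarrow> other_end x e # xs | _ \<Rightarrow> xs)
       }) es) es [a]"

definition component_edges_c :: "'v set list \<Rightarrow> 'v \<Rightarrow> 'v set list comp" where
  "component_edges_c es a = do {
     xs \<leftarrow> reachable_c es a;
     filter_c (\<lambda>e. do { hits \<leftarrow> ends_in_c e xs; return (hits \<noteq> []) }) es
   }"

text \<open>The first edge of the path from \<open>a\<close> to \<open>b\<close> in a tree.\<close>

definition first_edge_c :: "'v set list \<Rightarrow> 'v \<Rightarrow> 'v \<Rightarrow> 'v set comp" where
  "first_edge_c es a b = do {
     ds \<leftarrow> incident_c a es;
     fs \<leftarrow> filter_c (\<lambda>e. do {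
         es' \<leftarrow> remove_c e es;
         xs \<leftarrow> reachable_c es' (other_end a e);
         member_c b xs
       }) ds;
     pick fs
   }"

definition self_or_neighbour_c :: "'v set list \<Rightarrow> 'v \<Rightarrow> 'v comp" where
  "self_or_neighbour_c es a =
     (if es = [] then return a
      else do { ds \<leftarrow> incident_c a es; e \<leftarrow> pick ds; return (other_end a e) })"

lemma runs_component_edges_c:
  "(es', t) \<in> runs (component_edges_c es a) \<Longrightarrow> length es' \<le> length es"
  unfolding component_edges_c_def by (auto elim!: runs_bind dest: runs_filter_c)

lemma runs_first_edge_c: "(e, t) \<in> runs (first_edge_c es a b) \<Longrightarrow> e \<in> set es"
  unfolding first_edge_c_def incident_c_def
  by (auto elim!: runs_bind dest!: runs_pick runs_filter_c)

lemma runs_component_edges_c_less: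
  assumes "e \<in> set es" "(es', t) \<in> runs (remove_c e es)"
    "(es'', t') \<in> runs (component_edges_c es' x)"
  shows "length es'' < length es"
proof -
  have "length es'' \<le> length es'"
    by (rule runs_component_edges_c[OF assms(3)])
  also have "\<dots> < length es"
    using assms(1) unfolding runs_remove_c[OF assms(2)] by (intro length_filter_less) auto
  finally show ?thesis .
qed

text \<open>A tree is given by its edges, and by the end \<open>a\<close> if it has only one vertex; a path is
  given by the sequence of its vertices.\<close>

function ham_path_c :: "'v set list \<Rightarrow> 'v \<Rightarrow> 'v \<Rightarrow> 'v list comp" where
  "ham_path_c es a b =
     (if es = [] then return [a] else do {
        adjacent \<leftarrow> member_c {a, b} es;
        if adjacent then do {
          es' \<leftarrow> remove_c {a, b} es;
          es_a \<leftarrow> component_edges_c es' a;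
          es_b \<leftarrow> component_edges_c es' b;
          a' \<leftarrow> self_or_neighbour_c es_a a;
          b' \<leftarrow> self_or_neighbour_c es_b b;
          p \<leftarrow> ham_path_c es_a a a';
          q \<leftarrow> ham_path_c es_b b' b;
          append_c p q
        }
        else do {
          e \<leftarrow> first_edge_c es a b;
          es' \<leftarrow> remove_c e es;
          es_a \<leftarrow> component_edges_c es' a;
          es_b \<leftarrow> component_edges_c es' (other_end a e);
          a' \<leftarrow> self_or_neighbour_c es_a a;
          p \<leftarrow> ham_path_c es_a a a';
          q \<leftarrow> ham_path_c es_b (other_end a e) b;
          append_c p q
        }
      })"
  by pat_completeness auto
termination
  by (relation "measure (\<lambda>(es, a, b). length es)")
    (auto dest: runs_member_c runs_first_edge_c elim: runs_component_edges_c_less[rotated])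

declare ham_path_c.simps [simp del]

fun path_edges_c :: "'v list \<Rightarrow> 'v set list comp" where
  "path_edges_c (x # y # zs) = do {
     es \<leftarrow> path_edges_c (y # zs);
     return ({x, y} # es)
   }"
| "path_edges_c xs = return []"


section \<open>Minimum spanning trees by Prim's algorithm\<close>

definition cheapest_c :: "(real \<Rightarrow> nat) \<Rightarrow> ('v set \<Rightarrow> real) \<Rightarrow> 'v set list \<Rightarrow> 'v set comp" where
  "cheapest_c len c es = do {
     fs \<leftarrow> filter_c (\<lambda>e. do {
         ds \<leftarrow> filter_c (\<lambda>e'. do { b \<leftarrow> num_le len (c e) (c e'); return (\<not> b) }) es;
         return (ds = [])
       }) es;
     pick fs
   }"

fun prim :: "(real \<Rightarrow> nat) \<Rightarrow> 'v wgraph \<Rightarrow> 'v graph_code comp" where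
  "prim len (vs, es, c) =
     fold_c (\<lambda>_ (xs, T). do {
         cut \<leftarrow> filter_c (\<lambda>e. do {
             hits \<leftarrow> ends_in_c e xs;
             return (case hits of [_] \<Rightarrow> True | _ \<Rightarrow> False)
           }) es;
         e \<leftarrow> cheapest_c len c cut;
         hits \<leftarrow> ends_in_c e xs;
         return (other_end (hd hits) e # xs, e # T)
       }) (tl vs) ([hd vs], [])"


section \<open>Contraction of the clusters\<close>

text \<open>Contracting the edge \<open>{u, v}\<close> of a complete graph.  The new vertex takes over the name \<open>u\<close>.\<close>

fun contract_edge_c :: "(real \<Rightarrow> nat) \<Rightarrow> 'v \<Rightarrow> 'v \<Rightarrow> 'v wgraph \<Rightarrow> 'v wgraph comp" where
  "contract_edge_c len u v (vs, es, c) = do {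
     vs' \<leftarrow> remove_c v vs;
     es' \<leftarrow> filter_c (\<lambda>e. return (v \<notin> e)) es;
     c' \<leftarrow> fold_c (\<lambda>x c'.
         if x = u then return c'
         else do {
           b \<leftarrow> num_le len (c {u, x}) (c {v, x});
           return (c'({u, x} := (if b then c {u, x} else c {v, x})))
         }) vs' c;
     return (vs', es', c')
   }"

text \<open>Hence the vertex obtained from the cluster \<open>R\<^sub>i\<close> is named \<open>hd R\<^sub>i\<close>.\<close>

definition contract_clusters_c ::
  "(real \<Rightarrow> nat) \<Rightarrow> ('v list \<times> 'v list) list \<Rightarrow> 'v wgraph \<Rightarrow> 'v wgraph comp" where
  "contract_clusters_c len Cs G =
     fold_c (\<lambda>(R, R'). fold_c (contract_edge_c len (hd R)) (tl R)) Cs G"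

text \<open>The array that maps every vertex of \<open>G\<close> to the vertex of \<open>G/R\<close> it ends up in.\<close>

definition contraction_map_c ::
  "'v list \<Rightarrow> ('v list \<times> 'v list) list \<Rightarrow> ('v \<Rightarrow> 'v) comp" where
  "contraction_map_c vs Cs = do {
     f \<leftarrow> fold_c (\<lambda>v f. return (f(v := v))) vs (\<lambda>_. undefined);
     fold_c (\<lambda>(R, R'). fold_c (\<lambda>v f. return (f(v := hd R))) R) Cs f
   }"


section \<open>The approximation algorithm\<close>

fun induced_c :: "'v list \<Rightarrow> 'v wgraph \<Rightarrow> 'v wgraph comp" where
  "induced_c R (vs, es, c) = do {
     es' \<leftarrow> filter_c (\<lambda>e. do {
         hits \<leftarrow> ends_in_c e R;
         return (case hits of [_, _] \<Rightarrow> True | _ \<Rightarrow> False)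
       }) es;
     return (R, es', c)
   }"

fun cluster_path_c ::
  "('v wgraph \<Rightarrow> 'v graph_code comp) \<Rightarrow> 'v wgraph \<Rightarrow> 'v list \<times> 'v list \<Rightarrow> 'v list comp" where
  "cluster_path_c mst G (R, R') = do {
     H \<leftarrow> induced_c R G;
     (_, T) \<leftarrow> mst H;
     xs \<leftarrow> minus_c R R';
     u \<leftarrow> pick xs;
     ys \<leftarrow> remove_c u xs;
     v \<leftarrow> pick ys;
     ham_path_c T u v
   }"

text \<open>An edge of \<open>G\<close> of the same cost that corresponds to the edge \<open>e\<close> of \<open>G/R\<close>, whose costs
  are \<open>c'\<close>; \<open>f\<close> is the contraction map.\<close>

fun corresponding_edge_c ::
  "(real \<Rightarrow> nat) \<Rightarrow> 'v wgraph \<Rightarrow> ('v set \<Rightarrow> real) \<Rightarrow> ('v \<Rightarrow> 'v) \<Rightarrow> 'v set \<Rightarrow> 'v set comp" where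
  "corresponding_edge_c len (vs, es, c) c' f e = do {
     ds \<leftarrow> filter_c (\<lambda>d. do {
         b \<leftarrow> num_eq len (c d) (c' e);
         return (b \<and> f ` d = e)
       }) es;
     pick ds
   }"

fun apx :: "(real \<Rightarrow> nat) \<Rightarrow> ('v wgraph \<Rightarrow> 'v graph_code comp) \<Rightarrow>
    ('v stp \<Rightarrow> 'v graph_code comp) \<Rightarrow> 'v csistp \<Rightarrow> 'v graph_code comp" where
  "apx len mst stp ((vs, es, c), Cs) = do {
     paths \<leftarrow> map_c (cluster_path_c mst (vs, es, c)) Cs;
     (vs', es', c') \<leftarrow> contract_clusters_c len Cs (vs, es, c);
     rs \<leftarrow> map_c (\<lambda>(R, R'). return (hd R)) Cs;
     (vT, eT) \<leftarrow> stp ((vs', es', c'), rs);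
     f \<leftarrow> contraction_map_c vs Cs;
     inter \<leftarrow> map_c (corresponding_edge_c len (vs, es, c) c' f) eT;
     intra \<leftarrow> map_c path_edges_c paths;
     steiner \<leftarrow> minus_c vT rs;
     vs_out \<leftarrow> fold_c (\<lambda>(R, R'). append_c R) Cs steiner;
     es_out \<leftarrow> fold_c append_c intra inter;
     return (vs_out, es_out)
   }"

end

theory Submission
  imports Defs
begin

text \<open>
  On the solution side, the Hamiltonian path of a cluster costs at most twice its minimum spanning
  tree, because every recursion step of \<open>A\<^sub>h\<close> pays for its new edge by the triangle
  inequality with tree edges that are each used at most twice overall.  On the side of the optimum,
  deleting the \<open>k - 1\<close> cut edges splits the optimal tree into edge-disjoint trees, one around each
  cluster; shortcutting a Hamiltonian path of such a tree to the cluster gives a spanning tree of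
  the cluster of at most twice its cost.  So the paths cost at most four times the optimum.  The
  image of the optimal tree in \<open>G/R\<close> is connected and contains all terminals, so the
  inter-cluster tree costs at most \<open>\<rho>\<close> times the optimum.  That the result is a tree follows by
  counting edges, and its \<open>k - 1\<close> cut edges are found by extending the paths to a maximal edge set
  that joins no two clusters.
\<close>

section \<open>Connectivity and trees\<close>

text \<open>Choices are adversarial and the subroutines are known only through their guarantees, so
  each program is shown correct and fast for all of its runs at once, as a \<open>spec\<close>; only
  combinatorics then remains. The obstacle in the path bound is that \<open>2 * sum c E\<close>
  alone does not survive the recursion: the edge joining two partial paths is bounded by a detour of
  up to three tree edges, and the halves must help to pay for it. Hence \<open>ham_post\<close>
  promises a refund of \<open>c {a, b}\<close> whenever the ends are adjacent, and the recursion
  picks neighbouring ends wherever it collects that refund. The same program, run on pieces of the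
  optimal tree, is the existence proof for the paths used there. Contraction proceeds edge by edge,
  so its invariant describes partly contracted graphs; it makes each cost a minimum over preimages,
  which serves both to lift the inter-cluster tree at equal cost and to project the optimum at no
  greater cost. Scaling the latter bound requires \<open>0 \<le> \<rho>\<close>, which follows from
  an instance with a single edge.\<close>

abbreviation conn :: "'v set set \<Rightarrow> 'v rel" where
  "conn E \<equiv> (adj E)\<^sup>*"

lemma adj_iff [simp]: "(u, v) \<in> adj E \<longleftrightarrow> {u, v} \<in> E"
  by (simp add: adj_def)

lemma sym_conn: "sym (conn E)"
  by (intro sym_rtrancl) (simp add: sym_def adj_def insert_commute)

lemma conn_sym: "(u, v) \<in> conn E \<Longrightarrow> (v, u) \<in> conn E"
  using sym_conn by (rule symD)

lemma conn_mono: "E \<subseteq> E' \<Longrightarrow> (u, v) \<in> conn E \<Longrightarrow> (u, v) \<in> conn E'"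
  by (rule rtrancl_mono[THEN subsetD, rotated]) (auto simp: adj_def)

lemma conn_edge: "{u, v} \<in> E \<Longrightarrow> (u, v) \<in> conn E"
  by (simp add: r_into_rtrancl)

text \<open>A walk needs the new edge at most once, in one of its two directions. This reduces
  reachability after adding an edge, or before removing one, to the smaller relation.\<close>

lemma conn_insert:
  "(x, y) \<in> conn (insert {u, v} E) \<longleftrightarrow>
     (x, y) \<in> conn E \<or> (x, u) \<in> conn E \<and> (v, y) \<in> conn E \<or> (x, v) \<in> conn E \<and> (u, y) \<in> conn E"
proof -
  have "adj (insert {u, v} E) = insert (u, v) (insert (v, u) (adj E))"
    by (auto simp: adj_def doubleton_eq_iff)
  then show ?thesis
    by (auto simp: rtrancl_insert intro: rtrancl_trans)
qed

text \<open>Every use of the edge can be replaced by the detour. A minimal connecting edge set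
  therefore consists of bridges.\<close>

lemma conn_remove_redundant:
  assumes "(u, v) \<in> conn (E - {{u, v}})"
  shows "conn (E - {{u, v}}) = conn E"
proof (cases "{u, v} \<in> E")
  case True
  then have E: "insert {u, v} (E - {{u, v}}) = E" by auto
  have "(x, y) \<in> conn (E - {{u, v}})" if "(x, y) \<in> conn E" for x y
    using that conn_insert[of x y u v "E - {{u, v}}"] assms conn_sym[OF assms]
    unfolding E by (meson rtrancl_trans)
  moreover have "(x, y) \<in> conn E" if "(x, y) \<in> conn (E - {{u, v}})" for x y
    using that by (rule conn_mono[rotated]) auto
  ultimately show ?thesis by auto
qed simp

lemma conn_remove_edge:
  assumes "(u, x) \<in> conn E"
  shows "(u, x) \<in> conn (E - {{u, v}}) \<or> (v, x) \<in> conn (E - {{u, v}})"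
proof -
  have "(u, x) \<in> conn (insert {u, v} (E - {{u, v}}))"
    using assms by (rule conn_mono[rotated]) auto
  then show ?thesis unfolding conn_insert by blast
qed

lemma conn_crossing:
  assumes "(x, y) \<in> conn E" "x \<in> S" "y \<notin> S"
  obtains p q where "{p, q} \<in> E" "p \<in> S" "q \<notin> S"
  using assms by (induction rule: rtrancl_induct) auto

lemma conn_in_verts:
  assumes "(a, x) \<in> conn E" "E \<subseteq> all_edges V" "a \<in> V"
  shows "x \<in> V"
  using assms by (induction rule: rtrancl_induct) (auto simp: all_edges_def)

lemma all_edgesE:
  assumes "e \<in> all_edges V"
  obtains u v where "e = {u, v}" "u \<noteq> v" "u \<in> V" "v \<in> V"
  using assms by (auto simp: all_edges_def card_2_iff)

lemma all_edges_iff [simp]: "{u, v} \<in> all_edges V \<longleftrightarrow> u \<in> V \<and> v \<in> V \<and> u \<noteq> v"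
  by (auto simp: all_edges_def)

lemma all_edges_mono: "V \<subseteq> W \<Longrightarrow> all_edges V \<subseteq> all_edges W"
  by (auto simp: all_edges_def)

lemma finite_all_edges: "finite V \<Longrightarrow> finite (all_edges V)"
  by (rule finite_subset[of _ "Pow V"]) (auto simp: all_edges_def)

section \<open>Counting connected components\<close>

definition comp_of :: "'v graph \<Rightarrow> 'v \<Rightarrow> 'v set" where
  "comp_of G a = {x \<in> fst G. (a, x) \<in> conn (snd G)}"

lemma components_eq: "components (V, E) = comp_of (V, E) ` V"
  by (auto simp: components_def quotient_def comp_of_def image_def)

lemma comp_of_eq_iff:
  assumes "a \<in> V" "b \<in> V"
  shows "comp_of (V, E) a = comp_of (V, E) b \<longleftrightarrow> (a, b) \<in> conn E"
proof
  assume "comp_of (V, E) a = comp_of (V, E) b"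
  then have "b \<in> comp_of (V, E) a" using assms by (simp add: comp_of_def)
  then show "(a, b) \<in> conn E" by (simp add: comp_of_def)
next
  assume "(a, b) \<in> conn E"
  then show "comp_of (V, E) a = comp_of (V, E) b"
    using conn_sym[of a b E] by (auto simp: comp_of_def intro: rtrancl_trans)
qed

text \<open>A walk from \<open>a\<close> never leaves what is reachable from \<open>a\<close>, so a
  component is already connected by the edges inside it.\<close>

lemma conn_within_reachable:
  assumes "(a, x) \<in> conn E"
  shows "(a, x) \<in> conn {e \<in> E. e \<subseteq> {y. (a, y) \<in> conn E}}"
  using assms
proof (induction rule: rtrancl_induct)
  case (step y z)
  have "(a, z) \<in> conn E" using step by (meson rtrancl.rtrancl_into_rtrancl)
  then have "(y, z) \<in> adj {e \<in> E. e \<subseteq> {y. (a, y) \<in> conn E}}"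
    using step by simp
  with step.IH show ?case by (meson rtrancl.rtrancl_into_rtrancl)
qed simp

text \<open>Send each old component to the new one that contains it. Only the components of
  \<open>u\<close> and \<open>v\<close> can merge, so the map is injective once the component of
  \<open>u\<close> is left out.\<close>

lemma card_components_insert_le:
  assumes "finite V" "u \<in> V"
  shows "card (components (V, E)) \<le> card (components (V, insert {u, v} E)) + 1"
proof -
  let ?C = "comp_of (V, E)" and ?D = "comp_of (V, insert {u, v} E)"
  have "card (components (V, E) - {?C u}) \<le> card (components (V, insert {u, v} E))"
  proof (rule card_inj_on_le)
    let ?g = "\<lambda>X. \<Union>x\<in>X. ?D x"
    have g: "?g (?C x) = ?D x" if "x \<in> V" for x
    proof -
      have "?D y = ?D x" if "y \<in> ?C x" for y
        using that \<open>x \<in> V\<close> conn_mono[of E "insert {u, v} E" x y]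
        by (subst comp_of_eq_iff) (auto simp: comp_of_def intro: conn_sym)
      moreover have "x \<in> ?C x" using that by (simp add: comp_of_def)
      ultimately show ?thesis by blast
    qed
    show "?g ` (components (V, E) - {?C u}) \<subseteq> components (V, insert {u, v} E)"
      using g by (auto simp: components_eq)
    show "inj_on ?g (components (V, E) - {?C u})"
    proof (rule inj_onI)
      fix X Y
      assume X: "X \<in> components (V, E) - {?C u}" and Y: "Y \<in> components (V, E) - {?C u}"
        and eq: "?g X = ?g Y"
      obtain x y where xy: "x \<in> V" "X = ?C x" "y \<in> V" "Y = ?C y"
        using X Y by (auto simp: components_eq)
      have n: "(x, u) \<notin> conn E" "(u, y) \<notin> conn E"
        using X Y xy assms(2) comp_of_eq_iff[of x V u E] comp_of_eq_iff[of u V y E] by auto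
      have "?D x = ?D y" using eq g xy by simp
      then have "(x, y) \<in> conn E"
        using n xy by (simp add: comp_of_eq_iff conn_insert)
      then show "X = Y" using xy by (simp add: comp_of_eq_iff)
    qed
  qed (use assms(1) in \<open>simp add: components_eq\<close>)
  moreover have "card (components (V, E)) \<le> card (components (V, E) - {?C u}) + 1"
    using diff_card_le_card_Diff[of "{?C u}" "components (V, E)"] by simp
  ultimately show ?thesis by linarith
qed

text \<open>The map from old to new components stays onto without the component of \<open>u\<close>,
  because the component of \<open>v\<close> has the same image.\<close>

lemma card_components_insert_less:
  assumes "finite V" "u \<in> V" "v \<in> V" "(u, v) \<notin> conn E"
  shows "card (components (V, insert {u, v} E)) < card (components (V, E))"
proof -
  let ?C = "comp_of (V, E)" and ?D = "comp_of (V, insert {u, v} E)"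
  have "components (V, insert {u, v} E) \<subseteq> (\<lambda>X. \<Union>x\<in>X. ?D x) ` (components (V, E) - {?C u})"
  proof
    fix X assume "X \<in> components (V, insert {u, v} E)"
    then obtain x where x: "x \<in> V" "X = ?D x" by (auto simp: components_eq)
    have "\<exists>y\<in>V. ?D y = X \<and> ?C y \<noteq> ?C u"
    proof (cases "(x, u) \<in> conn E")
      case True
      have "?D v = ?D x" using x assms(2,3) True by (simp add: comp_of_eq_iff conn_insert conn_sym)
      then show ?thesis
        using assms x comp_of_eq_iff[of u V v E] by auto
    next
      case False
      then show ?thesis using x assms comp_of_eq_iff[of x V u E] by auto
    qed
    then obtain y where y: "y \<in> V" "?D y = X" "?C y \<noteq> ?C u" by auto
    have "?D z = ?D y" if "z \<in> ?C y" for z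
      using that y(1) conn_mono[of E "insert {u, v} E" y z]
      by (subst comp_of_eq_iff) (auto simp: comp_of_def intro: conn_sym)
    moreover have "y \<in> ?C y" using y by (simp add: comp_of_def)
    ultimately have "(\<Union>z\<in>?C y. ?D z) = X" using y by blast
    then show "X \<in> (\<lambda>X. \<Union>x\<in>X. ?D x) ` (components (V, E) - {?C u})"
      using y by (auto simp: components_eq)
  qed
  then have "card (components (V, insert {u, v} E)) \<le> card (components (V, E) - {?C u})"
    using assms(1) by (intro surj_card_le) (auto simp: components_eq)
  also have "\<dots> < card (components (V, E))"
    using assms by (intro card_Diff1_less) (auto simp: components_eq)
  finally show ?thesis .
qed

lemma card_components_Un_le:
  assumes "finite V" "finite F" "F \<subseteq> all_edges V"
  shows "card (components (V, E)) \<le> card (components (V, E \<union> F)) + card F"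
  using assms(2,3)
proof (induction rule: finite_induct)
  case (insert e F)
  from insert.prems obtain u v where e: "e = {u, v}" "u \<in> V"
    by (auto elim: all_edgesE)
  have "card (components (V, E \<union> F)) \<le> card (components (V, insert e (E \<union> F))) + 1"
    unfolding e(1) by (rule card_components_insert_le[OF assms(1) e(2)])
  with insert show ?case by simp
qed simp

lemma conn_empty [simp]: "conn {} = Id"
  by (simp add: adj_def)

lemma card_components_empty: "card (components (V, {})) = card V"
proof -
  have "comp_of (V, {}) x = {x}" if "x \<in> V" for x using that by (auto simp: comp_of_def)
  then have "inj_on (comp_of (V, {})) V" by (auto simp: inj_on_def)
  then show ?thesis by (simp add: components_eq card_image)
qed

text \<open>Without edges there are \<open>card V\<close> components, and each edge lowers their
  number by at most one.\<close>

lemma card_verts_le: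
  assumes "finite V" "E \<subseteq> all_edges V"
  shows "card V \<le> card (components (V, E)) + card E"
  using card_components_Un_le[OF assms(1) finite_subset[OF assms(2)] assms(2), of "{}"]
  by (simp add: card_components_empty finite_all_edges assms(1))

lemma connected_graph_iff:
  "connected_graph (V, E) \<longleftrightarrow> V \<noteq> {} \<and> (\<forall>u\<in>V. \<forall>v\<in>V. (u, v) \<in> conn E)"
  by (simp add: connected_graph_def)

lemma connected_graph_from:
  assumes "a \<in> V" "\<And>x. x \<in> V \<Longrightarrow> (a, x) \<in> conn E"
  shows "connected_graph (V, E)"
  unfolding connected_graph_iff using assms by (blast intro: rtrancl_trans conn_sym)

lemma card_components_connected:
  assumes "connected_graph (V, E)"
  shows "card (components (V, E)) = 1"
proof -
  obtain a where "a \<in> V" using assms by (auto simp: connected_graph_iff)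
  then have "components (V, E) = {V}"
    using assms by (fastforce simp: components_eq comp_of_def connected_graph_iff)
  then show ?thesis by simp
qed

section \<open>Bridges, trees and edge counts\<close>

definition all_bridges :: "'v set set \<Rightarrow> bool" where
  "all_bridges E \<longleftrightarrow> (\<forall>u v. {u, v} \<in> E \<longrightarrow> (u, v) \<notin> conn (E - {{u, v}}))"

lemma all_bridges_subset:
  assumes "all_bridges E" "E' \<subseteq> E"
  shows "all_bridges E'"
  using assms conn_mono[of "E' - {{_, _}}" "E - {{_, _}}"] unfolding all_bridges_def by blast

lemma conn_path:
  assumes "(u, v) \<in> conn E"
  shows "\<exists>xs. xs \<noteq> [] \<and> hd xs = u \<and> last xs = v \<and> distinct xs \<and>
    successively (\<lambda>x y. {x, y} \<in> E) xs"
  using assms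
proof (induction rule: converse_rtrancl_induct)
  case base
  show ?case by (rule exI[of _ "[v]"]) simp
next
  case (step y z)
  then obtain xs where xs: "xs \<noteq> []" "hd xs = z" "last xs = v" "distinct xs"
    "successively (\<lambda>x y. {x, y} \<in> E) xs" by blast
  show ?case
  proof (cases "y \<in> set xs")
    case True
    then obtain as bs where "xs = as @ y # bs" by (auto simp: in_set_conv_decomp)
    with xs show ?thesis
      by (intro exI[of _ "y # bs"]) (auto simp: successively_append_iff)
  next
    case False
    with xs step.hyps show ?thesis
      by (intro exI[of _ "y # xs"]) (auto simp: successively_Cons)
  qed
qed

lemma successively_conn:
  assumes "successively (\<lambda>x y. {x, y} \<in> E) xs" "x \<in> set xs"
  shows "(hd xs, x) \<in> conn E"
  using assms
proof (induction xs)
  case (Cons y ys)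
  show ?case
  proof (cases ys)
    case (Cons z zs)
    with Cons.IH Cons.prems have "{y, z} \<in> E" "x \<noteq> y \<Longrightarrow> (z, x) \<in> conn E" by auto
    then show ?thesis by (cases "x = y") (auto intro: converse_rtrancl_into_rtrancl)
  qed (use Cons in simp)
qed simp

text \<open>A simple path that avoids the edge between its ends closes up with it to a cycle, and a
  cycle without its closing edge shows that this edge is no bridge. \<open>all_bridges\<close> is
  the working form of acyclicity: it mentions only \<open>conn\<close> and passes to
  subsets.\<close>

lemma no_cycle_iff_all_bridges:
  assumes "E \<subseteq> all_edges V"
  shows "(\<nexists>xs. is_cycle E xs) \<longleftrightarrow> all_bridges E"
proof
  assume *: "\<nexists>xs. is_cycle E xs"
  show "all_bridges E"
    unfolding all_bridges_def
  proof (intro allI impI notI)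
    fix u v
    assume e: "{u, v} \<in> E" and c: "(u, v) \<in> conn (E - {{u, v}})"
    obtain xs where xs: "xs \<noteq> []" "hd xs = u" "last xs = v" "distinct xs"
      "successively (\<lambda>x y. {x, y} \<in> E - {{u, v}}) xs"
      using conn_path[OF c] by blast
    have "u \<noteq> v" using e assms all_edges_iff[of u v V] by blast
    \<comment> \<open>The path avoids the edge \<open>{u, v}\<close> and
      \<open>u \<noteq> v\<close>, so it has at least the three vertices that
      \<open>is_cycle\<close> demands.\<close>
    obtain x y z ys where "xs = x # y # z # ys"
      using xs \<open>u \<noteq> v\<close> by (cases xs; cases "tl xs"; cases "tl (tl xs)") auto
    moreover have "successively (\<lambda>x y. {x, y} \<in> E) xs"
      using xs(5) by (rule successively_mono) auto
    ultimately have "is_cycle E xs"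
      using xs e by (simp add: is_cycle_def insert_commute)
    with * show False by blast
  qed
next
  assume br: "all_bridges E"
  show "\<nexists>xs. is_cycle E xs"
  proof
    assume "\<exists>xs. is_cycle E xs"
    then obtain xs where xs: "length xs \<ge> 3" "distinct xs"
      "successively (\<lambda>u v. {u, v} \<in> E) xs" "{last xs, hd xs} \<in> E"
      by (auto simp: is_cycle_def)
    let ?e = "{last xs, hd xs}" and ?n = "length xs"
    have ne: "xs \<noteq> []" using xs by auto
    have "successively (\<lambda>u v. {u, v} \<in> E - {?e}) xs"
      unfolding successively_conv_nth
    proof (intro allI impI)
      fix i assume i: "Suc i < ?n"
      \<comment> \<open>With at least three vertices, no two consecutive ones form the closing
        pair.\<close>
      have "{xs ! i, xs ! Suc i} \<noteq> {xs ! (?n - 1), xs ! 0}"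
      proof -
        have "xs ! i = xs ! 0 \<longleftrightarrow> i = 0" "xs ! Suc i \<noteq> xs ! 0"
          "xs ! Suc i = xs ! (?n - 1) \<longleftrightarrow> Suc i = ?n - 1"
          using i ne by (simp_all add: nth_eq_iff_index_eq[OF xs(2)])
        then show ?thesis using i xs(1) unfolding doubleton_eq_iff by linarith
      qed
      then show "{xs ! i, xs ! Suc i} \<in> E - {?e}"
        using i xs(3) ne by (simp add: successively_conv_nth last_conv_nth hd_conv_nth)
    qed
    from successively_conn[OF this, of "last xs"] ne
    have "(last xs, hd xs) \<in> conn (E - {?e})" by (auto intro: conn_sym)
    with br xs(4) show False by (simp add: all_bridges_def)
  qed
qed

text \<open>In a forest each added edge joins two components, so their number falls by exactly one:
  the case of equality in \<open>card_verts_le\<close>.\<close>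

lemma card_components_forest:
  assumes "finite V" "E \<subseteq> all_edges V" "all_bridges E"
  shows "card (components (V, E)) + card E = card V"
proof -
  have "finite E" using assms finite_all_edges finite_subset by blast
  then show ?thesis
    using assms(2,3)
  proof (induction rule: finite_induct)
    case empty
    then show ?case by (simp add: card_components_empty)
  next
    case (insert e E)
    from insert.prems obtain u v where e: "e = {u, v}" "u \<in> V" "v \<in> V"
      by (auto elim: all_edgesE)
    have "(u, v) \<notin> conn E"
      using insert e by (auto simp: all_bridges_def)
    with card_components_insert_less[OF assms(1) e(2,3)] card_components_insert_le[OF assms(1) e(2), of E v]
      insert.hyps insert.IH insert.prems all_bridges_subset[OF insert.prems(2), of E] e
    show ?case by fastforce
  qed
qed

lemma is_tree_iff_bridges:
  "is_tree (V, E) \<longleftrightarrow> finite V \<and> E \<subseteq> all_edges V \<and> connected_graph (V, E) \<and> all_bridges E"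
  using no_cycle_iff_all_bridges[of E V] by (auto simp: is_tree_def simple_graph_def)

text \<open>For the converse, an edge that is no bridge could be removed without disconnecting the
  graph, which would leave fewer edges than connectivity requires. Counting edges thus replaces any
  search for cycles.\<close>

lemma is_tree_iff_card:
  "is_tree (V, E) \<longleftrightarrow>
     finite V \<and> E \<subseteq> all_edges V \<and> connected_graph (V, E) \<and> card V = card E + 1"
proof
  assume "is_tree (V, E)"
  then show "finite V \<and> E \<subseteq> all_edges V \<and> connected_graph (V, E) \<and> card V = card E + 1"
    using card_components_forest[of V E] card_components_connected[of V E]
    by (simp add: is_tree_iff_bridges)
next
  assume *: "finite V \<and> E \<subseteq> all_edges V \<and> connected_graph (V, E) \<and> card V = card E + 1"
  have "all_bridges E"
    unfolding all_bridges_def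
  proof (intro allI impI notI)
    fix u v assume e: "{u, v} \<in> E" "(u, v) \<in> conn (E - {{u, v}})"
    from conn_remove_redundant[OF e(2)] have "connected_graph (V, E - {{u, v}})"
      using * by (simp add: connected_graph_iff)
    from card_components_connected[OF this] card_verts_le[of V "E - {{u, v}}"] *
    have "card E + 1 \<le> 1 + card (E - {{u, v}})" by auto
    moreover have "card (E - {{u, v}}) < card E"
      using e * by (intro card_Diff1_less) (auto intro: finite_subset finite_all_edges)
    ultimately show False by simp
  qed
  with * show "is_tree (V, E)" by (simp add: is_tree_iff_bridges)
qed

lemma is_tree_component:
  assumes "finite V" "E \<subseteq> all_edges V" "all_bridges E" "a \<in> V"
  shows "is_tree (comp_of (V, E) a, {e \<in> E. e \<subseteq> comp_of (V, E) a})"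
proof -
  have C: "comp_of (V, E) a = {x. (a, x) \<in> conn E}"
    using conn_in_verts[OF _ assms(2,4)] by (auto simp: comp_of_def)
  have "connected_graph (comp_of (V, E) a, {e \<in> E. e \<subseteq> comp_of (V, E) a})"
    using conn_within_reachable[of a _ E] unfolding C
    by (intro connected_graph_from[of a]) auto
  moreover have "finite (comp_of (V, E) a)" using assms(1) by (simp add: comp_of_def)
  moreover have "{e \<in> E. e \<subseteq> comp_of (V, E) a} \<subseteq> all_edges (comp_of (V, E) a)"
    using assms(2) by (auto simp: all_edges_def)
  moreover have "all_bridges {e \<in> E. e \<subseteq> comp_of (V, E) a}"
    using assms(3) by (rule all_bridges_subset) auto
  ultimately show ?thesis by (simp add: is_tree_iff_bridges)
qed

text \<open>A connecting edge set of least cardinality has only bridges, since a redundant edge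
  could be dropped.\<close>

lemma ex_spanning_tree:
  assumes "finite V" "E \<subseteq> all_edges V" "connected_graph (V, E)"
  shows "\<exists>E'\<subseteq>E. is_tree (V, E')"
proof -
  have fin: "finite E" using assms finite_all_edges finite_subset by blast
  let ?P = "\<lambda>E'. E' \<subseteq> E \<and> connected_graph (V, E')"
  obtain E' where E': "?P E'" and min: "\<And>E''. ?P E'' \<Longrightarrow> card E' \<le> card E''"
    using ex_has_least_nat[of ?P E card] assms(3) by blast
  have "all_bridges E'"
    unfolding all_bridges_def
  proof (intro allI impI notI)
    fix u v assume e: "{u, v} \<in> E'" "(u, v) \<in> conn (E' - {{u, v}})"
    from conn_remove_redundant[OF e(2)] have "?P (E' - {{u, v}})"
      using E' by (auto simp: connected_graph_iff)
    from min[OF this] have "card E' \<le> card (E' - {{u, v}})" .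
    moreover have "card (E' - {{u, v}}) < card E'"
      using e E' fin by (intro card_Diff1_less) (auto intro: finite_subset)
    ultimately show False by simp
  qed
  with E' assms show ?thesis by (intro exI[of _ E']) (auto simp: is_tree_iff_bridges)
qed

text \<open>Removing the bridge \<open>{p, q}\<close> leaves the side of \<open>p\<close>, which
  contains \<open>u\<close>, and the side of \<open>q\<close>, which contains \<open>v\<close>; the
  new edge reconnects them. This is the exchange behind the cut property in Prim's
  algorithm.\<close>

lemma tree_exchange:
  assumes "is_tree (V, E)" "{p, q} \<in> E" "u \<in> V" "v \<in> V" "{u, v} \<notin> E"
    "(u, p) \<in> conn (E - {{p, q}})" "(q, v) \<in> conn (E - {{p, q}})"
  shows "is_tree (V, insert {u, v} (E - {{p, q}}))"
proof -
  let ?D = "E - {{p, q}}"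
  have E: "insert {p, q} ?D = E" using assms by auto
  have fin: "finite E" using assms(1) by (auto simp: is_tree_iff_card intro: finite_subset finite_all_edges)
  have "u \<noteq> v"
  proof
    assume "u = v"
    then have "(p, q) \<in> conn ?D" using assms(6,7) by (meson conn_sym rtrancl_trans)
    then show False using assms(1,2) by (auto simp: is_tree_iff_bridges all_bridges_def)
  qed
  have "(x, y) \<in> conn (insert {u, v} ?D)" if "x \<in> V" "y \<in> V" for x y
  proof -
    have "(x, y) \<in> conn (insert {p, q} ?D)"
      using assms(1) that unfolding E by (auto simp: is_tree_iff_card connected_graph_iff)
    then consider "(x, y) \<in> conn ?D" | "(x, p) \<in> conn ?D" "(q, y) \<in> conn ?D"
      | "(x, q) \<in> conn ?D" "(p, y) \<in> conn ?D"
      unfolding conn_insert by blast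
    then show ?thesis
    proof cases
      case 2
      then have "(x, u) \<in> conn ?D" "(v, y) \<in> conn ?D"
        using conn_sym[OF assms(6)] conn_sym[OF assms(7)] by (meson rtrancl_trans)+
      then show ?thesis unfolding conn_insert by blast
    next
      case 3
      then have "(x, v) \<in> conn ?D" "(u, y) \<in> conn ?D"
        using assms(6,7) by (meson rtrancl_trans)+
      then show ?thesis unfolding conn_insert by blast
    qed (simp add: conn_insert)
  qed
  then have "connected_graph (V, insert {u, v} ?D)"
    using assms(1) by (auto simp: is_tree_iff_card connected_graph_iff)
  moreover have "card (insert {u, v} ?D) = card E"
    using assms(5) fin card_Suc_Diff1[OF fin assms(2)] by simp
  ultimately show ?thesis
    using assms \<open>u \<noteq> v\<close> by (auto simp: is_tree_iff_card)
qed

text \<open>Take a largest set between \<open>I\<close> and \<open>E\<close> that joins no two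
  clusters. Each of its components meets a cluster, as otherwise an edge of \<open>E\<close> leaving
  that component could be added. So components and clusters correspond, and the edges outside the
  set form the cut.\<close>

lemma ex_cut_into_clusters:
  assumes tree: "is_tree (V, E)" and "I \<subseteq> E" "0 < k"
    and R: "\<And>i. i < k \<Longrightarrow> R i \<noteq> {} \<and> R i \<subseteq> V"
    and within: "\<And>i x y. i < k \<Longrightarrow> x \<in> R i \<Longrightarrow> y \<in> R i \<Longrightarrow> (x, y) \<in> conn I"
    and apart: "\<And>i j x y. \<lbrakk>i < k; j < k; i \<noteq> j; x \<in> R i; y \<in> R j\<rbrakk> \<Longrightarrow> (x, y) \<notin> conn I"
  shows "\<exists>F C. F \<subseteq> E \<and> card F = k - 1 \<and> bij_betw C {..<k} (components (V, E - F)) \<and>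
    (\<forall>i<k. R i \<subseteq> C i)"
proof -
  have finV: "finite V" and EV: "E \<subseteq> all_edges V" and cn: "connected_graph (V, E)"
    and br: "all_bridges E" and cV: "card V = card E + 1"
    using tree is_tree_iff_bridges is_tree_iff_card by blast+
  have fin: "finite E" using EV finV finite_all_edges finite_subset by blast
  define P where "P = (\<lambda>E'. I \<subseteq> E' \<and> E' \<subseteq> E \<and>
    (\<forall>i<k. \<forall>j<k. i \<noteq> j \<longrightarrow> (\<forall>x\<in>R i. \<forall>y\<in>R j. (x, y) \<notin> conn E')))"
  have "P I" using assms by (auto simp: P_def)
  moreover have "\<forall>E'. P E' \<longrightarrow> card E' < Suc (card E)"
    using fin by (auto simp: P_def less_Suc_eq_le intro: card_mono)
  ultimately have "\<exists>E'. P E' \<and> (\<forall>E''. P E'' \<longrightarrow> card E'' \<le> card E')"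
    by (rule ex_has_greatest_nat)
  then obtain E' where PE': "P E'" and max: "\<And>E''. P E'' \<Longrightarrow> card E'' \<le> card E'"
    by blast
  note E' = PE'[unfolded P_def]
  have finE': "finite E'" using E' fin finite_subset by blast
  have reach: "\<exists>i<k. \<exists>x\<in>R i. (z, x) \<in> conn E'" if "z \<in> V" for z
  proof (rule ccontr)
    assume no: "\<not> ?thesis"
    obtain r where r: "r \<in> R 0" using R[of 0] \<open>0 < k\<close> by auto
    have "(z, r) \<in> conn E" using cn that r R[of 0] \<open>0 < k\<close> by (auto simp: connected_graph_iff)
    then obtain p q where pq: "{p, q} \<in> E" "(z, p) \<in> conn E'" "(z, q) \<notin> conn E'"
      using conn_crossing[of z r E "{x. (z, x) \<in> conn E'}"] no r \<open>0 < k\<close> by auto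
    have far: "(x, p) \<notin> conn E'" "(p, x) \<notin> conn E'" if "i < k" "x \<in> R i" for i x
      using no that pq(2) by (meson conn_sym rtrancl_trans)+
    have "P (insert {p, q} E')"
      using E' pq(1) far by (auto simp: P_def conn_insert)
    from max[OF this] have "{p, q} \<in> E'" using finE' by (auto simp: card_insert_if split: if_splits)
    then have "(z, q) \<in> conn E'" using pq(2) conn_edge by (meson rtrancl_trans)
    with pq(3) show False by blast
  qed
  define a where "a i = (SOME x. x \<in> R i)" for i
  have a: "a i \<in> R i" "a i \<in> V" if "i < k" for i
    using that R[of i] some_in_eq[of "R i"] unfolding a_def by auto
  define C where "C = (\<lambda>i. comp_of (V, E') (a i))"
  have sep: "i = j" if "i < k" "j < k" "x \<in> R i" "y \<in> R j" "(x, y) \<in> conn E'" for i j x y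
    using E' that by blast
  have win: "(x, y) \<in> conn E'" if "i < k" "x \<in> R i" "y \<in> R i" for i x y
    using E' within that conn_mono by metis
  have "inj_on C {..<k}"
  proof (rule inj_onI)
    fix i j assume ij: "i \<in> {..<k}" "j \<in> {..<k}" "C i = C j"
    then have "(a i, a j) \<in> conn E'" using a by (simp add: C_def comp_of_eq_iff)
    with ij a show "i = j" using sep[of i j "a i" "a j"] by simp
  qed
  moreover have "C ` {..<k} = components (V, E')"
  proof -
    have "comp_of (V, E') z \<in> C ` {..<k}" if z: "z \<in> V" for z
    proof -
      obtain i x where i: "i < k" "x \<in> R i" "(z, x) \<in> conn E'" using reach[OF z] by blast
      then have "(z, a i) \<in> conn E'" using win[OF i(1,2) a(1)[OF i(1)]] by (meson rtrancl_trans)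
      then have "comp_of (V, E') z = C i" using i a z by (simp add: C_def comp_of_eq_iff)
      then show ?thesis using i by blast
    qed
    then show ?thesis using a by (auto simp: components_eq C_def)
  qed
  ultimately have bij: "bij_betw C {..<k} (components (V, E'))" by (simp add: bij_betw_def)
  then have "card (components (V, E')) = k" using bij_betw_same_card by fastforce
  moreover have "card (components (V, E')) + card E' = card V"
    using card_components_forest[of V E'] finV E' EV all_bridges_subset[OF br] by auto
  \<comment> \<open>The forest count against the tree count:
    \<open>k + card E' = card V = card E + 1\<close>.\<close>
  ultimately have "card (E - E') = k - 1"
    using cV E' by (simp add: card_Diff_subset[OF finE'])
  moreover have "E - (E - E') = E'" using E' by auto
  moreover have "R i \<subseteq> C i" if "i < k" for i
    using R[OF that] win[OF that a(1)[OF that]] by (auto simp: C_def comp_of_def)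
  ultimately show ?thesis using bij by (intro exI[of _ "E - E'"] exI[of _ C]) auto
qed

section \<open>Total correctness with time bounds\<close>

text \<open>A nonempty set of runs is demanded so that a \<open>spec\<close> is never vacuous;
  quantifying over all runs reflects that choices are adversarial.\<close>

definition spec :: "'a comp \<Rightarrow> nat \<Rightarrow> ('a \<Rightarrow> bool) \<Rightarrow> bool" where
  "spec m b Q \<longleftrightarrow> (\<exists>S. m = Runs S \<and> S \<noteq> {} \<and> (\<forall>(x, t)\<in>S. t \<le> b \<and> Q x))"

text \<open>Turns the correctness of an algorithm into an existence proof, for some run produces an
  output.\<close>

lemma spec_ex: "spec m b Q \<Longrightarrow> \<exists>x. Q x"
  by (auto simp: spec_def)

lemma spec_mono:
  assumes "spec m b P" "b \<le> b'" "\<And>x. P x \<Longrightarrow> Q x"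
  shows "spec m b' Q"
proof -
  obtain S where "m = Runs S" "S \<noteq> {}" "\<And>x t. (x, t) \<in> S \<Longrightarrow> t \<le> b \<and> P x"
    using assms(1) by (auto simp: spec_def)
  moreover have "t \<le> b' \<and> Q x" if "(x, t) \<in> S" for x t
    using calculation(3)[OF that] assms(2,3) by auto
  ultimately show ?thesis unfolding spec_def by blast
qed

lemma spec_bind:
  assumes m: "spec m b1 P" and f: "\<And>x. P x \<Longrightarrow> spec (f x) b2 Q" and b: "b1 + b2 \<le> b"
  shows "spec (bind m f) b Q"
proof -
  obtain S where S: "m = Runs S" "S \<noteq> {}" "\<And>x t. (x, t) \<in> S \<Longrightarrow> t \<le> b1 \<and> P x"
    using m by (auto simp: spec_def)
  have f': "\<exists>S'. f x = Runs S' \<and> S' \<noteq> {} \<and> (\<forall>(y, t')\<in>S'. t' \<le> b2 \<and> Q y)" if "(x, t) \<in> S" for x t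
    using f[of x] S(3)[OF that] by (auto simp: spec_def)
  have "bind m f = Runs (\<Union>(x, t)\<in>S. (\<lambda>(y, t'). (y, t + t')) ` runs (f x))"
    using f' S(1) by (fastforce simp: bind_def)
  moreover have "(\<Union>(x, t)\<in>S. (\<lambda>(y, t'). (y, t + t')) ` runs (f x)) \<noteq> {}"
    using S(2) f' by fastforce
  moreover have "t \<le> b \<and> Q y" if yt: "(y, t) \<in> (\<Union>(x, t)\<in>S. (\<lambda>(y, t'). (y, t + t')) ` runs (f x))" for y t
  proof -
    obtain x t1 t2 where *: "(x, t1) \<in> S" "(y, t2) \<in> runs (f x)" "t = t1 + t2" using yt by auto
    have "t2 \<le> b2 \<and> Q y" using f'[OF *(1)] *(2) by auto
    with S(3)[OF *(1)] *(3) b show ?thesis by simp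
  qed
  ultimately show ?thesis unfolding spec_def by blast
qed

text \<open>The bound is literally a sum, so unification can match it. For this reason the time
  functions of sequential programs are nested sums bracketed in program order.\<close>

lemma spec_bind1:
  "spec m b1 P \<Longrightarrow> (\<And>x. P x \<Longrightarrow> spec (f x) b2 Q) \<Longrightarrow> spec (bind m f) (b1 + b2) Q"
  by (rule spec_bind[OF _ _ order_refl])

lemma spec_return: "Q x \<Longrightarrow> 1 \<le> b \<Longrightarrow> spec (return x) b Q"
  by (simp add: spec_def return_def)

lemma spec_return1: "Q x \<Longrightarrow> spec (return x) 1 Q"
  by (rule spec_return) simp_all

lemma spec_pick:
  assumes "xs \<noteq> []" "length xs \<le> b" "\<And>x. x \<in> set xs \<Longrightarrow> Q x"
  shows "spec (pick xs) b Q"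
  using assms by (auto simp: spec_def pick_def)

text \<open>Each element costs its test and one \<open>return\<close>, the empty list one more. The
  separate bounds \<open>N\<close> and \<open>B\<close> let one estimate in the input size serve
  lists of different lengths.\<close>

lemma spec_filter_c:
  assumes "\<And>x. x \<in> set xs \<Longrightarrow> spec (P x) b (\<lambda>r. r = q x)" "length xs \<le> N" "N * (b + 1) + 1 \<le> B"
  shows "spec (filter_c P xs) B (\<lambda>ys. ys = filter q xs)"
proof -
  have "spec (filter_c P xs) (length xs * (b + 1) + 1) (\<lambda>ys. ys = filter q xs)"
    using assms(1)
  proof (induction xs)
    case (Cons x xs)
    have IH: "spec (filter_c P xs) (length xs * (b + 1) + 1) (\<lambda>ys. ys = filter q xs)"
      by (rule Cons.IH) (simp add: Cons.prems)
    show ?case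
      unfolding filter_c.simps
      by (rule spec_bind[OF Cons.prems], simp, rule spec_bind1[OF IH], rule spec_return1) auto
  qed (auto intro: spec_return)
  moreover have "length xs * (b + 1) + 1 \<le> B"
    using assms(2,3) mult_le_mono1[of "length xs" N "b + 1"] by linarith
  ultimately show ?thesis by (rule spec_mono)
qed

lemma spec_map_c:
  assumes "\<And>x. x \<in> set xs \<Longrightarrow> spec (f x) b (Q x)" "length xs \<le> N" "N * (b + 1) + 1 \<le> B"
  shows "spec (map_c f xs) B (list_all2 Q xs)"
proof -
  have "spec (map_c f xs) (length xs * (b + 1) + 1) (list_all2 Q xs)"
    using assms(1)
  proof (induction xs)
    case (Cons x xs)
    have IH: "spec (map_c f xs) (length xs * (b + 1) + 1) (list_all2 Q xs)"
      by (rule Cons.IH) (simp add: Cons.prems)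
    show ?case
      unfolding map_c.simps
      by (rule spec_bind[OF Cons.prems], simp, rule spec_bind1[OF IH], rule spec_return1) auto
  qed (auto intro: spec_return)
  moreover have "length xs * (b + 1) + 1 \<le> B"
    using assms(2,3) mult_le_mono1[of "length xs" N "b + 1"] by linarith
  ultimately show ?thesis by (rule spec_mono)
qed

text \<open>The invariant speaks of the prefix already processed, and the step may use the splitting
  of the whole list; this is how freshness of an element or progress by rounds becomes available.
  Only the empty list returns, hence a single extra step.\<close>

lemma spec_fold_c:
  assumes "I [] s"
    "\<And>ys x zs s. xs = ys @ x # zs \<Longrightarrow> I ys s \<Longrightarrow> spec (f x s) b (I (ys @ [x]))"
    "length xs \<le> N" "N * b + 1 \<le> B"
  shows "spec (fold_c f xs s) B (I xs)"
proof -
  have "spec (fold_c f zs s) (length zs * b + 1) (I xs)" if "xs = ys @ zs" "I ys s" for ys zs s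
    using that
  proof (induction zs arbitrary: ys s)
    case (Cons z zs)
    show ?case
      unfolding fold_c.simps
    proof (rule spec_bind[OF assms(2)[OF Cons.prems]])
      fix s' assume "I (ys @ [z]) s'"
      with Cons.prems(1) show "spec (fold_c f zs s') (length zs * b + 1) (I xs)"
        by (intro Cons.IH[of "ys @ [z]"]) simp_all
    qed simp
  qed (auto intro: spec_return)
  from this[of "[]" xs s] have "spec (fold_c f xs s) (length xs * b + 1) (I xs)"
    using assms(1) by simp
  moreover have "length xs * b + 1 \<le> B"
    using assms(3,4) mult_le_mono1[of "length xs" N b] by linarith
  ultimately show ?thesis by (rule spec_mono)
qed

lemma spec_append_c:
  assumes "length xs + 1 \<le> b"
  shows "spec (append_c xs ys) b (\<lambda>zs. zs = xs @ ys)"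
proof -
  have "spec (append_c xs ys) (length xs + 1) (\<lambda>zs. zs = xs @ ys)"
  proof (induction xs)
    case (Cons x xs)
    show ?case unfolding append_c.simps
      by (rule spec_bind[OF Cons.IH], rule spec_return1) auto
  qed (auto intro: spec_return)
  then show ?thesis using assms by (rule spec_mono)
qed

lemma spec_filter_return:
  assumes "length xs \<le> N" "2 * N + 1 \<le> b"
  shows "spec (filter_c (\<lambda>x. return (q x)) xs) b (\<lambda>ys. ys = filter q xs)"
  by (rule spec_filter_c[where b = 1]) (use assms in \<open>auto intro: spec_return\<close>)

lemma spec_remove_c:
  assumes "length xs \<le> N" "2 * N + 1 \<le> b"
  shows "spec (remove_c x xs) b (\<lambda>ys. ys = filter (\<lambda>y. y \<noteq> x) xs)"
  unfolding remove_c_def using assms by (rule spec_filter_return)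

lemma spec_member_c:
  assumes "length xs \<le> N" "2 * N + 2 \<le> b"
  shows "spec (member_c x xs) b (\<lambda>r. r = (x \<in> set xs))"
  unfolding member_c_def
  by (rule spec_bind[OF spec_filter_return[OF assms(1) order_refl]], rule spec_return1)
    (use assms(2) in \<open>auto simp: filter_empty_conv\<close>)

lemma spec_minus_c:
  assumes "length xs \<le> N" "length ys \<le> N" "N * (2 * N + 4) + 1 \<le> b"
  shows "spec (minus_c xs ys) b (\<lambda>zs. zs = filter (\<lambda>x. x \<notin> set ys) xs)"
  unfolding minus_c_def
  by (rule spec_filter_c[where b = "2 * N + 3"], rule spec_bind[OF spec_member_c[OF assms(2) order_refl]],
      rule spec_return1) (use assms in \<open>auto simp: algebra_simps\<close>)

lemma spec_ends_in_c:
  assumes "length xs \<le> N" "2 * N + 1 \<le> b"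
  shows "spec (ends_in_c e xs) b (\<lambda>ys. ys = filter (\<lambda>x. x \<in> e) xs)"
  unfolding ends_in_c_def using assms by (rule spec_filter_return)

lemma spec_incident_c:
  assumes "length es \<le> N" "2 * N + 1 \<le> b"
  shows "spec (incident_c x es) b (\<lambda>ys. ys = filter (\<lambda>e. x \<in> e) es)"
  unfolding incident_c_def using assms by (rule spec_filter_return)

section \<open>Polynomial time bounds written as functions\<close>

definition polyfun :: "(nat \<Rightarrow> nat) \<Rightarrow> bool" where
  "polyfun f \<longleftrightarrow> (\<exists>p. f = poly p)"

lemma polyfun_const: "polyfun (\<lambda>_. c)"
  unfolding polyfun_def by (rule exI[of _ "[:c:]"]) auto

lemma polyfun_id: "polyfun (\<lambda>n. n)"
  unfolding polyfun_def by (rule exI[of _ "[:0, 1:]"]) auto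

lemma polyfun_add:
  assumes "polyfun f" "polyfun g"
  shows "polyfun (\<lambda>n. f n + g n)"
proof -
  obtain p q where "f = poly p" "g = poly q" using assms by (auto simp: polyfun_def)
  then have "(\<lambda>n. f n + g n) = poly (p + q)" by auto
  then show ?thesis unfolding polyfun_def ..
qed

lemma polyfun_mult:
  assumes "polyfun f" "polyfun g"
  shows "polyfun (\<lambda>n. f n * g n)"
proof -
  obtain p q where "f = poly p" "g = poly q" using assms by (auto simp: polyfun_def)
  then have "(\<lambda>n. f n * g n) = poly (p * q)" by auto
  then show ?thesis unfolding polyfun_def ..
qed

lemma polyfun_poly:
  assumes "polyfun f"
  shows "polyfun (\<lambda>n. poly p (f n))"
proof -
  obtain q where "f = poly q" using assms by (auto simp: polyfun_def)
  then have "(\<lambda>n. poly p (f n)) = poly (p \<circ>\<^sub>p q)" by (auto simp: poly_pcompose)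
  then show ?thesis unfolding polyfun_def ..
qed

lemmas polyfun_intros = polyfun_const polyfun_id polyfun_add polyfun_mult polyfun_poly

text \<open>Natural coefficients are nonnegative. An upper bound on the size of a subroutine's input
  thus bounds its running time.\<close>

lemma poly_nat_mono: "m \<le> n \<Longrightarrow> poly p m \<le> poly p n" for p :: "nat poly"
  by (induction p) (simp_all add: add_mono mult_mono)

section \<open>Hamiltonian paths in the cube of a tree\<close>

lemma other_end_left [simp]: "u \<noteq> v \<Longrightarrow> other_end u {u, v} = v"
  by (simp add: other_end_def insert_Diff_if)

lemma other_end_right [simp]: "u \<noteq> v \<Longrightarrow> other_end v {u, v} = u"
  by (simp add: other_end_def insert_Diff_if)

section \<open>Ends of an edge in a list, and the component of a vertex\<close>

lemma filter_in_edge: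
  assumes "distinct xs" "u \<noteq> v"
  shows "length (filter (\<lambda>x. x \<in> {u, v}) xs) = card ({u, v} \<inter> set xs)"
  by (subst distinct_card[symmetric]) (use assms in \<open>auto intro!: arg_cong[where f = card]\<close>)

text \<open>The programs locate an edge relative to a vertex set by the number of its ends found in
  a list: one for an edge across the cut, none for an edge outside, two for an edge inside.
  Distinctness of the list makes this number reliable.\<close>

lemma hits_cases:
  assumes "distinct xs" "e \<in> all_edges V" "hits = filter (\<lambda>x. x \<in> e) xs"
  obtains u v where "hits = [u]" "e = {u, v}" "u \<noteq> v" "u \<in> set xs" "v \<notin> set xs"
  | "hits = []" "e \<inter> set xs = {}"
  | x y where "hits = [x, y]" "e \<subseteq> set xs"
proof -
  obtain u v where e: "e = {u, v}" "u \<noteq> v" using assms(2) by (auto elim: all_edgesE)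
  have len: "length hits = card ({u, v} \<inter> set xs)"
    using filter_in_edge[OF assms(1) e(2)] e(1) assms(3) by simp
  have set: "set hits = {u, v} \<inter> set xs" using assms(3) e(1) by auto
  consider "u \<in> set xs" "v \<in> set xs" | "u \<in> set xs" "v \<notin> set xs"
    | "u \<notin> set xs" "v \<in> set xs" | "u \<notin> set xs" "v \<notin> set xs" by blast
  then show ?thesis
  proof cases
    case 1
    then have "length hits = Suc (Suc 0)" using len e(2) by auto
    then obtain x y where "hits = [x, y]" by (auto simp: length_Suc_conv)
    then show ?thesis using 1 e that(3) by auto
  next
    case 2
    then have "length hits = Suc 0" and u: "set hits = {u}" using len set by auto
    then obtain w where "hits = [w]" by (auto simp: length_Suc_conv)
    with u have "hits = [u]" by simp
    then show ?thesis using 2 e that(1) by auto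
  next
    case 3
    then have "length hits = Suc 0" and v: "set hits = {v}" using len set by auto
    then obtain w where "hits = [w]" by (auto simp: length_Suc_conv)
    with v have "hits = [v]" by simp
    then show ?thesis using 3 e that(1)[of v u] by (auto simp: insert_commute)
  next
    case 4
    then have "hits = []" using len by simp
    then show ?thesis using 4 e that(2) by auto
  qed
qed

text \<open>The component is connected by its own edges, so it has at most one vertex more than
  edges. This bounds the search list by the number of edges alone.\<close>

lemma card_reachable_le:
  assumes "finite E" "E \<subseteq> all_edges V"
  shows "finite {x. (a, x) \<in> conn E}" "card {x. (a, x) \<in> conn E} \<le> card E + 1"
proof -
  let ?C = "{x. (a, x) \<in> conn E}" and ?E = "{e \<in> E. e \<subseteq> {x. (a, x) \<in> conn E}}"
  have "?C \<subseteq> insert a (\<Union>E)"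
  proof
    fix x assume "x \<in> ?C"
    then have "(a, x) \<in> conn E" by simp
    then show "x \<in> insert a (\<Union>E)" by cases auto
  qed
  moreover have "finite (\<Union>E)"
  proof (rule finite_Union[OF assms(1)])
    fix e assume "e \<in> E"
    then have "card e = 2" using assms(2) by (auto simp: all_edges_def)
    then show "finite e" using card.infinite by fastforce
  qed
  ultimately show fin: "finite ?C" using finite_subset by blast
  have sub: "?E \<subseteq> all_edges ?C" using assms(2) by (auto simp: all_edges_def)
  have "connected_graph (?C, ?E)"
    using conn_within_reachable[of a _ E] by (intro connected_graph_from[of a]) auto
  from card_components_connected[OF this] card_verts_le[OF fin sub]
  have "card ?C \<le> card ?E + 1" by simp
  also have "card ?E \<le> card E" using assms(1) by (intro card_mono) auto
  finally show "card ?C \<le> card E + 1" by simp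
qed

definition closed_under :: "'v set set \<Rightarrow> 'v set \<Rightarrow> bool" where
  "closed_under E X \<longleftrightarrow> (\<forall>u v. {u, v} \<in> E \<longrightarrow> u \<in> X \<longrightarrow> v \<in> X)"

text \<open>At most \<open>N\<close> sweeps over at most \<open>N\<close> edges; for one edge,
  \<open>2 * (N + 1) + 1\<close> steps to filter a list of at most \<open>N + 1\<close> vertices and
  one step to return.\<close>

definition reach_time :: "nat \<Rightarrow> nat" where
  "reach_time N = N * (N * (2 * N + 4) + 1) + 1"

text \<open>A sweep that adds nothing has reached the whole component, which has at most
  \<open>length es + 1\<close> vertices.\<close>

lemma spec_reachable_c:
  assumes es: "set es \<subseteq> all_edges V" "distinct es" and N: "length es \<le> N" "reach_time N \<le> b"
  shows "spec (reachable_c es a) b (\<lambda>xs. distinct xs \<and> set xs = {x. (a, x) \<in> conn (set es)})"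
proof -
  let ?C = "{x. (a, x) \<in> conn (set es)}"
  define ok where "ok xs \<longleftrightarrow> distinct xs \<and> a \<in> set xs \<and> set xs \<subseteq> ?C" for xs
  have fin: "finite ?C" and card: "card ?C \<le> length es + 1"
    using card_reachable_le[OF _ es(1), of a] distinct_card[OF es(2)] by auto
  have len: "length xs \<le> N + 1" if "ok xs" for xs
    using card_mono[OF fin, of "set xs"] that card N distinct_card[of xs] by (auto simp: ok_def)
  define sweep where "sweep = fold_c (\<lambda>e xs. do {
         hits \<leftarrow> ends_in_c e xs;
         return (case hits of [x] \<Rightarrow> other_end x e # xs | _ \<Rightarrow> xs)
       }) es"
  have step: "spec (do {
         hits \<leftarrow> ends_in_c e xs;
         return (case hits of [x] \<Rightarrow> other_end x e # xs | _ \<Rightarrow> xs)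
       }) (2 * N + 4) (\<lambda>ys. ok ys \<and> set xs \<subseteq> set ys \<and> (e \<inter> set xs = {} \<longrightarrow> ys = xs) \<and>
          (e \<inter> set xs \<noteq> {} \<longrightarrow> e \<subseteq> set ys) \<and> (e \<subseteq> set xs \<longrightarrow> ys = xs))"
    if e: "e \<in> set es" and xs: "ok xs" for e xs
  proof (rule spec_bind[OF spec_ends_in_c[OF len[OF xs] order_refl]])
    fix hits assume hits: "hits = filter (\<lambda>x. x \<in> e) xs"
    have "distinct xs" "e \<in> all_edges V" using xs e es by (auto simp: ok_def)
    from hits_cases[OF this hits]
    show "spec (return (case hits of [x] \<Rightarrow> other_end x e # xs | _ \<Rightarrow> xs)) 1
      (\<lambda>ys. ok ys \<and> set xs \<subseteq> set ys \<and> (e \<inter> set xs = {} \<longrightarrow> ys = xs) \<and>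
          (e \<inter> set xs \<noteq> {} \<longrightarrow> e \<subseteq> set ys) \<and> (e \<subseteq> set xs \<longrightarrow> ys = xs))"
    proof cases
      case (1 u v)
      have "(a, u) \<in> conn (set es)" using 1 xs by (auto simp: ok_def)
      moreover have "(u, v) \<in> adj (set es)" using 1 e by auto
      ultimately have "(a, v) \<in> conn (set es)" by (rule rtrancl_into_rtrancl)
      with 1 xs show ?thesis by (intro spec_return) (auto simp: ok_def)
    next
      case 2
      with xs show ?thesis by (intro spec_return) auto
    next
      case (3 x y)
      moreover have "e \<noteq> {}" using \<open>e \<in> all_edges V\<close> by (auto simp: all_edges_def)
      ultimately show ?thesis using xs by (intro spec_return) auto
    qed
  qed simp
  have sweep: "spec (sweep xs) (N * (2 * N + 4) + 1)
      (\<lambda>ys. ok ys \<and> (closed_under (set es) (set xs) \<longrightarrow> ys = xs) \<and>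
        (\<not> closed_under (set es) (set xs) \<longrightarrow> length xs < length ys))"
    if xs: "ok xs" for xs
    unfolding sweep_def
  proof (rule spec_mono[OF spec_fold_c[where N = N and b = "2 * N + 4" and I =
        "\<lambda>ds ys. ok ys \<and> set xs \<subseteq> set ys \<and> (closed_under (set es) (set xs) \<longrightarrow> ys = xs) \<and>
           (\<forall>e\<in>set ds. e \<inter> set xs \<noteq> {} \<longrightarrow> e \<subseteq> set ys)"] order_refl])
    fix ds e ds' ys
    assume "es = ds @ e # ds'" and I: "ok ys \<and> set xs \<subseteq> set ys \<and>
      (closed_under (set es) (set xs) \<longrightarrow> ys = xs) \<and> (\<forall>e\<in>set ds. e \<inter> set xs \<noteq> {} \<longrightarrow> e \<subseteq> set ys)"
    then have e: "e \<in> set es" by simp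
    show "spec (do {
         hits \<leftarrow> ends_in_c e ys;
         return (case hits of [x] \<Rightarrow> other_end x e # ys | _ \<Rightarrow> ys)
       }) (2 * N + 4) (\<lambda>ys. ok ys \<and> set xs \<subseteq> set ys \<and> (closed_under (set es) (set xs) \<longrightarrow> ys = xs) \<and>
           (\<forall>e\<in>set (ds @ [e]). e \<inter> set xs \<noteq> {} \<longrightarrow> e \<subseteq> set ys))"
    proof (rule spec_mono[OF step[OF e] order_refl])
      show "ok ys" using I by simp
      fix zs assume zs: "ok zs \<and> set ys \<subseteq> set zs \<and> (e \<inter> set ys = {} \<longrightarrow> zs = ys) \<and>
          (e \<inter> set ys \<noteq> {} \<longrightarrow> e \<subseteq> set zs) \<and> (e \<subseteq> set ys \<longrightarrow> zs = ys)"
      have "zs = xs" if c: "closed_under (set es) (set xs)"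
      proof -
        have "ys = xs" using I c by simp
        moreover obtain u v where uv: "e = {u, v}" using subsetD[OF es(1) e] by (auto elim: all_edgesE)
        moreover have "u \<in> set xs \<longleftrightarrow> v \<in> set xs"
          using c e uv unfolding closed_under_def by (metis insert_commute)
        ultimately show ?thesis using zs by auto
      qed
      with zs I show "ok zs \<and> set xs \<subseteq> set zs \<and> (closed_under (set es) (set xs) \<longrightarrow> zs = xs) \<and>
           (\<forall>e\<in>set (ds @ [e]). e \<inter> set xs \<noteq> {} \<longrightarrow> e \<subseteq> set zs)"
        by auto
    qed
  next
    fix ys assume ys: "ok ys \<and> set xs \<subseteq> set ys \<and> (closed_under (set es) (set xs) \<longrightarrow> ys = xs) \<and>
           (\<forall>e\<in>set es. e \<inter> set xs \<noteq> {} \<longrightarrow> e \<subseteq> set ys)"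
    have "length xs < length ys" if nc: "\<not> closed_under (set es) (set xs)"
    proof -
      obtain u v where "{u, v} \<in> set es" "u \<in> set xs" "v \<notin> set xs"
        using nc by (auto simp: closed_under_def)
      then have "v \<in> set ys" using ys by auto
      then have "set xs \<subset> set ys" using ys \<open>v \<notin> set xs\<close> by auto
      then show ?thesis using psubset_card_mono[of "set ys" "set xs"] xs ys
        by (auto simp: ok_def distinct_card)
    qed
    with ys show "ok ys \<and> (closed_under (set es) (set xs) \<longrightarrow> ys = xs) \<and>
        (\<not> closed_under (set es) (set xs) \<longrightarrow> length xs < length ys)" by simp
  qed (use xs N in auto)
  have "spec (reachable_c es a) b
    (\<lambda>xs. ok xs \<and> (closed_under (set es) (set xs) \<or> length es < length xs))"
    unfolding reachable_c_def sweep_def[symmetric]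
  \<comment> \<open>The start vertex and at least one new vertex per sweep, unless the list is
    already closed, account for the strict inequality.\<close>
  proof (rule spec_fold_c[where N = N and b = "N * (2 * N + 4) + 1" and I =
        "\<lambda>ds xs. ok xs \<and> (closed_under (set es) (set xs) \<or> length ds < length xs)"])
    fix ds e ds' xs
    assume I: "ok xs \<and> (closed_under (set es) (set xs) \<or> length (ds :: 'a set list) < length xs)"
    then have "ok xs" by simp
    from sweep[OF this] show "spec (sweep xs) (N * (2 * N + 4) + 1)
        (\<lambda>xs. ok xs \<and> (closed_under (set es) (set xs) \<or> length (ds @ [e]) < length xs))"
      by (rule spec_mono) (use I in auto)
  qed (use N in \<open>auto simp: ok_def reach_time_def\<close>)
  then show ?thesis
  proof (rule spec_mono[OF _ order_refl])
    fix xs assume xs: "ok xs \<and> (closed_under (set es) (set xs) \<or> length es < length xs)"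
    have "?C \<subseteq> set xs"
    proof (cases "closed_under (set es) (set xs)")
      case True
      have "x \<in> set xs" if "(a, x) \<in> conn (set es)" for x
        using that by (induction rule: rtrancl_induct) (use xs True in \<open>auto simp: ok_def closed_under_def\<close>)
      then show ?thesis by blast
    next
      case False
      then have "card ?C \<le> card (set xs)" using xs card by (auto simp: ok_def distinct_card)
      then show ?thesis using card_seteq[OF fin, of "set xs"] xs by (auto simp: ok_def)
    qed
    with xs show "distinct xs \<and> set xs = ?C" by (auto simp: ok_def)
  qed
qed

definition comp_time :: "nat \<Rightarrow> nat" where
  "comp_time N = reach_time N + (N * (2 * N + 6) + 1)"

text \<open>An edge with one end in the component lies in it entirely, so a single hit is a
  sufficient test.\<close>

lemma spec_component_edges_c:
  assumes es: "set es \<subseteq> all_edges V" "distinct es" and N: "length es \<le> N" "comp_time N \<le> b"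
  shows "spec (component_edges_c es a) b (\<lambda>ds. ds = filter (\<lambda>e. e \<subseteq> {x. (a, x) \<in> conn (set es)}) es)"
  unfolding component_edges_c_def
proof (rule spec_bind[OF spec_reachable_c[OF es N(1) order_refl]])
  let ?C = "{x. (a, x) \<in> conn (set es)}"
  fix xs assume xs: "distinct xs \<and> set xs = ?C"
  have "length xs \<le> N + 1"
    using card_reachable_le[OF _ es(1), of a] xs N distinct_card[OF es(2)] distinct_card[of xs] by simp
  have "spec (do { hits \<leftarrow> ends_in_c e xs; return (hits \<noteq> []) }) (2 * N + 5) (\<lambda>r. r = (e \<subseteq> ?C))"
    if e: "e \<in> set es" for e
  proof (rule spec_bind[OF spec_ends_in_c[OF \<open>length xs \<le> N + 1\<close> order_refl]], rule spec_return1)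
    fix hits assume hits: "hits = filter (\<lambda>x. x \<in> e) xs"
    obtain u v where uv: "e = {u, v}" using subsetD[OF es(1) e] by (auto elim: all_edgesE)
    have "(a, u) \<in> conn (set es) \<longleftrightarrow> (a, v) \<in> conn (set es)"
      using conn_edge[of u v "set es"] e uv by (meson conn_sym rtrancl_trans)
    then show "(hits \<noteq> []) = (e \<subseteq> ?C)"
      using hits xs uv by (auto simp: filter_empty_conv)
  qed auto
  then show "spec (filter_c (\<lambda>e. do { hits \<leftarrow> ends_in_c e xs; return (hits \<noteq> []) }) es) (N * (2 * N + 6) + 1)
      (\<lambda>ds. ds = filter (\<lambda>e. e \<subseteq> ?C) es)"
    by (rule spec_filter_c) (use N in auto)
qed (use N in \<open>simp add: comp_time_def\<close>)

definition first_time :: "nat \<Rightarrow> nat" where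
  "first_time N = (2 * N + 1) + (N * ((2 * N + 1) + (reach_time N + (2 * (N + 1) + 2)) + 1) + 1) + N"

lemma first_edge_on_path:
  assumes "(a, b) \<in> conn E" "a \<noteq> b"
  shows "\<exists>v. {a, v} \<in> E \<and> (v, b) \<in> conn (E - {{a, v}})"
proof -
  \<comment> \<open>The disjunct \<open>b = a\<close> absorbs walks that come back to
    \<open>a\<close> along the chosen edge; the next step out of \<open>a\<close> then chooses
    afresh.\<close>
  have "b = a \<or> (\<exists>v. {a, v} \<in> E \<and> (v, b) \<in> conn (E - {{a, v}}))"
    using assms(1)
  proof (induction rule: rtrancl_induct)
    case (step y z)
    show ?case
    proof (cases "y = a")
      case True
      then show ?thesis using step.hyps by auto
    next
      case False
      then obtain v where v: "{a, v} \<in> E" "(v, y) \<in> conn (E - {{a, v}})" using step.IH by blast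
      show ?thesis
      proof (cases "{y, z} = {a, v}")
        case True
        then show ?thesis using False by (auto simp: doubleton_eq_iff)
      next
        case neq: False
        then have "(y, z) \<in> adj (E - {{a, v}})" using step.hyps by auto
        with v show ?thesis by (meson rtrancl_into_rtrancl)
      qed
    qed
  qed simp
  with assms(2) show ?thesis by blast
qed

text \<open>\<open>first_edge_on_path\<close> provides a candidate, so \<open>pick\<close> cannot
  fail; the far end of every candidate stays connected to \<open>b\<close> when the candidate is
  removed, which is what the recursion relies on.\<close>

lemma spec_first_edge_c:
  assumes es: "set es \<subseteq> all_edges V" "distinct es" and N: "length es \<le> N" "first_time N \<le> t"
    and ab: "(a, b) \<in> conn (set es)" "a \<noteq> b"
  shows "spec (first_edge_c es a b) t
    (\<lambda>e. \<exists>v. e = {a, v} \<and> {a, v} \<in> set es \<and> (v, b) \<in> conn (set es - {{a, v}}))"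
  unfolding first_edge_c_def
proof (rule spec_bind[OF spec_incident_c[OF N(1) order_refl], where ?b2.0 = "first_time N - (2 * N + 1)"])
  fix ds assume ds: "ds = filter (\<lambda>e. a \<in> e) es"
  let ?q = "\<lambda>e. (other_end a e, b) \<in> conn (set es - {e})"
  show "spec (do {
      fs \<leftarrow> filter_c (\<lambda>e. do {
         es' \<leftarrow> remove_c e es;
         xs \<leftarrow> reachable_c es' (other_end a e);
         member_c b xs
       }) ds;
      pick fs
    }) (first_time N - (2 * N + 1))
    (\<lambda>e. \<exists>v. e = {a, v} \<and> {a, v} \<in> set es \<and> (v, b) \<in> conn (set es - {{a, v}}))"
  proof (rule spec_bind[OF spec_filter_c[where q = ?q and N = N and
      b = "(2 * N + 1) + (reach_time N + (2 * (N + 1) + 2))"]])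
    fix e assume "e \<in> set ds"
    show "spec (do {
         es' \<leftarrow> remove_c e es;
         xs \<leftarrow> reachable_c es' (other_end a e);
         member_c b xs
       }) ((2 * N + 1) + (reach_time N + (2 * (N + 1) + 2))) (\<lambda>r. r = ?q e)"
    proof (rule spec_bind[OF spec_remove_c[OF N(1) order_refl]])
      fix es' assume es': "es' = filter (\<lambda>y. y \<noteq> e) es"
      have set: "set es' = set es - {e}" using es' by auto
      have sub: "set es' \<subseteq> all_edges V" "distinct es'" using es es' by auto
      have len': "length es' \<le> N" using es' N length_filter_le order_trans by blast
      show "spec (do { xs \<leftarrow> reachable_c es' (other_end a e); member_c b xs })
        (reach_time N + (2 * (N + 1) + 2)) (\<lambda>r. r = ?q e)"
      proof (rule spec_bind[OF spec_reachable_c[OF sub len' order_refl]])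
        fix xs assume xs: "distinct xs \<and> set xs = {x. (other_end a e, x) \<in> conn (set es')}"
        have "length xs \<le> N + 1"
          using card_reachable_le[OF _ sub(1), of "other_end a e"] xs len' distinct_card[OF sub(2)] distinct_card[of xs]
          by simp
        from spec_member_c[OF this order_refl, of b]
        show "spec (member_c b xs) (2 * (N + 1) + 2) (\<lambda>r. r = ?q e)"
          by (rule spec_mono) (use xs set in auto)
      qed simp
    qed simp
  next
    fix fs assume fs: "fs = filter ?q ds"
    obtain v where v: "{a, v} \<in> set es" "(v, b) \<in> conn (set es - {{a, v}})"
      using first_edge_on_path[OF ab] by blast
    have "a \<noteq> v" using v es(1) all_edges_iff[of a v V] by blast
    then have "{a, v} \<in> set fs" using v fs ds by auto
    then have ne: "fs \<noteq> []" by auto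
    show "spec (pick fs) N
      (\<lambda>e. \<exists>v. e = {a, v} \<and> {a, v} \<in> set es \<and> (v, b) \<in> conn (set es - {{a, v}}))"
    proof (rule spec_pick[OF ne])
      show "length fs \<le> N" using fs ds N(1) by (meson length_filter_le order_trans)
      fix e assume e: "e \<in> set fs"
      then obtain x y where xy: "e = {x, y}" "x \<noteq> y" using fs ds es(1) by (auto elim!: all_edgesE)
      have "a = x \<or> a = y" using e fs ds xy by auto
      then obtain v where "e = {a, v}" "v \<noteq> a" using xy by (metis insert_commute)
      with e fs ds show "\<exists>v. e = {a, v} \<and> {a, v} \<in> set es \<and> (v, b) \<in> conn (set es - {{a, v}})"
        by (intro exI[of _ v]) auto
    qed
  qed (use ds N in \<open>auto simp: first_time_def intro: order_trans[OF length_filter_le]\<close>)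
qed (use N in \<open>simp add: first_time_def\<close>)

section \<open>Paths, their edges and their costs\<close>

fun path_edges :: "'v list \<Rightarrow> 'v set list" where
  "path_edges (x # y # zs) = {x, y} # path_edges (y # zs)"
| "path_edges xs = []"

text \<open>Extended by 0 to equal arguments, so that the triangle inequality holds without
  distinctness and a partial path with a single vertex fits the same estimates.\<close>

definition dist_of :: "('v set \<Rightarrow> real) \<Rightarrow> 'v \<Rightarrow> 'v \<Rightarrow> real" where
  "dist_of c u v = (if u = v then 0 else c {u, v})"

fun path_cost :: "('v set \<Rightarrow> real) \<Rightarrow> 'v list \<Rightarrow> real" where
  "path_cost c (x # y # zs) = dist_of c x y + path_cost c (y # zs)"
| "path_cost c xs = 0"

lemma dist_of_refl [simp]: "dist_of c u u = 0"
  by (simp add: dist_of_def)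

lemma dist_of_neq: "u \<noteq> v \<Longrightarrow> dist_of c u v = c {u, v}"
  by (simp add: dist_of_def)

lemma dist_of_commute: "dist_of c u v = dist_of c v u"
  by (simp add: dist_of_def insert_commute)

lemma path_cost_append:
  "p \<noteq> [] \<Longrightarrow> q \<noteq> [] \<Longrightarrow>
    path_cost c (p @ q) = path_cost c p + dist_of c (last p) (hd q) + path_cost c q"
proof (induction c p rule: path_cost.induct)
  case ("2_2" c v)
  then show ?case by (cases q) auto
qed auto

lemma spec_path_edges_c:
  assumes "length xs \<le> N" "N + 1 \<le> b"
  shows "spec (path_edges_c xs) b (\<lambda>es. es = path_edges xs)"
proof -
  have "spec (path_edges_c xs) (length xs + 1) (\<lambda>es. es = path_edges xs)"
  proof (induction xs rule: path_edges.induct)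
    case (1 x y zs)
    show ?case unfolding path_edges_c.simps
      by (rule spec_bind[OF 1], rule spec_return1) auto
  qed (auto intro: spec_return)
  then show ?thesis by (rule spec_mono) (use assms in auto)
qed

lemma length_path_edges: "length (path_edges xs) = length xs - 1"
  by (induction xs rule: path_edges.induct) auto

lemma path_edges_subset: "e \<in> set (path_edges xs) \<Longrightarrow> e \<subseteq> set xs"
  by (induction xs rule: path_edges.induct) auto

lemma path_edges_all_edges: "distinct xs \<Longrightarrow> set (path_edges xs) \<subseteq> all_edges (set xs)"
proof (induction xs rule: path_edges.induct)
  case (1 x y zs)
  then show ?case using all_edges_mono[of "set (y # zs)" "set (x # y # zs)"] by auto
qed auto

lemma distinct_path_edges: "distinct xs \<Longrightarrow> distinct (path_edges xs)"
proof (induction xs rule: path_edges.induct)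
  case (1 x y zs)
  then show ?case using path_edges_subset[of "{x, y}" "y # zs"] by auto
qed auto

lemma path_cost_eq: "distinct xs \<Longrightarrow> path_cost c xs = (\<Sum>e\<in>set (path_edges xs). c e)"
proof (induction xs rule: path_edges.induct)
  case (1 x y zs)
  then have "{x, y} \<notin> set (path_edges (y # zs))" using path_edges_subset[of "{x, y}" "y # zs"] by auto
  with 1 show ?case by (simp add: dist_of_neq)
qed auto

lemma path_edges_conn: "x \<in> set xs \<Longrightarrow> (hd xs, x) \<in> conn (set (path_edges xs))"
proof (induction xs rule: path_edges.induct)
  case (1 z y zs)
  show ?case
  proof (cases "x = z")
    case False
    then have "(y, x) \<in> conn (set (path_edges (z # y # zs)))"
      using 1 conn_mono[of "set (path_edges (y # zs))" "set (path_edges (z # y # zs))" y x] by auto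
    moreover have "(z, y) \<in> adj (set (path_edges (z # y # zs)))" by simp
    ultimately have "(z, x) \<in> conn (set (path_edges (z # y # zs)))"
      by (rule converse_rtrancl_into_rtrancl[rotated])
    then show ?thesis by simp
  qed simp
qed auto

lemma is_tree_path:
  assumes "distinct xs" "xs \<noteq> []"
  shows "is_tree (set xs, set (path_edges xs))"
proof -
  have "connected_graph (set xs, set (path_edges xs))"
    using assms(2) path_edges_conn[of _ xs] by (intro connected_graph_from[of "hd xs"]) auto
  then show ?thesis
    using path_edges_all_edges[OF assms(1)] distinct_card[OF distinct_path_edges[OF assms(1)]] assms
    by (simp add: is_tree_iff_card distinct_card length_path_edges Suc_leI)
qed

lemma path_edges_append_Cons:
  "set (path_edges (as @ [p, v, q] @ bs)) \<supseteq> {{p, v}, {v, q}}"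
  by (induction as rule: path_edges.induct) auto

text \<open>An inner vertex lies on two path edges, which differ because its two neighbours do. This
  makes the selected vertices internal, as the ends of a cluster path are unselected.\<close>

lemma internal_vertex_path:
  assumes xs: "distinct xs" and v: "v \<in> set xs" "v \<noteq> hd xs" "v \<noteq> last xs"
  shows "internal_vertex (set xs, set (path_edges xs)) v"
proof -
  obtain as bs where ab: "xs = as @ v # bs" using v(1) by (auto simp: in_set_conv_decomp)
  have "as \<noteq> []" "bs \<noteq> []" using ab v by auto
  obtain p q where p: "as = butlast as @ [p]" and q: "bs = q # tl bs"
    using \<open>as \<noteq> []\<close> \<open>bs \<noteq> []\<close> by (metis append_butlast_last_id hd_Cons_tl)
  have eq: "xs = butlast as @ [p, v, q] @ tl bs" using ab p q by (metis append.assoc append_Cons append_Nil)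
  have ne: "{p, v} \<noteq> {v, q}" using xs unfolding eq by (auto simp: doubleton_eq_iff)
  have "{{p, v}, {v, q}} \<subseteq> {e \<in> set (path_edges xs). v \<in> e}"
    using path_edges_append_Cons[of p v q "butlast as" "tl bs"] eq by auto
  from card_mono[OF _ this] ne have "2 \<le> degree_in (set xs, set (path_edges xs)) v"
    by (auto simp: degree_in_def)
  then show ?thesis using v(1) by (simp add: internal_vertex_def)
qed

section \<open>Shortcuts under the triangle inequality\<close>

locale metric_costs =
  fixes V :: "'v set" and c :: "'v set \<Rightarrow> real"
  assumes nonneg: "e \<in> all_edges V \<Longrightarrow> 0 \<le> c e"
    and triangle: "\<lbrakk>u \<in> V; v \<in> V; w \<in> V; distinct [u, v, w]\<rbrakk> \<Longrightarrow> c {u, v} \<le> c {u, w} + c {w, v}"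
begin

lemma dist_of_nonneg: "u \<in> V \<Longrightarrow> v \<in> V \<Longrightarrow> 0 \<le> dist_of c u v"
  using nonneg[of "{u, v}"] by (simp add: dist_of_def)

lemma dist_of_triangle:
  assumes "u \<in> V" "v \<in> V" "w \<in> V"
  shows "dist_of c u v \<le> dist_of c u w + dist_of c w v"
proof (cases "distinct [u, v, w]")
  case True
  then show ?thesis using triangle[OF assms] by (simp add: dist_of_def insert_commute)
next
  case False
  then show ?thesis using assms dist_of_nonneg dist_of_commute[of c u w] by auto
qed

lemma edge_nonneg: "E \<subseteq> all_edges W \<Longrightarrow> W \<subseteq> V \<Longrightarrow> e \<in> E \<Longrightarrow> 0 \<le> c e"
  using nonneg all_edges_mono by blast

lemma path_cost_skip:
  assumes "x \<in> V" "y \<in> V" "set ys \<subseteq> V"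
  shows "path_cost c (x # ys) \<le> dist_of c x y + path_cost c (y # ys)"
  using assms dist_of_triangle[of x "hd ys" y] dist_of_nonneg[of x y] by (cases ys) auto

text \<open>The vertex \<open>x\<close> kept in front carries the induction: dropping the vertex
  after it is a single triangle inequality, \<open>path_cost_skip\<close>.\<close>

lemma path_cost_Cons_filter:
  "x \<in> V \<Longrightarrow> set xs \<subseteq> V \<Longrightarrow> path_cost c (x # filter P xs) \<le> path_cost c (x # xs)"
proof (induction xs arbitrary: x)
  case (Cons y ys)
  have 1: "path_cost c (x # filter P ys) \<le> path_cost c (x # ys)"
    "path_cost c (y # filter P ys) \<le> path_cost c (y # ys)"
    using Cons by simp_all
  have 2: "path_cost c (x # ys) \<le> dist_of c x y + path_cost c (y # ys)"
    using Cons.prems path_cost_skip[of x y ys] by simp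
  from 1 2 show ?case by simp
qed simp

lemma path_cost_filter: "set xs \<subseteq> V \<Longrightarrow> path_cost c (filter P xs) \<le> path_cost c xs"
proof (induction xs)
  case (Cons x xs)
  show ?case
  proof (cases "P x")
    case True
    then show ?thesis using path_cost_Cons_filter[of x xs P] Cons.prems by simp
  next
    case False
    moreover have "path_cost c xs \<le> path_cost c (x # xs)"
      using Cons.prems dist_of_nonneg[of x "hd xs"] by (cases xs) auto
    ultimately show ?thesis using Cons by simp
  qed
qed simp

end

text \<open>Every vertex stays connected to \<open>u\<close> or to \<open>v\<close>, and not to
  both, since the edge is a bridge. The sides are written as sets of reachable vertices to agree
  with what \<open>component_edges_c\<close> returns.\<close>

lemma tree_split:
  fixes W :: "'v set"
  assumes tree: "is_tree (W, E)" and uv: "{u, v} \<in> E"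
  defines "E' \<equiv> E - {{u, v}}"
  defines "W1 \<equiv> {x. (u, x) \<in> conn E'}" and "W2 \<equiv> {x. (v, x) \<in> conn E'}"
  defines "E1 \<equiv> {e \<in> E'. e \<subseteq> W1}" and "E2 \<equiv> {e \<in> E'. e \<subseteq> W2}"
  shows "is_tree (W1, E1)" "is_tree (W2, E2)" "u \<in> W1" "v \<in> W2" "W1 \<union> W2 = W" "W1 \<inter> W2 = {}"
    "\<And>c :: 'v set \<Rightarrow> real. sum c E = c {u, v} + sum c E1 + sum c E2"
    "card E1 + card E2 + 1 = card E"
proof -
  have fin: "finite W" and EW: "E \<subseteq> all_edges W" and cn: "connected_graph (W, E)" and br: "all_bridges E"
    using tree is_tree_iff_bridges by blast+
  have finE: "finite E" using EW fin finite_all_edges finite_subset by blast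
  have E'W: "E' \<subseteq> all_edges W" and br': "all_bridges E'"
    using EW br all_bridges_subset[of E E'] by (auto simp: E'_def)
  have uW: "u \<in> W" "v \<in> W" "u \<noteq> v" using subsetD[OF EW uv] by simp_all
  have W1: "W1 = comp_of (W, E') u" and W2: "W2 = comp_of (W, E') v"
    using conn_in_verts[OF _ E'W] uW by (auto simp: W1_def W2_def comp_of_def)
  show "is_tree (W1, E1)" "is_tree (W2, E2)"
    unfolding W1 W2 E1_def E2_def using is_tree_component[OF fin E'W br'] uW by blast+
  show "u \<in> W1" "v \<in> W2" by (simp_all add: W1_def W2_def)
  have "x \<in> W1 \<union> W2" if "x \<in> W" for x
    using conn_remove_edge[of u x E v] cn uW that
    by (auto simp: W1_def W2_def E'_def connected_graph_iff)
  then show "W1 \<union> W2 = W" by (auto simp: W1 W2 comp_of_def)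
  have "(u, v) \<notin> conn E'" using br uv by (auto simp: all_bridges_def E'_def)
  then show disj: "W1 \<inter> W2 = {}"
    unfolding W1_def W2_def by (auto dest: conn_sym intro: rtrancl_trans)
  have "e \<in> E1 \<union> E2" if e: "e \<in> E'" for e
  proof -
    obtain x y where xy: "e = {x, y}" "x \<in> W" using subsetD[OF E'W e] by (auto elim: all_edgesE)
    have "(x, y) \<in> conn E'" using e xy(1) by (simp add: conn_edge)
    then have "y \<in> W1" if "x \<in> W1" using that by (auto simp: W1_def intro: rtrancl_trans)
    moreover have "y \<in> W2" if "x \<in> W2" using that \<open>(x, y) \<in> conn E'\<close> by (auto simp: W2_def intro: rtrancl_trans)
    moreover have "x \<in> W1 \<union> W2" using \<open>W1 \<union> W2 = W\<close> xy by simp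
    ultimately show ?thesis using e xy by (auto simp: E1_def E2_def)
  qed
  then have E: "E = insert {u, v} (E1 \<union> E2)" "{u, v} \<notin> E1 \<union> E2"
    using uv by (auto simp: E'_def E1_def E2_def)
  have "E1 \<inter> E2 = {}"
  proof (rule ccontr)
    assume "E1 \<inter> E2 \<noteq> {}"
    then obtain e where "e \<in> E'" "e \<subseteq> W1 \<inter> W2" by (auto simp: E1_def E2_def)
    then show False using disj E'W by (auto simp: all_edges_def)
  qed
  moreover have "finite E1" "finite E2" using finE by (auto simp: E1_def E2_def E'_def)
  ultimately show "card E1 + card E2 + 1 = card E"
    and "\<And>c :: 'v set \<Rightarrow> real. sum c E = c {u, v} + sum c E1 + sum c E2"
    using E by (simp_all add: sum.union_disjoint card_Un_disjoint)
qed

lemma spec_self_or_neighbour_c: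
  assumes tree: "is_tree (W, set es)" and a: "a \<in> W" and N: "length es \<le> N" "3 * N + 2 \<le> t"
  shows "spec (self_or_neighbour_c es a) t (\<lambda>a'. a' \<in> W \<and> (es = [] \<and> a' = a \<or> a' \<noteq> a \<and> {a, a'} \<in> set es))"
proof (cases "es = []")
  case True
  then show ?thesis using a N by (auto simp: self_or_neighbour_c_def intro: spec_return)
next
  case False
  have EW: "set es \<subseteq> all_edges W" and cn: "connected_graph (W, set es)"
    using tree is_tree_iff_bridges by blast+
  obtain e where e: "e \<in> set es" using False by (cases es) auto
  obtain x y where "e = {x, y}" "x \<noteq> y" "x \<in> W" "y \<in> W" using subsetD[OF EW e] by (rule all_edgesE)
  then obtain b where "b \<in> W" "a \<noteq> b" by metis
  then have "(a, b) \<in> conn (set es)" using cn a by (auto simp: connected_graph_iff)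
  from first_edge_on_path[OF this \<open>a \<noteq> b\<close>] obtain v where v: "{a, v} \<in> set es" by blast
  have "spec (do { ds \<leftarrow> incident_c a es; e \<leftarrow> pick ds; return (other_end a e) }) ((2 * N + 1) + (N + 1))
    (\<lambda>a'. a' \<in> W \<and> a' \<noteq> a \<and> {a, a'} \<in> set es)"
  proof (rule spec_bind1[OF spec_incident_c[OF N(1) order_refl]], hypsubst, rule spec_bind1[OF spec_pick])
    show "filter ((\<in>) a) es \<noteq> []" using v by (auto simp: filter_empty_conv)
    show "length (filter ((\<in>) a) es) \<le> N" using N(1) length_filter_le order_trans by blast
    fix e assume "e \<in> set (filter ((\<in>) a) es)"
    then show "e \<in> set es \<and> a \<in> e" by simp
  next
    fix e assume e: "e \<in> set es \<and> a \<in> e"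
    then have "e \<in> all_edges W" using EW by auto
    then obtain x y where "e = {x, y}" "x \<noteq> y" "x \<in> W" "y \<in> W" by (rule all_edgesE)
    then obtain w where "e = {a, w}" "w \<noteq> a" "w \<in> W" using e by (metis insert_commute insert_iff singletonD)
    then show "spec (return (other_end a e)) 1 (\<lambda>a'. a' \<in> W \<and> a' \<noteq> a \<and> {a, a'} \<in> set es)"
      using e by (intro spec_return1) auto
  qed
  then have "spec (self_or_neighbour_c es a) ((2 * N + 1) + (N + 1)) (\<lambda>a'. a' \<in> W \<and> a' \<noteq> a \<and> {a, a'} \<in> set es)"
    using False by (simp add: self_or_neighbour_c_def)
  then show ?thesis by (rule spec_mono) (use N in auto)
qed

text \<open>The price of one call without its recursive calls. It covers both branches:
  \<open>first_time\<close> occurs only for non-adjacent ends, the second \<open>3 * N + 2\<close>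
  only for adjacent ones.\<close>

definition ham_step :: "nat \<Rightarrow> nat" where
  "ham_step N = (2 * N + 2) + (first_time N + ((2 * N + 1) + (comp_time N + (comp_time N +
     ((3 * N + 2) + ((3 * N + 2) + (N + 2)))))))"

context metric_costs
begin

text \<open>An edge joining the two chosen ends is used only once, which pays for the detour that joins
  the two partial paths.\<close>

definition ham_post :: "'v set \<Rightarrow> 'v set set \<Rightarrow> 'v \<Rightarrow> 'v \<Rightarrow> 'v list \<Rightarrow> bool" where
  "ham_post W E a b p \<longleftrightarrow> distinct p \<and> set p = W \<and> p \<noteq> [] \<and> hd p = a \<and> last p = b \<and>
     path_cost c p \<le> 2 * sum c E - (if {a, b} \<in> E then c {a, b} else 0)"

text \<open>The refund for the edge between the ends pays for the way back from \<open>a'\<close> to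
  \<open>a\<close>; if there are no edges, then \<open>a' = a\<close> and the way costs
  nothing.\<close>

lemma ham_post_neighbour:
  assumes "ham_post W E x y p" "{x, y} = {a, a'}" "E = {} \<and> a' = a \<or> a' \<noteq> a \<and> {a, a'} \<in> E"
  shows "path_cost c p + dist_of c a a' \<le> 2 * sum c E"
  using assms by (auto simp: ham_post_def dist_of_def doubleton_eq_iff insert_commute split: if_splits)

text \<open>The connecting edge costs no more than the detour from \<open>u'\<close> over
  \<open>u\<close> and \<open>v\<close> to \<open>v'\<close>. The outer legs are paid by the refunds
  of the halves (or \<open>v' = v\<close> and the leg is 0), so only the middle leg
  \<open>c {u, v}\<close> is charged, and only once. The disjunction on \<open>v'\<close> separates
  adjacent from non-adjacent ends.\<close>

lemma ham_post_join:
  assumes W: "W \<subseteq> V" and tree: "is_tree (W, E)" and uv: "{u, v} \<in> E"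
  defines "E' \<equiv> E - {{u, v}}"
  defines "W1 \<equiv> {x. (u, x) \<in> conn E'}" and "W2 \<equiv> {x. (v, x) \<in> conn E'}"
  defines "E1 \<equiv> {e \<in> E'. e \<subseteq> W1}" and "E2 \<equiv> {e \<in> E'. e \<subseteq> W2}"
  assumes p: "ham_post W1 E1 u u' p" and q: "ham_post W2 E2 v' b q"
    and u': "E1 = {} \<and> u' = u \<or> u' \<noteq> u \<and> {u, u'} \<in> E1"
    and v': "b = v \<and> (E2 = {} \<and> v' = v \<or> v' \<noteq> v \<and> {v, v'} \<in> E2) \<or> v' = v \<and> {u, b} \<notin> E"
  shows "ham_post W E u b (p @ q)"
proof -
  note split = tree_split[OF tree uv, folded E'_def, folded W1_def W2_def, folded E1_def E2_def]
  have EW: "E \<subseteq> all_edges W" using tree is_tree_iff_bridges by blast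
  have "u' \<in> W1" "v' \<in> W2" using p q by (auto simp: ham_post_def)
  then have in_V: "u \<in> V" "v \<in> V" "u' \<in> V" "v' \<in> V" using split(3-5) W by auto
  have "u \<noteq> v" using split(3,4,6) by auto
  have p': "path_cost c p + dist_of c u u' \<le> 2 * sum c E1"
    by (rule ham_post_neighbour[OF p refl u'])
  have nonneg1: "0 \<le> sum c E2"
    using W EW by (intro sum_nonneg nonneg) (auto simp: E2_def E'_def all_edges_def)
  have q': "path_cost c q + dist_of c v v' \<le> 2 * sum c E2"
    using v'
  proof
    assume *: "b = v \<and> (E2 = {} \<and> v' = v \<or> v' \<noteq> v \<and> {v, v'} \<in> E2)"
    then show ?thesis using ham_post_neighbour[OF q, of v v'] by (auto simp: insert_commute)
  next
    assume "v' = v \<and> {u, b} \<notin> E"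
    moreover have "0 \<le> (if {v', b} \<in> E2 then c {v', b} else 0)"
      using edge_nonneg[OF EW W] by (simp add: E2_def E'_def)
    ultimately show ?thesis using q by (auto simp: ham_post_def)
  qed
  have "dist_of c u' v' \<le> dist_of c u' u + dist_of c u v'"
    using in_V by (intro dist_of_triangle) auto
  also have "dist_of c u v' \<le> dist_of c u v + dist_of c v v'"
    using in_V by (intro dist_of_triangle) auto
  finally have d: "dist_of c u' v' \<le> dist_of c u u' + c {u, v} + dist_of c v v'"
    using \<open>u \<noteq> v\<close> by (simp add: dist_of_neq dist_of_commute[of c u' u])
  have "path_cost c (p @ q) = path_cost c p + dist_of c u' v' + path_cost c q"
    using p q by (subst path_cost_append) (auto simp: ham_post_def)
  also have "\<dots> \<le> 2 * sum c E1 + c {u, v} + 2 * sum c E2" using p' q' d by linarith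
  also have "\<dots> = 2 * sum c E - c {u, v}" using split(7)[of c] by simp
  finally have cost: "path_cost c (p @ q) \<le> 2 * sum c E - c {u, v}" .
  have "0 \<le> c {u, v}" by (rule edge_nonneg[OF EW W uv])
  \<comment> \<open>If \<open>b = v\<close>, the saved \<open>c {u, v}\<close> is exactly the refund
    owed; otherwise \<open>{u, b}\<close> is no edge and nothing is owed.\<close>
  then have "path_cost c (p @ q) \<le> 2 * sum c E - (if {u, b} \<in> E then c {u, b} else 0)"
    using cost v' by auto
  with p q split(5,6) show ?thesis by (auto simp: ham_post_def)
qed

text \<open>Each branching call removes one edge, so there are \<open>length es\<close> branching
  calls and \<open>length es + 1\<close> trivial ones. \<open>N\<close> stays fixed through the
  recursion so that every call has the same price.\<close>

lemma spec_ham_path_c: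
  assumes "is_tree (W, set es)" "distinct es" "W \<subseteq> V" "a \<in> W" "b \<in> W" "es \<noteq> [] \<Longrightarrow> a \<noteq> b"
    and N: "length es \<le> N" "(2 * length es + 1) * ham_step N \<le> t"
  shows "spec (ham_path_c es a b) t (ham_post W (set es) a b)"
  using assms
proof (induction "length es" arbitrary: es W a b t rule: less_induct)
  case less
  note tree = less.prems(1) and dist = less.prems(2) and WV = less.prems(3)
    and aW = less.prems(4) and bW = less.prems(5) and len = less.prems(7) and t = less.prems(8)
  have fin: "finite W" and EW: "set es \<subseteq> all_edges W" and cn: "connected_graph (W, set es)"
    using tree is_tree_iff_bridges by blast+
  show ?case
  proof (cases "es = []")
    case True
    then have "card W = 1" using tree by (simp add: is_tree_iff_card)
    then have "W = {a}" "b = a" using aW bW by (auto simp: card_1_singleton_iff)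
    moreover have "1 \<le> t" using t True by (simp add: ham_step_def)
    ultimately show ?thesis
      using True by (subst ham_path_c.simps) (auto intro!: spec_return simp: ham_post_def)
  next
    case False
    then have "a \<noteq> b" using less.prems(6) by simp
    \<comment> \<open>Both branches of the program end like this. The adjacent one has
      \<open>v = b\<close>, the other one \<open>b' = v\<close>.\<close>
    have halves: "spec (do { p \<leftarrow> ham_path_c es1 a a'; q \<leftarrow> ham_path_c es2 b' b; append_c p q })
        (2 * length es * ham_step N + (N + 2))
        (ham_post W (set es) a b)"
      if v: "{a, v} \<in> set es"
        and es1: "es1 = filter (\<lambda>e. e \<subseteq> {x. (a, x) \<in> conn (set es - {{a, v}})}) (filter (\<lambda>y. y \<noteq> {a, v}) es)"
        and es2: "es2 = filter (\<lambda>e. e \<subseteq> {x. (v, x) \<in> conn (set es - {{a, v}})}) (filter (\<lambda>y. y \<noteq> {a, v}) es)"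
        and a': "es1 = [] \<and> a' = a \<or> a' \<noteq> a \<and> {a, a'} \<in> set es1" "(a, a') \<in> conn (set es - {{a, v}})"
        and b': "b = v \<and> (es2 = [] \<and> b' = v \<or> b' \<noteq> v \<and> {v, b'} \<in> set es2) \<or>
          b' = v \<and> b \<noteq> v \<and> {a, b} \<notin> set es"
          "(v, b') \<in> conn (set es - {{a, v}})" "(v, b) \<in> conn (set es - {{a, v}})"
      for v es1 es2 a' b'
    proof -
      let ?E' = "set es - {{a, v}}"
      let ?W1 = "{x. (a, x) \<in> conn ?E'}" and ?W2 = "{x. (v, x) \<in> conn ?E'}"
      note split = tree_split[OF tree v]
      have s1: "set es1 = {e \<in> ?E'. e \<subseteq> ?W1}" and s2: "set es2 = {e \<in> ?E'. e \<subseteq> ?W2}"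
        using es1 es2 by auto
      have d: "distinct es1" "distinct es2" using es1 es2 dist by simp_all
      have sz: "length es1 + length es2 + 1 = length es"
        using split(8) distinct_card[OF d(1)] distinct_card[OF d(2)] distinct_card[OF dist] s1 s2 by simp
      have WV1: "?W1 \<subseteq> V" and WV2: "?W2 \<subseteq> V" using split(5) WV by auto
      have h1: "spec (ham_path_c es1 a a') ((2 * length es1 + 1) * ham_step N) (ham_post ?W1 (set es1) a a')"
      proof (rule less.hyps)
        show "is_tree (?W1, set es1)" using split(1) s1 by simp
        show "length es1 < length es" "length es1 \<le> N" using sz len by simp_all
        show "?W1 \<subseteq> V" by (rule WV1)
        show "es1 \<noteq> [] \<Longrightarrow> a \<noteq> a'" using a'(1) by blast
      qed (use d a' in simp_all)
      have h2: "spec (ham_path_c es2 b' b) ((2 * length es2 + 1) * ham_step N) (ham_post ?W2 (set es2) b' b)"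
      proof (rule less.hyps)
        show "is_tree (?W2, set es2)" using split(2) s2 by simp
        show "length es2 < length es" "length es2 \<le> N" using sz len by simp_all
        show "?W2 \<subseteq> V" by (rule WV2)
        show "es2 \<noteq> [] \<Longrightarrow> b' \<noteq> b" using b'(1) by blast
      qed (use d b'(2,3) in simp_all)
      have joined: "ham_post W (set es) a b (p @ q)"
        if "ham_post ?W1 (set es1) a a' p" "ham_post ?W2 (set es2) b' b q" for p q
        by (rule ham_post_join[OF WV tree v, folded s1 s2]) (use that a' b' in auto)
      have short: "length p \<le> N + 1" if "ham_post ?W1 (set es1) a a' p" for p
      proof -
        have "length p = card ?W1" using that distinct_card[of p] by (simp add: ham_post_def)
        also have "\<dots> = card (set es1) + 1" using split(1) s1 by (simp add: is_tree_iff_card)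
        finally show ?thesis using sz len distinct_card[OF d(1)] by simp
      qed
      have "spec (do { p \<leftarrow> ham_path_c es1 a a'; q \<leftarrow> ham_path_c es2 b' b; append_c p q })
        ((2 * length es1 + 1) * ham_step N + ((2 * length es2 + 1) * ham_step N + (N + 2)))
        (ham_post W (set es) a b)"
      proof (rule spec_bind1[OF h1], rule spec_bind1[OF h2])
        fix p q assume p: "ham_post ?W1 (set es1) a a' p" and q: "ham_post ?W2 (set es2) b' b q"
        show "spec (append_c p q) (N + 2) (ham_post W (set es) a b)"
          by (rule spec_mono[OF spec_append_c order_refl]) (use short[OF p] joined[OF p q] in auto)
      qed
      \<comment> \<open>If the halves have \<open>m1\<close> and \<open>m2\<close> edges and
        \<open>m1 + m2 + 1 = m\<close>, then \<open>(2 * m1 + 1) + (2 * m2 + 1) = 2 * m\<close>,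
        which leaves one share of \<open>ham_step N\<close> for the call itself.\<close>
      then show ?thesis by (rule spec_mono) (simp_all add: sz[symmetric] algebra_simps)
    qed
    have sub: "set (filter (\<lambda>y. y \<noteq> e) es) \<subseteq> all_edges W" "distinct (filter (\<lambda>y. y \<noteq> e) es)"
      "length (filter (\<lambda>y. y \<noteq> e) es) \<le> N" for e
      using EW dist order_trans[OF length_filter_le len] by auto
    have seteq: "set (filter (\<lambda>y. y \<noteq> e) es) = set es - {e}" for e by auto
    define part where "part e x = filter (\<lambda>d. d \<subseteq> {y. (x, y) \<in> conn (set es - {e})}) (filter (\<lambda>y. y \<noteq> e) es)" for e x
    have comp: "spec (component_edges_c (filter (\<lambda>y. y \<noteq> e) es) x) (comp_time N) (\<lambda>ds. ds = part e x)" for e x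
      using spec_component_edges_c[OF sub order_refl, of e x] unfolding seteq part_def .
    have set_part: "set (part e x) = {d \<in> set es - {e}. d \<subseteq> {y. (x, y) \<in> conn (set es - {e})}}" for e x
      by (auto simp: part_def)
    have len_part: "length (part e x) \<le> N" for e x
      unfolding part_def by (rule order_trans[OF length_filter_le sub(3)])
    have neigh: "spec (self_or_neighbour_c (part {a, v} x) x) (3 * N + 2) (\<lambda>x'. (x, x') \<in> conn (set es - {{a, v}}) \<and>
        (part {a, v} x = [] \<and> x' = x \<or> x' \<noteq> x \<and> {x, x'} \<in> set (part {a, v} x)))"
      if v: "{a, v} \<in> set es" and x: "x \<in> {a, v}" for v x
    proof -
      have "is_tree ({y. (x, y) \<in> conn (set es - {{a, v}})}, set (part {a, v} x))"
        using tree_split(1,2)[OF tree v] x unfolding set_part by blast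
      from spec_self_or_neighbour_c[OF this _ len_part order_refl] show ?thesis
        by simp
    qed
    let ?rec = "2 * length es * ham_step N + (N + 2)"
    have adjacent: "spec (do {
          es' \<leftarrow> remove_c {a, b} es;
          es_a \<leftarrow> component_edges_c es' a;
          es_b \<leftarrow> component_edges_c es' b;
          a' \<leftarrow> self_or_neighbour_c es_a a;
          b' \<leftarrow> self_or_neighbour_c es_b b;
          p \<leftarrow> ham_path_c es_a a a';
          q \<leftarrow> ham_path_c es_b b' b;
          append_c p q
        }) ((2 * N + 1) + (comp_time N + (comp_time N + ((3 * N + 2) + ((3 * N + 2) + ?rec)))))
        (ham_post W (set es) a b)" if v: "{a, b} \<in> set es"
    proof (rule spec_bind1[OF spec_remove_c[OF len order_refl]], hypsubst, rule spec_bind1[OF comp], hypsubst,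
        rule spec_bind1[OF comp], hypsubst, rule spec_bind1[OF neigh[OF v]], simp,
        rule spec_bind1[OF neigh[OF v]], simp)
    qed (rule halves[OF v part_def part_def], auto)
    have apart: "spec (do {
          e \<leftarrow> first_edge_c es a b;
          es' \<leftarrow> remove_c e es;
          es_a \<leftarrow> component_edges_c es' a;
          es_b \<leftarrow> component_edges_c es' (other_end a e);
          a' \<leftarrow> self_or_neighbour_c es_a a;
          p \<leftarrow> ham_path_c es_a a a';
          q \<leftarrow> ham_path_c es_b (other_end a e) b;
          append_c p q
        }) (first_time N + ((2 * N + 1) + (comp_time N + (comp_time N + ((3 * N + 2) + ?rec)))))
        (ham_post W (set es) a b)" if nv: "{a, b} \<notin> set es"
    proof (rule spec_bind1[OF spec_first_edge_c[OF EW dist len order_refl _ \<open>a \<noteq> b\<close>]])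
      show "(a, b) \<in> conn (set es)" using cn aW bW by (auto simp: connected_graph_iff)
      fix e assume "\<exists>v. e = {a, v} \<and> {a, v} \<in> set es \<and> (v, b) \<in> conn (set es - {{a, v}})"
      then obtain v where e: "e = {a, v}" and v: "{a, v} \<in> set es" and vb: "(v, b) \<in> conn (set es - {{a, v}})"
        by blast
      have "a \<noteq> v" using subsetD[OF EW v] by simp
      then have oe: "other_end a e = v" using e by simp
      have "b \<noteq> v" using v nv by auto
      show "spec (do {
          es' \<leftarrow> remove_c e es;
          es_a \<leftarrow> component_edges_c es' a;
          es_b \<leftarrow> component_edges_c es' (other_end a e);
          a' \<leftarrow> self_or_neighbour_c es_a a;
          p \<leftarrow> ham_path_c es_a a a';
          q \<leftarrow> ham_path_c es_b (other_end a e) b;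
          append_c p q
        }) ((2 * N + 1) + (comp_time N + (comp_time N + ((3 * N + 2) + ?rec))))
        (ham_post W (set es) a b)"
        unfolding oe unfolding e
      proof (rule spec_bind1[OF spec_remove_c[OF len order_refl]], hypsubst, rule spec_bind1[OF comp], hypsubst,
          rule spec_bind1[OF comp], hypsubst, rule spec_bind1[OF neigh[OF v]], simp)
      qed (rule halves[OF v part_def part_def], use vb nv \<open>b \<noteq> v\<close> in auto)
    qed
    show ?thesis
      apply (subst ham_path_c.simps)
      apply (simp only: False if_False)
      apply (rule spec_bind[OF spec_member_c[OF len order_refl], where ?b2.0 =
        "first_time N + ((2 * N + 1) + (comp_time N + (comp_time N + ((3 * N + 2) + ((3 * N + 2) + ?rec)))))"])
       apply (simp only: split: if_split)
       apply (intro conjI impI)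
        apply (rule spec_mono[OF adjacent], assumption, simp, assumption)
       apply (rule spec_mono[OF apart], assumption, simp, assumption)
      using t by (simp add: ham_step_def algebra_simps)
  qed
qed

end

section \<open>Approximation guarantees as specifications, and input sizes\<close>

lemma poly_time_approximation_iff:
  "poly_time_approximation inst isize feasible cost \<beta> alg \<longleftrightarrow>
    (\<exists>f. polyfun f \<and> (\<forall>I. inst I \<longrightarrow> spec (alg I) (f (isize I))
      (\<lambda>T. irredundant T \<and> feasible I (graph_of T) \<and>
        (\<forall>T_opt. is_arg_min (cost I) (feasible I) T_opt \<longrightarrow> cost I (graph_of T) \<le> \<beta> * cost I T_opt))))"
  (is "?L \<longleftrightarrow> ?R")
proof
  assume ?L
  then obtain p where "\<forall>I. inst I \<longrightarrow> (\<exists>S. alg I = Runs S \<and> S \<noteq> {} \<and>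
          (\<forall>(T, t)\<in>S. t \<le> poly p (isize I) \<and> irredundant T \<and> feasible I (graph_of T) \<and>
            (\<forall>T_opt. is_arg_min (cost I) (feasible I) T_opt \<longrightarrow>
               cost I (graph_of T) \<le> \<beta> * cost I T_opt)))"
    unfolding poly_time_approximation_def by blast
  then show ?R
    by (intro exI[of _ "poly p"]) (auto simp: spec_def polyfun_def)
next
  assume ?R
  then show ?L
    unfolding poly_time_approximation_def spec_def polyfun_def by blast
qed

lemma wgraph_size_bounds:
  assumes "wgraph_size len (vs, es, c) \<le> N"
  shows "length vs \<le> N" "length es \<le> N" "e \<in> set es \<Longrightarrow> len (c e) \<le> N"
proof -
  have "length es \<le> (\<Sum>e\<leftarrow>es. 1 + len (c e))" by (induction es) auto
  moreover have "len (c e) \<le> (\<Sum>e\<leftarrow>es. 1 + len (c e))" if "e \<in> set es"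
    using that by (induction es) auto
  ultimately show "length vs \<le> N" "length es \<le> N" "e \<in> set es \<Longrightarrow> len (c e) \<le> N"
    using assms by auto
qed

section \<open>Prim's algorithm\<close>

text \<open>On a simple path take the first exit from \<open>S\<close>. The part up to
  \<open>p\<close> lies in \<open>S\<close> and misses \<open>q\<close>, the part from
  \<open>q\<close> on misses \<open>p\<close>, so neither uses \<open>{p, q}\<close>.\<close>

lemma conn_crossing_edge:
  assumes "(u, v) \<in> conn E" "u \<in> S" "v \<notin> S"
  obtains p q where "{p, q} \<in> E" "p \<in> S" "q \<notin> S"
    "(u, p) \<in> conn (E - {{p, q}})" "(q, v) \<in> conn (E - {{p, q}})"
proof -
  obtain xs where xs: "xs \<noteq> []" "hd xs = u" "last xs = v" "distinct xs"
    "successively (\<lambda>x y. {x, y} \<in> E) xs" using conn_path[OF assms(1)] by blast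
  define as where "as = takeWhile (\<lambda>x. x \<in> S) xs"
  define bs where "bs = dropWhile (\<lambda>x. x \<in> S) xs"
  have ab: "xs = as @ bs" by (simp add: as_def bs_def)
  have "as \<noteq> []" using xs assms(2) by (cases xs) (auto simp: as_def)
  have "bs \<noteq> []" using xs assms(3) by (metis bs_def dropWhile_eq_Nil_conv last_in_set)
  define p q where "p = last as" and "q = hd bs"
  have asS: "set as \<subseteq> S" by (auto simp: as_def dest: set_takeWhileD)
  have pS: "p \<in> S" using asS \<open>as \<noteq> []\<close> by (auto simp: p_def)
  have qS: "q \<notin> S" using hd_dropWhile[of "\<lambda>x. x \<in> S" xs] \<open>bs \<noteq> []\<close> by (simp add: q_def bs_def)
  have suc: "successively (\<lambda>x y. {x, y} \<in> E) as" "successively (\<lambda>x y. {x, y} \<in> E) bs" "{p, q} \<in> E"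
    using xs(5) \<open>as \<noteq> []\<close> \<open>bs \<noteq> []\<close> by (auto simp: ab successively_append_iff p_def q_def)
  have "p \<notin> set bs" using xs(4) last_in_set[OF \<open>as \<noteq> []\<close>] by (auto simp: ab p_def)
  have "successively (\<lambda>x y. {x, y} \<in> E - {{p, q}}) as"
    by (rule successively_mono[OF suc(1)]) (use asS qS in \<open>auto simp: doubleton_eq_iff\<close>)
  from successively_conn[OF this, of p] have up: "(u, p) \<in> conn (E - {{p, q}})"
    using xs(2) \<open>as \<noteq> []\<close> by (simp add: ab p_def)
  have "successively (\<lambda>x y. {x, y} \<in> E - {{p, q}}) bs"
    by (rule successively_mono[OF suc(2)]) (use \<open>p \<notin> set bs\<close> in \<open>auto simp: doubleton_eq_iff\<close>)
  from successively_conn[OF this, of v] have "(q, v) \<in> conn (E - {{p, q}})"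
    using xs(3) \<open>bs \<noteq> []\<close> by (auto simp: ab q_def)
  with suc(3) pS qS up show ?thesis by (rule that)
qed

definition cut_edge :: "'v set \<Rightarrow> 'v set \<Rightarrow> bool" where
  "cut_edge X e \<longleftrightarrow> (\<exists>u v. e = {u, v} \<and> u \<in> X \<and> v \<notin> X)"

lemma tree_insert_cut_edge:
  assumes "is_tree (X, T)" "u \<in> X" "v \<notin> X"
  shows "is_tree (insert v X, insert {u, v} T)"
proof -
  have T: "finite X" "T \<subseteq> all_edges X" "connected_graph (X, T)" "card X = card T + 1"
    using assms(1) is_tree_iff_card by blast+
  have fin: "finite T" using T finite_all_edges finite_subset by blast
  have "(u, x) \<in> conn (insert {u, v} T)" if "x \<in> insert v X" for x
    using that T(3) assms(2) by (auto simp: connected_graph_iff conn_insert)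
  then have "connected_graph (insert v X, insert {u, v} T)"
    using assms(2) by (intro connected_graph_from[of u]) auto
  moreover have "{u, v} \<notin> T" using T(2) assms(3) all_edges_iff[of u v X] by blast
  moreover have "insert {u, v} T \<subseteq> all_edges (insert v X)"
    using T(2) assms(2,3) all_edges_mono[of X "insert v X"] by auto
  ultimately show ?thesis using T assms(2,3) fin by (simp add: is_tree_iff_card)
qed

text \<open>The invariant of Prim's algorithm. Dominating every spanning tree, rather than extending
  a minimum one, avoids naming a minimum.\<close>

definition extends_optimally :: "'v set \<Rightarrow> 'v set set \<Rightarrow> ('v set \<Rightarrow> real) \<Rightarrow> 'v set set \<Rightarrow> bool" where
  "extends_optimally V E c T \<longleftrightarrow> (\<forall>A\<subseteq>E. is_tree (V, A) \<longrightarrow>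
     (\<exists>B\<subseteq>E. is_tree (V, B) \<and> T \<subseteq> B \<and> sum c B \<le> sum c A))"

text \<open>The cut property. If the dominating tree misses \<open>e\<close>, its path between the
  ends of \<open>e\<close> crosses the cut in some \<open>{p, q}\<close>, which is no cheaper than
  \<open>e\<close> and not in \<open>T\<close>, as \<open>T\<close> stays inside \<open>X\<close>;
  exchange the two.\<close>

lemma extends_optimally_insert:
  assumes opt: "extends_optimally V E c T" and T: "T \<subseteq> all_edges X" "X \<subseteq> V"
    and e: "e \<in> E" "cut_edge X e" "\<And>f. f \<in> E \<Longrightarrow> cut_edge X f \<Longrightarrow> c e \<le> c f"
    and E: "E \<subseteq> all_edges V"
  shows "extends_optimally V E c (insert e T)"
  unfolding extends_optimally_def
proof (intro allI impI)
  fix A assume A: "A \<subseteq> E" "is_tree (V, A)"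
  obtain B where B: "B \<subseteq> E" "is_tree (V, B)" "T \<subseteq> B" "sum c B \<le> sum c A"
    using opt[unfolded extends_optimally_def, rule_format, OF A] by blast
  show "\<exists>B\<subseteq>E. is_tree (V, B) \<and> insert e T \<subseteq> B \<and> sum c B \<le> sum c A"
  proof (cases "e \<in> B")
    case True
    then show ?thesis using B by blast
  next
    case False
    obtain u v where uv: "e = {u, v}" "u \<in> X" "v \<notin> X" using e(2) by (auto simp: cut_edge_def)
    have V: "u \<in> V" "v \<in> V" using subsetD[OF E e(1)] uv by auto
    then have "(u, v) \<in> conn B" using B(2) by (simp add: is_tree_iff_card connected_graph_iff)
    from conn_crossing_edge[OF this uv(2,3)] obtain p q where pq: "{p, q} \<in> B" "p \<in> X" "q \<notin> X"
      "(u, p) \<in> conn (B - {{p, q}})" "(q, v) \<in> conn (B - {{p, q}})" .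
    let ?B = "insert {u, v} (B - {{p, q}})"
    have "is_tree (V, ?B)"
      using tree_exchange[OF B(2) pq(1) V _ pq(4,5)] False uv(1) by simp
    moreover have "{p, q} \<notin> T" using T(1) pq(3) all_edges_iff[of p q X] by blast
    moreover have fin: "finite B" using B(2) by (auto simp: is_tree_iff_card intro: finite_subset finite_all_edges)
    have "sum c ?B = c e + (sum c B - c {p, q})"
      using False fin pq(1) uv(1) by (simp add: sum_diff1)
    moreover have "c e \<le> c {p, q}" using e(3)[of "{p, q}"] B(1) pq by (auto simp: cut_edge_def)
    ultimately show ?thesis
      using B e(1) uv(1) by (intro exI[of _ ?B]) auto
  qed
qed

definition cheapest_time :: "nat \<Rightarrow> nat" where
  "cheapest_time N = (N * ((N * (2 * N + 3) + 1) + 1 + 1) + 1) + N"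

lemma spec_cheapest_c:
  assumes ne: "es \<noteq> []" and N: "length es \<le> N" "\<And>e. e \<in> set es \<Longrightarrow> len (c e) \<le> N"
  shows "spec (cheapest_c len c es) (cheapest_time N) (\<lambda>e. e \<in> set es \<and> (\<forall>f\<in>set es. c e \<le> c f))"
proof -
  let ?q = "\<lambda>e. filter (\<lambda>f. \<not> c e \<le> c f) es = []"
  have inner: "spec (filter_c (\<lambda>f. do { b \<leftarrow> num_le len (c e) (c f); return (\<not> b) }) es) (N * (2 * N + 3) + 1)
      (\<lambda>ds. ds = filter (\<lambda>f. \<not> c e \<le> c f) es)" if "e \<in> set es" for e
  proof (rule spec_filter_c[where b = "2 * N + 2"])
    fix f assume "f \<in> set es"
    then have "spec (num_le len (c e) (c f)) (2 * N + 1) (\<lambda>b. b = (c e \<le> c f))"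
      using N(2)[of e] N(2)[of f] that by (simp add: spec_def num_le_def)
    then show "spec (do { b \<leftarrow> num_le len (c e) (c f); return (\<not> b) }) (2 * N + 2) (\<lambda>r. r = (\<not> c e \<le> c f))"
      by (rule spec_bind) (auto intro: spec_return1)
  qed (use N in \<open>auto simp: algebra_simps\<close>)
  have key: "spec (do {
         ds \<leftarrow> filter_c (\<lambda>e'. do { b \<leftarrow> num_le len (c e) (c e'); return (\<not> b) }) es;
         return (ds = [])
       }) ((N * (2 * N + 3) + 1) + 1) (\<lambda>r. r = ?q e)" if "e \<in> set es" for e
    by (rule spec_bind1[OF inner[OF that]], rule spec_return1) simp
  show ?thesis
    unfolding cheapest_c_def cheapest_time_def
  proof (rule spec_bind1[OF spec_filter_c[where q = ?q, OF key N(1) order_refl]], assumption, hypsubst)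
    have "Min (c ` set es) \<in> c ` set es" using ne by (intro Min_in) auto
    then obtain e where "e \<in> set es" "c e = Min (c ` set es)" by force
    then have e: "e \<in> set es" "\<And>f. f \<in> set es \<Longrightarrow> c e \<le> c f" by auto
    show "spec (pick (filter ?q es)) N (\<lambda>e. e \<in> set es \<and> (\<forall>f\<in>set es. c e \<le> c f))"
    proof (rule spec_pick)
      show "filter ?q es \<noteq> []" using e by (force simp: filter_empty_conv)
      show "length (filter ?q es) \<le> N" using order_trans[OF length_filter_le N(1)] .
    qed (auto simp: filter_empty_conv)
  qed
qed

text \<open>Optimality against every spanning tree instead of against an arg min: the form in which
  both Prim's algorithm and an arbitrary given subroutine are used.\<close>

fun mst_solution :: "'v wgraph \<Rightarrow> 'v graph_code \<Rightarrow> bool" where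
  "mst_solution (vs, es, c) T \<longleftrightarrow> irredundant T \<and> spanning_tree (set vs, set es) (graph_of T) \<and>
    (\<forall>A\<subseteq>set es. is_tree (set vs, A) \<longrightarrow> sum c (set (snd T)) \<le> sum c A)"

definition prim_time :: "nat \<Rightarrow> nat" where
  "prim_time N = N * ((N * ((2 * N + 1) + 1 + 1) + 1) + (cheapest_time N + ((2 * N + 1) + 1))) + 1"

lemma spec_prim:
  assumes G: "mst_instance (vs, es, c)" and N: "wgraph_size len (vs, es, c) \<le> N"
  shows "spec (prim len (vs, es, c)) (prim_time N) (mst_solution (vs, es, c))"
proof -
  let ?V = "set vs" and ?E = "set es"
  note N = wgraph_size_bounds[OF N]
  have dist: "distinct vs" "distinct es" and EV: "?E \<subseteq> all_edges ?V" and cn: "connected_graph (?V, ?E)"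
    using G by (auto simp: mst_instance_def irredundant_def simple_graph_def)
  have ne: "vs \<noteq> []" using cn by (auto simp: connected_graph_iff)
  \<comment> \<open>The entries of \<open>tl vs\<close> merely count rounds: after
    \<open>length ds\<close> rounds the tree has one vertex more, namely the start vertex.\<close>
  define I where "I ds = (\<lambda>(xs, T). distinct xs \<and> set xs \<subseteq> ?V \<and> length xs = Suc (length ds) \<and>
    distinct T \<and> set T \<subseteq> ?E \<and> is_tree (set xs, set T) \<and> extends_optimally ?V ?E c (set T))" for ds :: "'a list"
  have "spec (prim len (vs, es, c)) (prim_time N) (I (tl vs))"
    unfolding prim.simps
  proof (rule spec_fold_c[where N = N])
    have "is_tree ({hd vs}, {})"
      by (auto simp: is_tree_iff_card connected_graph_iff)
    then show "I [] ([hd vs], [])"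
      using ne by (auto simp: I_def extends_optimally_def)
    show "length (tl vs) \<le> N" using N by simp
    show "N * ((N * ((2 * N + 1) + 1 + 1) + 1) + (cheapest_time N + ((2 * N + 1) + 1))) + 1 \<le> prim_time N"
      by (simp add: prim_time_def)
  next
    fix ds x ds' and s :: "'a list \<times> 'a set list"
    assume split: "tl vs = ds @ x # ds'" and Is: "I ds s"
    obtain xs T where s: "s = (xs, T)" by (cases s)
    have xs: "distinct xs" "set xs \<subseteq> ?V" "length xs = Suc (length ds)"
      and T: "distinct T" "set T \<subseteq> ?E" "is_tree (set xs, set T)" "extends_optimally ?V ?E c (set T)"
      using Is s by (auto simp: I_def)
    \<comment> \<open>A round is still to come, so the tree misses a vertex, and connectivity of the
      graph provides a cut edge to choose.\<close>
    have less: "length xs < length vs"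
      using xs(3) arg_cong[OF split, of length] ne by (cases vs) auto
    then have "card (set xs) < card ?V" using xs dist by (simp add: distinct_card)
    then have "\<not> ?V \<subseteq> set xs" using card_mono[of "set xs" ?V] by auto
    then obtain z where z: "z \<in> ?V" "z \<notin> set xs" by blast
    have lenxs: "length xs \<le> N" using less N(1) by simp
    let ?cut = "filter (cut_edge (set xs)) es"
    have cut: "spec (filter_c (\<lambda>e. do {
             hits \<leftarrow> ends_in_c e xs;
             return (case hits of [_] \<Rightarrow> True | _ \<Rightarrow> False)
           }) es) (N * ((2 * N + 1) + 1 + 1) + 1) (\<lambda>cut. cut = ?cut)"
    proof (rule spec_filter_c[OF _ N(2) order_refl], rule spec_bind1[OF spec_ends_in_c[OF lenxs order_refl]],
        rule spec_return1)
      fix e hits assume e: "e \<in> set es" and hits: "hits = filter (\<lambda>x. x \<in> e) xs"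
      from hits_cases[OF xs(1) subsetD[OF EV e] hits]
      show "(case hits of [_] \<Rightarrow> True | _ \<Rightarrow> False) = cut_edge (set xs) e"
        by cases (auto simp: cut_edge_def)
    qed
    obtain u where u: "u \<in> set xs" using xs(3) by (cases xs) auto
    have "(u, z) \<in> conn ?E" using cn u xs(2) z(1) by (auto simp: connected_graph_iff)
    from conn_crossing[OF this u z(2)] obtain p q where "{p, q} \<in> ?E" "p \<in> set xs" "q \<notin> set xs" .
    then have "{p, q} \<in> set ?cut" by (auto simp: cut_edge_def)
    then have cut_ne: "?cut \<noteq> []" by force
    have cut_len: "length ?cut \<le> N" using order_trans[OF length_filter_le N(2)] .
    show "spec (case s of (xs, T) \<Rightarrow> do {
         cut \<leftarrow> filter_c (\<lambda>e. do {
             hits \<leftarrow> ends_in_c e xs;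
             return (case hits of [_] \<Rightarrow> True | _ \<Rightarrow> False)
           }) es;
         e \<leftarrow> cheapest_c len c cut;
         hits \<leftarrow> ends_in_c e xs;
         return (other_end (hd hits) e # xs, e # T)
       }) ((N * ((2 * N + 1) + 1 + 1) + 1) + (cheapest_time N + ((2 * N + 1) + 1))) (I (ds @ [x]))"
      unfolding s prod.case
    proof (rule spec_bind1[OF cut], hypsubst, rule spec_bind1[OF spec_cheapest_c[where len = len and c = c, OF cut_ne cut_len]],
        (simp add: N(3); fail), rule spec_bind1[OF spec_ends_in_c[OF lenxs order_refl]], rule spec_return1)
      fix e hits
      assume "e \<in> set ?cut \<and> (\<forall>f\<in>set ?cut. c e \<le> c f)"
        and hits: "hits = filter (\<lambda>x. x \<in> e) xs"
      then have e: "e \<in> ?E" "cut_edge (set xs) e" "\<And>f. f \<in> ?E \<Longrightarrow> cut_edge (set xs) f \<Longrightarrow> c e \<le> c f"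
        by auto
      from hits_cases[OF xs(1) subsetD[OF EV e(1)] hits]
      obtain u v where uv: "hits = [u]" "e = {u, v}" "u \<noteq> v" "u \<in> set xs" "v \<notin> set xs"
        using e(2) by cases (auto simp: cut_edge_def)
      have T_in: "set T \<subseteq> all_edges (set xs)" using T(3) by (simp add: is_tree_iff_card)
      have "e \<notin> set T" using T_in uv all_edges_iff[of u v "set xs"] by blast
      moreover have "extends_optimally ?V ?E c (insert e (set T))"
        by (rule extends_optimally_insert[OF T(4) T_in xs(2) e EV])
      moreover have "is_tree (insert v (set xs), insert e (set T))"
        using tree_insert_cut_edge[OF T(3) uv(4,5)] uv(2) by simp
      moreover have "v \<in> ?V" using subsetD[OF EV e(1)] uv(2) by simp
      ultimately show "I (ds @ [x]) (other_end (hd hits) e # xs, e # T)"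
        using xs T e(1) uv by (simp add: I_def)
    qed
  qed
  then show ?thesis
  proof (rule spec_mono[OF _ order_refl])
    fix s assume Is: "I (tl vs) s"
    obtain xs T where s: "s = (xs, T)" by (cases s)
    have xs: "distinct xs" "set xs \<subseteq> ?V" "length xs = length vs"
      and T: "distinct T" "set T \<subseteq> ?E" "is_tree (set xs, set T)" "extends_optimally ?V ?E c (set T)"
      using Is s ne by (auto simp: I_def)
    have V: "set xs = ?V"
      using xs dist by (intro card_subset_eq) (auto simp: distinct_card)
    have "sum c (set T) \<le> sum c A" if A: "A \<subseteq> ?E" "is_tree (?V, A)" for A
    proof -
      obtain B where B: "B \<subseteq> ?E" "is_tree (?V, B)" "set T \<subseteq> B" "sum c B \<le> sum c A"
        using T(4)[unfolded extends_optimally_def, rule_format, OF A] by blast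
      \<comment> \<open>The dominating tree \<open>B\<close> contains \<open>set T\<close> and has
        equally many edges, so the two coincide and the extension property becomes
        optimality.\<close>
      have "finite B" using B(1) finite_subset by blast
      moreover have "card (set T) = card B" using B(2) T(3) V by (simp add: is_tree_iff_card)
      ultimately have "set T = B" using B(3) by (intro card_subset_eq)
      then show ?thesis using B(4) by simp
    qed
    then show "mst_solution (vs, es, c) s"
      using xs T V s by (simp add: irredundant_def spanning_tree_def subgraph_def graph_of_def)
  qed
qed

lemma polyfun_prim_time: "polyfun prim_time"
  unfolding prim_time_def[abs_def] cheapest_time_def by (intro polyfun_intros)

lemma poly_time_mst_prim: "poly_time_mst len (prim len)"
  unfolding poly_time_mst_def poly_time_approximation_iff
proof (intro exI[of _ prim_time] conjI polyfun_prim_time allI impI)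
  fix G :: "'a wgraph" assume G: "mst_instance G"
  obtain vs es c where g: "G = (vs, es, c)" by (cases G)
  show "spec (prim len G) (prim_time (wgraph_size len G)) (\<lambda>T. irredundant T \<and>
      spanning_tree (wgraph G) (graph_of T) \<and>
      (\<forall>T_opt. is_arg_min (graph_cost (edge_cost G)) (spanning_tree (wgraph G)) T_opt \<longrightarrow>
        graph_cost (edge_cost G) (graph_of T) \<le> 1 * graph_cost (edge_cost G) T_opt))"
    unfolding g
  proof (rule spec_mono[OF spec_prim[OF G[unfolded g] order_refl] order_refl])
    fix T assume T: "mst_solution (vs, es, c) T"
    have "sum c (set (snd T)) \<le> sum c (snd A)" if A: "spanning_tree (set vs, set es) A" for A
    proof -
      have "is_tree (set vs, snd A)" "snd A \<subseteq> set es"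
        using A by (cases A; simp add: spanning_tree_def subgraph_def)+
      then show ?thesis using T by simp
    qed
    then show "irredundant T \<and> spanning_tree (wgraph (vs, es, c)) (graph_of T) \<and>
      (\<forall>T_opt. is_arg_min (graph_cost (edge_cost (vs, es, c))) (spanning_tree (wgraph (vs, es, c))) T_opt \<longrightarrow>
        graph_cost (edge_cost (vs, es, c)) (graph_of T) \<le> 1 * graph_cost (edge_cost (vs, es, c)) T_opt)"
      using T by (simp add: is_arg_min_def graph_cost_def graph_of_def)
  qed
qed

section \<open>Contraction of the clusters\<close>

definition contract_edge_time :: "nat \<Rightarrow> nat" where
  "contract_edge_time N = (2 * N + 1) + ((2 * N + 1) + ((N * ((2 * N + 1) + 1) + 1) + 1))"

definition contract_time :: "nat \<Rightarrow> nat" where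
  "contract_time N = N * (N * contract_edge_time N + 1) + 1"

definition map_time :: "nat \<Rightarrow> nat" where
  "map_time N = (N * 1 + 1) + (N * (N * 1 + 1) + 1)"

lemma in_set_tlD: "x \<in> set (tl xs) \<Longrightarrow> x \<in> set xs"
  by (cases xs) auto

locale csistp_data =
  fixes vs :: "'v list" and es :: "'v set list" and c :: "'v set \<Rightarrow> real"
    and Cs :: "('v list \<times> 'v list) list"
  assumes inst: "csistp_instance ((vs, es, c), Cs)"
    and metric: "metric_instance ((vs, es, c), Cs)"
    and unselected: "two_unselected ((vs, es, c), Cs)"
begin

abbreviation "V \<equiv> set vs"

lemma distinct_vs: "distinct vs" and distinct_es: "distinct es" and set_es: "set es = all_edges V"
  using inst by (auto simp: irredundant_def complete_graph_def)

sublocale metric_costs V c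
proof
  show "0 \<le> c e" if "e \<in> all_edges V" for e using inst that set_es by auto
qed (use metric in auto)

lemma clusterD:
  assumes "C \<in> set Cs"
  shows "distinct (fst C)" "distinct (snd C)" "fst C \<noteq> []" "set (fst C) \<subseteq> V" "set (snd C) \<subseteq> set (fst C)"
    "hd (fst C) \<in> set (fst C)"
  using inst assms by (auto simp: case_prod_unfold)

lemma cluster_disjoint:
  assumes "i < length Cs" "j < length Cs" "x \<in> cluster Cs i" "x \<in> cluster Cs j"
  shows "i = j"
proof -
  have "i \<noteq> j \<longrightarrow> cluster Cs i \<inter> cluster Cs j = {}" using inst assms(1,2) by simp
  then show ?thesis using assms(3,4) by blast
qed

lemma cluster_unique:
  assumes "C \<in> set Cs" "D \<in> set Cs" "x \<in> set (fst C)" "x \<in> set (fst D)"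
  shows "C = D"
  using assms cluster_disjoint by (metis cluster_def in_set_conv_nth)

lemma cluster_nonempty: "i < length Cs \<Longrightarrow> cluster Cs i \<noteq> {}"
  using clusterD(3)[of "Cs ! i"] by (simp add: cluster_def)

lemma cluster_distinct:
  assumes "Cs = ys @ C # zs" "D \<in> set ys"
  shows "set (fst C) \<inter> set (fst D) = {}"
proof -
  obtain i where i: "i < length ys" "D = ys ! i" using assms(2) by (auto simp: in_set_conv_nth)
  then have "cluster Cs i = set (fst D)" "cluster Cs (length ys) = set (fst C)"
    using assms(1) by (auto simp: cluster_def nth_append)
  then show ?thesis using cluster_disjoint[of i "length ys"] i assms(1) by auto
qed

text \<open>The quotient map onto \<open>G/R\<close>, stated without reference to the order of the
  contractions. The choice is unique because the clusters are disjoint.\<close>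

definition rep :: "'v \<Rightarrow> 'v" where
  "rep x = (if \<exists>C\<in>set Cs. x \<in> set (fst C) then hd (fst (SOME C. C \<in> set Cs \<and> x \<in> set (fst C))) else x)"

lemma rep_cluster:
  assumes "C \<in> set Cs" "x \<in> set (fst C)"
  shows "rep x = hd (fst C)"
proof -
  have "(SOME C. C \<in> set Cs \<and> x \<in> set (fst C)) = C"
    using assms cluster_unique by (intro some_equality) blast+
  then show ?thesis using assms by (auto simp: rep_def)
qed

lemma rep_other: "(\<And>C. C \<in> set Cs \<Longrightarrow> x \<notin> set (fst C)) \<Longrightarrow> rep x = x"
  by (auto simp: rep_def)

text \<open>The vertices that disappear in the contraction; the others form the vertex set of
  \<open>G/R\<close>.\<close>

definition absorbed :: "'v set" where
  "absorbed = (\<Union>C\<in>set Cs. set (tl (fst C)))"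

lemma absorbed_subset: "absorbed \<subseteq> V"
  unfolding absorbed_def using clusterD(4) by (auto dest: in_set_tlD)

lemma hd_not_absorbed:
  assumes "C \<in> set Cs"
  shows "hd (fst C) \<notin> absorbed"
proof
  assume "hd (fst C) \<in> absorbed"
  then obtain D where D: "D \<in> set Cs" "hd (fst C) \<in> set (tl (fst D))" by (auto simp: absorbed_def)
  then have "C = D" 
    by (intro cluster_unique[OF assms D(1) clusterD(6)[OF assms] in_set_tlD])
  then show False using D clusterD(1,3)[OF assms] by (cases "fst C") auto
qed

lemma rep_not_absorbed: "rep x \<notin> absorbed"
proof (cases "\<exists>C\<in>set Cs. x \<in> set (fst C)")
  case True
  then show ?thesis using rep_cluster hd_not_absorbed by auto
next
  case False
  then have "rep x = x" "x \<notin> absorbed"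
    by (auto simp: rep_other absorbed_def dest: in_set_tlD)
  then show ?thesis by simp
qed

lemma rep_in_V: "x \<in> V \<Longrightarrow> rep x \<in> V"
  using rep_cluster[of _ x] rep_other[of x] clusterD(4,6) by (metis subsetD)

lemma rep_id: "x \<notin> absorbed \<Longrightarrow> rep x = x"
proof (cases "\<exists>C\<in>set Cs. x \<in> set (fst C)")
  case True
  then obtain C where C: "C \<in> set Cs" "x \<in> set (fst C)" by blast
  assume "x \<notin> absorbed"
  then have "x \<notin> set (tl (fst C))" using C by (auto simp: absorbed_def)
  then have "x = hd (fst C)" using C by (cases "fst C") auto
  then show ?thesis using rep_cluster[OF C] by simp
qed (auto simp: rep_other)

text \<open>The graph obtained when the vertices in \<open>D\<close> have been merged into their representatives.\<close>

definition part_rep :: "'v set \<Rightarrow> 'v \<Rightarrow> 'v" where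
  "part_rep D x = (if x \<in> D then rep x else x)"

text \<open>The last two conjuncts make \<open>c' e\<close> the minimum of \<open>c\<close> over the
  edges of \<open>G\<close> mapped to \<open>e\<close>. One half lets a tree be lifted at equal
  cost, the other bounds the projection of the optimal tree.\<close>

fun contracted :: "'v set \<Rightarrow> 'v wgraph \<Rightarrow> bool" where
  "contracted D (vs', es', c') \<longleftrightarrow>
    vs' = filter (\<lambda>x. x \<notin> D) vs \<and> es' = filter (\<lambda>e. e \<inter> D = {}) es \<and>
    (\<forall>e\<in>set es'. \<exists>d\<in>set es. c d = c' e \<and> part_rep D ` d = e) \<and>
    (\<forall>d\<in>set es. card (part_rep D ` d) = 2 \<longrightarrow> c' (part_rep D ` d) \<le> c d)"

lemma contractedD:
  assumes "contracted D (vs', es', c')"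
  shows "vs' = filter (\<lambda>x. x \<notin> D) vs" "es' = filter (\<lambda>e. e \<inter> D = {}) es" "set vs' = V - D"
    "set es' = all_edges (V - D)"
    "e \<in> set es' \<Longrightarrow> \<exists>d\<in>set es. c d = c' e \<and> part_rep D ` d = e"
    "d \<in> set es \<Longrightarrow> card (part_rep D ` d) = 2 \<Longrightarrow> c' (part_rep D ` d) \<le> c d"
proof -
  show "vs' = filter (\<lambda>x. x \<notin> D) vs" and es: "es' = filter (\<lambda>e. e \<inter> D = {}) es"
    and "e \<in> set es' \<Longrightarrow> \<exists>d\<in>set es. c d = c' e \<and> part_rep D ` d = e"
    and "d \<in> set es \<Longrightarrow> card (part_rep D ` d) = 2 \<Longrightarrow> c' (part_rep D ` d) \<le> c d"
    using assms unfolding contracted.simps by blast+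
  then show "set vs' = V - D" by auto
  show "set es' = all_edges (V - D)" unfolding es by (auto simp: set_es all_edges_def)
qed

lemma contracted_empty: "contracted {} (vs, es, c)"
proof -
  have "part_rep {} ` d = d" for d by (auto simp: part_rep_def)
  then show ?thesis by auto
qed

text \<open>\<open>c''\<close> is the cost array after the loop in closed form: each edge at
  \<open>rep v\<close> is compared with its parallel at \<open>v\<close>. Since contractions
  compose, a minimum over preimages is preserved.\<close>

lemma contracted_insert:
  assumes G: "contracted D (vs', es', c')" and D: "D \<subseteq> absorbed" and v: "v \<in> absorbed" "v \<notin> D"
    and c'': "\<And>e. c'' e = (if \<exists>x\<in>V - insert v D. x \<noteq> rep v \<and> e = {rep v, x}
        then min (c' e) (c' (insert v (e - {rep v}))) else c' e)"
  shows "contracted (insert v D) (filter (\<lambda>x. x \<noteq> v) vs', filter (\<lambda>e. v \<notin> e) es', c'')"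
proof -
  let ?u = "rep v"
  have u: "?u \<notin> absorbed" "?u \<in> V" using rep_not_absorbed rep_in_V absorbed_subset v by auto
  note es' = contractedD(4)[OF G]
  \<comment> \<open>Representatives are never absorbed, so no vertex of \<open>D\<close> is sent to
    \<open>v\<close>, and merging \<open>v\<close> afterwards is a plain composition of
    maps.\<close>
  have img: "part_rep (insert v D) ` d = (\<lambda>y. if y = v then ?u else y) ` part_rep D ` d" for d
    using D v rep_not_absorbed by (auto simp: part_rep_def image_image intro!: image_cong)
  have merged: "c'' {?u, x} \<le> c' {v, x}" "c'' {?u, x} = c' {?u, x} \<or> c'' {?u, x} = c' {v, x}"
    if "x \<in> V - insert v D" "x \<noteq> ?u" for x
  proof -
    have "insert v ({?u, x} - {?u}) = {v, x}" using that by auto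
    then show "c'' {?u, x} \<le> c' {v, x}" "c'' {?u, x} = c' {?u, x} \<or> c'' {?u, x} = c' {v, x}"
      using that by (auto simp: c'' min_def)
  qed
  have le: "c'' e \<le> c' e" for e by (simp add: c'')
  have 1: "\<exists>d\<in>set es. c d = c'' e \<and> part_rep (insert v D) ` d = e" if e: "e \<in> set es'" "v \<notin> e" for e
  proof -
    have lift: "\<exists>d\<in>set es. c d = c' e' \<and> part_rep (insert v D) ` d = (\<lambda>y. if y = v then ?u else y) ` e'"
      if "e' \<in> set es'" for e'
    proof -
      obtain d where "d \<in> set es" "c d = c' e'" "part_rep D ` d = e'"
        using contractedD(5)[OF G \<open>e' \<in> set es'\<close>] by blast
      then show ?thesis unfolding img by blast
    qed
    have id: "(\<lambda>y. if y = v then ?u else y) ` e = e" using e(2) by force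
    show ?thesis
    proof (cases "c'' e = c' e")
      case True
      then show ?thesis using lift[OF e(1)] id by simp
    next
      case False
      then obtain x where x: "x \<in> V - insert v D" "x \<noteq> ?u" "e = {?u, x}" using c''[of e] by (auto split: if_splits)
      then have "c'' e = c' {v, x}" using merged(2)[OF x(1,2)] False by simp
      moreover have "{v, x} \<in> set es'" using x v absorbed_subset unfolding es' by auto
      moreover have "(\<lambda>y. if y = v then ?u else y) ` {v, x} = e" using x by auto
      ultimately show ?thesis using lift[of "{v, x}"] by simp
    qed
  qed
  have 2: "c'' (part_rep (insert v D) ` d) \<le> c d" if d: "d \<in> set es" "card (part_rep (insert v D) ` d) = 2" for d
  proof -
    have fin: "finite (part_rep D ` d)"
      using d set_es by (auto simp: all_edges_def intro: finite_subset)
    have "card (part_rep D ` d) \<le> card d" using d set_es by (intro card_image_le) (auto simp: all_edges_def intro: finite_subset)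
    moreover have "2 \<le> card (part_rep D ` d)" using card_image_le[OF fin] d(2) unfolding img by metis
    moreover have "card d = 2" using d set_es by (auto simp: all_edges_def)
    ultimately have two: "card (part_rep D ` d) = 2" by simp
    then obtain p q where pq: "part_rep D ` d = {p, q}" "p \<noteq> q" by (auto simp: card_2_iff)
    have "part_rep D ` d \<subseteq> V - D"
      using d set_es D rep_not_absorbed rep_in_V by (auto simp: part_rep_def all_edges_def)
    then have pqV: "p \<in> V - D" "q \<in> V - D" using pq by auto
    have old: "c' {p, q} \<le> c d" using contractedD(6)[OF G d(1) two] pq(1) by simp
    have step: "c'' {?u, y} \<le> c d" if "{p, q} = {v, y}" "y \<in> V - D" "y \<noteq> v" "card {?u, y} = 2" for y
    proof -
      have "y \<noteq> ?u" using that(4) by auto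
      then show ?thesis using merged(1)[of y] old that by simp
    qed
    consider "p = v" | "q = v" | "p \<noteq> v" "q \<noteq> v" by blast
    then show ?thesis
    proof cases
      case 1
      then show ?thesis using step[of q] d(2) pq pqV unfolding img pq(1) by (auto simp: insert_commute)
    next
      case 2
      then show ?thesis using step[of p] d(2) pq pqV unfolding img pq(1) by (auto simp: insert_commute)
    next
      case 3
      then show ?thesis using old le[of "{p, q}"] unfolding img pq(1) by auto
    qed
  qed
  have "filter (\<lambda>x. x \<noteq> v) vs' = filter (\<lambda>x. x \<notin> insert v D) vs"
    "filter (\<lambda>e. v \<notin> e) es' = filter (\<lambda>e. e \<inter> insert v D = {}) es"
    using contractedD(1,2)[OF G] by (auto intro!: filter_cong)
  moreover have "\<exists>d\<in>set es. c d = c'' e \<and> part_rep (insert v D) ` d = e"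
    if "e \<in> set (filter (\<lambda>e. v \<notin> e) es')" for e
    using that by (intro 1) simp_all
  ultimately show ?thesis unfolding contracted.simps using 2 by blast
qed

lemma contracted_cost_mem: "contracted D (vs', es', c') \<Longrightarrow> e \<in> set es' \<Longrightarrow> c' e \<in> c ` set es"
  using contractedD(5) by (metis imageI)

lemma spec_contract_edge_c:
  assumes G: "contracted D G" and D: "D \<subseteq> absorbed" and v: "v \<in> absorbed" "v \<notin> D"
    and N: "length vs \<le> N" "length es \<le> N" "\<And>e. e \<in> set es \<Longrightarrow> len (c e) \<le> N"
  shows "spec (contract_edge_c len (rep v) v G) (contract_edge_time N) (contracted (insert v D))"
proof -
  obtain vs' es' c' where g: "G = (vs', es', c')" by (cases G)
  note G = G[unfolded g]
  let ?u = "rep v"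
  let ?vs = "filter (\<lambda>x. x \<noteq> v) vs'" and ?es = "filter (\<lambda>e. v \<notin> e) es'"
  have sz: "length vs' \<le> N" "length es' \<le> N"
    using contractedD(1,2)[OF G] order_trans[OF length_filter_le N(1)] order_trans[OF length_filter_le N(2)]
    by simp_all
  have u: "?u \<notin> absorbed" "?u \<in> V" using rep_not_absorbed rep_in_V absorbed_subset v by auto
  note es' = contractedD(4)[OF G]
  have vs: "set ?vs = V - insert v D" using contractedD(3)[OF G] by auto
  have short: "len (c' e) \<le> N" if "e \<in> set es'" for e
    using contracted_cost_mem[OF G that] N(3) by auto
  \<comment> \<open>For \<open>e = {rep v, x}\<close> the set \<open>insert v (e - {rep v})\<close>
    is \<open>{v, x}\<close>. The loop reads the old array \<open>c'\<close> only, so the closed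
    form does not depend on the order of \<open>xs\<close>.\<close>
  define I where "I xs cc \<longleftrightarrow> (\<forall>e. cc e = (if \<exists>x\<in>set xs. x \<noteq> ?u \<and> e = {?u, x}
        then min (c' e) (c' (insert v (e - {?u}))) else c' e))" for xs cc
  have "spec (fold_c (\<lambda>x cc. if x = ?u then return cc
         else do {
           b \<leftarrow> num_le len (c' {?u, x}) (c' {v, x});
           return (cc({?u, x} := (if b then c' {?u, x} else c' {v, x})))
         }) ?vs c') (N * ((2 * N + 1) + 1) + 1) (I ?vs)"
  proof (rule spec_fold_c[OF _ _ _ order_refl])
    show "I [] c'" by (simp add: I_def)
    show "length ?vs \<le> N" using order_trans[OF length_filter_le sz(1)] .
    fix ys x zs cc assume split: "?vs = ys @ x # zs" and I: "I ys cc"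
    show "spec (if x = ?u then return cc
         else do {
           b \<leftarrow> num_le len (c' {?u, x}) (c' {v, x});
           return (cc({?u, x} := (if b then c' {?u, x} else c' {v, x})))
         }) ((2 * N + 1) + 1) (I (ys @ [x]))"
    proof (cases "x = ?u")
      case True
      then have "I (ys @ [x]) cc" using I by (auto simp: I_def)
      then show ?thesis using True by (simp add: spec_return)
    next
      case False
      have "x \<in> V - insert v D" using vs split by (metis in_set_conv_decomp)
      then have "{?u, x} \<in> set es'" "{v, x} \<in> set es'"
        using False u v D absorbed_subset unfolding es' by auto
      then have "spec (num_le len (c' {?u, x}) (c' {v, x})) (2 * N + 1) (\<lambda>b. b = (c' {?u, x} \<le> c' {v, x}))"
        using short[of "{?u, x}"] short[of "{v, x}"] by (simp add: spec_def num_le_def)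
      then have "spec (do {
           b \<leftarrow> num_le len (c' {?u, x}) (c' {v, x});
           return (cc({?u, x} := (if b then c' {?u, x} else c' {v, x})))
         }) ((2 * N + 1) + 1) (I (ys @ [x]))"
      proof (rule spec_bind1, hypsubst, intro spec_return1)
        have "insert v ({?u, x} - {?u}) = {v, x}" using False by auto
        then show "I (ys @ [x]) (cc({?u, x} := (if c' {?u, x} \<le> c' {v, x} then c' {?u, x} else c' {v, x})))"
          using I False by (auto simp: I_def min_def doubleton_eq_iff)
      qed
      then show ?thesis using False by simp
    qed
  qed
  then have tail: "spec (do {
      cc \<leftarrow> fold_c (\<lambda>x cc. if x = ?u then return cc
         else do {
           b \<leftarrow> num_le len (c' {?u, x}) (c' {v, x});
           return (cc({?u, x} := (if b then c' {?u, x} else c' {v, x})))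
         }) ?vs c';
      return (?vs, ?es, cc)
    }) ((N * ((2 * N + 1) + 1) + 1) + 1) (contracted (insert v D))"
    by (rule spec_bind1, intro spec_return1 contracted_insert[OF G D v]) (simp only: I_def vs)
  show ?thesis
    unfolding g contract_edge_c.simps contract_edge_time_def
    by (rule spec_bind1[OF spec_remove_c[OF sz(1) order_refl]], hypsubst,
        rule spec_bind1[OF spec_filter_return[OF sz(2) order_refl]], hypsubst, rule tail)
qed

lemma spec_contract_clusters_c:
  assumes N: "length vs \<le> N" "length es \<le> N" "\<And>e. e \<in> set es \<Longrightarrow> len (c e) \<le> N"
    "length Cs \<le> N" "\<And>C. C \<in> set Cs \<Longrightarrow> length (fst C) \<le> N"
  shows "spec (contract_clusters_c len Cs (vs, es, c)) (contract_time N) (contracted absorbed)"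
proof -
  have "spec (contract_clusters_c len Cs (vs, es, c)) (contract_time N)
      (contracted (\<Union>C\<in>set Cs. set (tl (fst C))))"
    unfolding contract_clusters_c_def contract_time_def
  proof (rule spec_fold_c[OF _ _ N(4) order_refl, where I = "\<lambda>ys. contracted (\<Union>C\<in>set ys. set (tl (fst C)))"])
    show "contracted (\<Union>C\<in>set []. set (tl (fst C))) (vs, es, c)" using contracted_empty by simp
    fix ys C zs G
    assume split: "Cs = ys @ C # zs" and G: "contracted (\<Union>C\<in>set ys. set (tl (fst C))) G"
    let ?D = "\<Union>C\<in>set ys. set (tl (fst C))"
    have C: "C \<in> set Cs" "set ys \<subseteq> set Cs" using split by auto
    have D: "?D \<subseteq> absorbed" using C(2) by (auto simp: absorbed_def)
    have "spec (fold_c (contract_edge_c len (hd (fst C))) (tl (fst C)) G) (N * contract_edge_time N + 1)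
      (contracted (?D \<union> set (tl (fst C))))"
    proof (rule spec_fold_c[OF _ _ _ order_refl, where I = "\<lambda>ws. contracted (?D \<union> set ws)"])
      show "contracted (?D \<union> set []) G" using G by simp
      show "length (tl (fst C)) \<le> N" using N(5)[OF C(1)] by simp
      fix ws v ws' H assume ws: "tl (fst C) = ws @ v # ws'" and H: "contracted (?D \<union> set ws) H"
      have v: "v \<in> set (tl (fst C))" using ws by simp
      then have abs: "v \<in> absorbed" and rv: "rep v = hd (fst C)"
        using C(1) rep_cluster[OF C(1) in_set_tlD[OF v]] by (auto simp: absorbed_def)
      have nv: "v \<notin> ?D \<union> set ws"
      proof -
        have "v \<notin> set ws" using distinct_tl[OF clusterD(1)[OF C(1)]] ws by simp
        moreover have "v \<notin> set (tl (fst B))" if "B \<in> set ys" for B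
          using cluster_distinct[OF split that] in_set_tlD[OF v] in_set_tlD[of v "fst B"] by blast
        ultimately show ?thesis by blast
      qed
      have sub: "?D \<union> set ws \<subseteq> absorbed"
        using D ws C(1) by (auto simp: absorbed_def intro!: bexI[of _ C])
      show "spec (contract_edge_c len (hd (fst C)) v H) (contract_edge_time N) (contracted (?D \<union> set (ws @ [v])))"
        using spec_contract_edge_c[where len = len, OF H sub abs nv N(1-3)] rv by simp
    qed
    moreover have "?D \<union> set (tl (fst C)) = (\<Union>C\<in>set (ys @ [C]). set (tl (fst C)))" by auto
    ultimately show "spec ((case C of (R, R') \<Rightarrow> fold_c (contract_edge_c len (hd R)) (tl R)) G)
        (N * contract_edge_time N + 1) (contracted (\<Union>C\<in>set (ys @ [C]). set (tl (fst C))))"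
      by (simp add: case_prod_unfold)
  qed
  then show ?thesis by (simp add: absorbed_def)
qed

lemma spec_contraction_map_c:
  assumes N: "length vs \<le> N" "length Cs \<le> N" "\<And>C. C \<in> set Cs \<Longrightarrow> length (fst C) \<le> N"
  shows "spec (contraction_map_c vs Cs) (map_time N) (\<lambda>f. \<forall>x\<in>V. f x = rep x)"
  unfolding contraction_map_c_def map_time_def
proof (rule spec_bind1[OF spec_fold_c[OF _ _ N(1) order_refl, where I = "\<lambda>ys f. \<forall>x\<in>set ys. f x = x"]])
  fix f0 :: "'v \<Rightarrow> 'v" assume f0: "\<forall>x\<in>V. f0 x = x"
  let ?U = "\<lambda>ys. \<Union>C\<in>set ys. set (fst C)"
  have "spec (fold_c (\<lambda>(R, R'). fold_c (\<lambda>v f. return (f(v := hd R))) R) Cs f0) (N * (N * 1 + 1) + 1)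
    (\<lambda>f. \<forall>x\<in>V. f x = (if x \<in> ?U Cs then rep x else x))"
  proof (rule spec_fold_c[OF _ _ N(2) order_refl, where I = "\<lambda>ys f. \<forall>x\<in>V. f x = (if x \<in> ?U ys then rep x else x)"])
    show "\<forall>x\<in>V. f0 x = (if x \<in> ?U [] then rep x else x)" using f0 by simp
    fix ys C zs f
    assume split: "Cs = ys @ C # zs" and f: "\<forall>x\<in>V. f x = (if x \<in> ?U ys then rep x else x)"
    have C: "C \<in> set Cs" using split by simp
    have "spec (fold_c (\<lambda>v f. return (f(v := hd (fst C)))) (fst C) f) (N * 1 + 1)
      (\<lambda>f. \<forall>x\<in>V. f x = (if x \<in> ?U ys \<union> set (fst C) then rep x else x))"
    proof (rule spec_fold_c[OF _ _ N(3)[OF C] order_refl,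
          where I = "\<lambda>ws f. \<forall>x\<in>V. f x = (if x \<in> ?U ys \<union> set ws then rep x else x)"])
      show "\<forall>x\<in>V. f x = (if x \<in> ?U ys \<union> set [] then rep x else x)" using f by simp
      fix ws v ws' g
      assume "fst C = ws @ v # ws'" and g: "\<forall>x\<in>V. g x = (if x \<in> ?U ys \<union> set ws then rep x else x)"
      then have "rep v = hd (fst C)" using rep_cluster[OF C, of v] by simp
      then show "spec (return (g(v := hd (fst C)))) 1
          (\<lambda>f. \<forall>x\<in>V. f x = (if x \<in> ?U ys \<union> set (ws @ [v]) then rep x else x))"
        using g by (intro spec_return1) auto
    qed
    moreover have "?U ys \<union> set (fst C) = ?U (ys @ [C])" by auto
    ultimately show "spec ((case C of (R, R') \<Rightarrow> fold_c (\<lambda>v f. return (f(v := hd R))) R) f) (N * 1 + 1)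
      (\<lambda>f. \<forall>x\<in>V. f x = (if x \<in> ?U (ys @ [C]) then rep x else x))"
      by (simp add: case_prod_unfold)
  qed
  then show "spec (fold_c (\<lambda>(R, R'). fold_c (\<lambda>v f. return (f(v := hd R))) R) Cs f0) (N * (N * 1 + 1) + 1)
    (\<lambda>f. \<forall>x\<in>V. f x = rep x)"
    by (rule spec_mono[OF _ order_refl]) (auto simp: rep_other split: if_splits)
qed (auto intro: spec_return)

end

section \<open>Comparison with an optimal solution\<close>

text \<open>The analysis of \<open>ham_path_c\<close> doubles as an existence proof, through
  \<open>spec_ex\<close>; filtering its output to \<open>R\<close> is a sequence of shortcuts. A
  tree without edges is treated apart, as it has no two distinct ends to choose.\<close>

lemma (in metric_costs) ex_spanning_path:
  assumes tree: "is_tree (W, B)" and W: "W \<subseteq> V" and R: "R \<subseteq> W" "R \<noteq> {}"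
  shows "\<exists>A. is_tree (R, A) \<and> sum c A \<le> 2 * sum c B"
proof (cases "B = {}")
  case True
  then obtain a where "W = {a}" using tree by (auto simp: is_tree_iff_card card_1_singleton_iff)
  then have "R = W" using R by auto
  then show ?thesis using tree True by auto
next
  case False
  have BW: "B \<subseteq> all_edges W" and "finite W" using tree is_tree_iff_bridges by blast+
  then have "finite B" using finite_all_edges finite_subset by blast
  then obtain bs where bs: "set bs = B" "distinct bs" using finite_distinct_list by blast
  obtain e where "e \<in> B" using False by blast
  then obtain a b where ab: "a \<noteq> b" "a \<in> W" "b \<in> W" using BW by (auto elim!: all_edgesE)
  from spec_ham_path_c[of W bs a b, OF _ bs(2) W ab(2,3) ab(1) order_refl order_refl] tree bs(1)
  obtain p where p: "ham_post W B a b p" by (auto dest: spec_ex)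
  let ?q = "filter (\<lambda>x. x \<in> R) p"
  have q: "distinct ?q" "set ?q = R" using p R(1) by (auto simp: ham_post_def)
  have "0 \<le> (if {a, b} \<in> B then c {a, b} else 0)" using edge_nonneg[OF BW W] by simp
  then have "path_cost c p \<le> 2 * sum c B" using p by (simp add: ham_post_def)
  moreover have "path_cost c ?q \<le> path_cost c p"
    using p W by (intro path_cost_filter) (auto simp: ham_post_def)
  ultimately have "sum c (set (path_edges ?q)) \<le> 2 * sum c B"
    using path_cost_eq[OF q(1), of c] by simp
  moreover have "is_tree (R, set (path_edges ?q))"
    using is_tree_path[OF q(1)] q(2) R(2) by (metis set_empty)
  ultimately show ?thesis by blast
qed

context csistp_data
begin

lemma cluster_trees_le:
  assumes T: "clustered_steiner_tree (V, set es) (length Cs) (cluster Cs) (W, E)"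
  shows "\<exists>A. (\<forall>i<length Cs. is_tree (cluster Cs i, A i)) \<and> (\<Sum>i<length Cs. sum c (A i)) \<le> 2 * sum c E"
proof -
  let ?k = "length Cs"
  have tree: "is_tree (W, E)" and sub: "W \<subseteq> V"
    using T by (auto simp: clustered_steiner_tree_def steiner_tree_def subgraph_def)
  obtain F C where FC: "F \<subseteq> E" "bij_betw C {..<?k} (components (W, E - F))" "\<And>i. i < ?k \<Longrightarrow> cluster Cs i \<subseteq> C i"
    using T by (auto simp: clustered_steiner_tree_def)
  have finW: "finite W" and EW: "E \<subseteq> all_edges W" and br: "all_bridges E"
    using tree is_tree_iff_bridges by blast+
  have finE: "finite E" using EW finW finite_all_edges finite_subset by blast
  define B where "B = (\<lambda>i. {e \<in> E - F. e \<subseteq> C i})"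
  have C: "\<exists>a\<in>W. C i = comp_of (W, E - F) a" if "i < ?k" for i
  proof -
    have "C i \<in> comp_of (W, E - F) ` W" using FC(2) that by (auto simp: bij_betw_def components_eq)
    then show ?thesis by blast
  qed
  have CW: "C i \<subseteq> W" if "i < ?k" for i using C[OF that] by (auto simp: comp_of_def)
  have Btree: "is_tree (C i, B i)" if i: "i < ?k" for i
  proof -
    obtain a where a: "a \<in> W" "C i = comp_of (W, E - F) a" using C[OF i] by blast
    have "E - F \<subseteq> all_edges W" "all_bridges (E - F)" using EW all_bridges_subset[OF br] by auto
    from is_tree_component[OF finW this a(1)] show ?thesis unfolding B_def a(2) .
  qed
  have Cdisj: "C i \<inter> C j = {}" if ij: "i < ?k" "j < ?k" "i \<noteq> j" for i j
  proof (rule ccontr)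
    assume "C i \<inter> C j \<noteq> {}"
    then obtain x where x: "x \<in> C i" "x \<in> C j" by blast
    obtain a where a: "a \<in> W" "C i = comp_of (W, E - F) a" using C[OF ij(1)] by blast
    obtain b where b: "b \<in> W" "C j = comp_of (W, E - F) b" using C[OF ij(2)] by blast
    have "(a, x) \<in> conn (E - F)" "(b, x) \<in> conn (E - F)" using x a b by (auto simp: comp_of_def)
    then have "(a, b) \<in> conn (E - F)" by (meson conn_sym rtrancl_trans)
    then have "C i = C j" using a b by (simp add: comp_of_eq_iff)
    then show False using FC(2) ij by (auto simp: bij_betw_def inj_on_def)
  qed
  have disj: "B i \<inter> B j = {}" if "i < ?k" "j < ?k" "i \<noteq> j" for i j
  proof -
    have "C i \<inter> C j = {}" by (rule Cdisj[OF that])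
    \<comment> \<open>Disjoint vertex sets alone would still allow a common empty edge.\<close>
    moreover have "e \<noteq> {}" if "e \<in> E" for e using subsetD[OF EW that] by (auto simp: all_edges_def)
    ultimately show ?thesis unfolding B_def by blast
  qed
  have "\<exists>A. is_tree (cluster Cs i, A) \<and> sum c A \<le> 2 * sum c (B i)" if "i < ?k" for i
    using ex_spanning_path[OF Btree[OF that]] CW[OF that] sub FC(3)[OF that] cluster_nonempty[OF that] by blast
  then obtain A where A: "\<And>i. i < ?k \<Longrightarrow> is_tree (cluster Cs i, A i) \<and> sum c (A i) \<le> 2 * sum c (B i)"
    by metis
  have "(\<Sum>i<?k. sum c (A i)) \<le> (\<Sum>i<?k. 2 * sum c (B i))" using A by (intro sum_mono) auto
  also have "\<dots> = 2 * (\<Sum>i<?k. sum c (B i))" by (simp add: sum_distrib_left)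
  also have "(\<Sum>i<?k. sum c (B i)) = sum c (\<Union>i<?k. B i)"
    using disj finE by (intro sum.UNION_disjoint[symmetric]) (auto simp: B_def)
  also have "\<dots> \<le> sum c E"
    using finE edge_nonneg[OF EW sub] by (intro sum_mono2) (auto simp: B_def)
  finally have "(\<Sum>i<?k. sum c (A i)) \<le> 2 * sum c E" by simp
  with A show ?thesis by blast
qed

lemma part_rep_absorbed: "part_rep absorbed = rep"
  by (auto simp: part_rep_def rep_id)

text \<open>Edges inside a cluster collapse and are dropped, parallel images count once, and passing
  to a spanning tree discards cycles. None of this raises the cost, because costs are nonnegative
  and \<open>c'\<close> of an image is at most \<open>c\<close> of the edge.\<close>

lemma contracted_tree_le:
  assumes G: "contracted absorbed (vs', es', c')"
    and tree: "is_tree (W, E)" "W \<subseteq> V" "E \<subseteq> set es" and R: "\<And>C. C \<in> set Cs \<Longrightarrow> set (fst C) \<subseteq> W"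
  shows "\<exists>T. steiner_tree (set vs', set es') ((hd \<circ> fst) ` set Cs) T \<and> sum c' (snd T) \<le> sum c E"
proof -
  note G = contractedD[OF G, unfolded part_rep_absorbed]
  have finW: "finite W" and EW: "E \<subseteq> all_edges W" and cn: "connected_graph (W, E)"
    using tree is_tree_iff_bridges by blast+
  have finE: "finite E" using EW finW finite_all_edges finite_subset by blast
  define E1 where "E1 = {e \<in> E. card (rep ` e) = 2}"
  define E2 where "E2 = (\<lambda>e. rep ` e) ` E1"
  have E2: "E2 \<subseteq> all_edges (rep ` W)"
    using EW by (auto simp: E2_def E1_def all_edges_def)
  have "(rep x, rep y) \<in> conn E2" if "(x, y) \<in> conn E" for x y
    using that
  proof (induction rule: rtrancl_induct)
    case (step y z)
    have "(rep y, rep z) \<in> conn E2"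
    proof (cases "rep y = rep z")
      case False
      then have "{y, z} \<in> E1" using step.hyps by (simp add: E1_def)
      then have "rep ` {y, z} \<in> E2" unfolding E2_def by blast
      then show ?thesis using conn_edge[of "rep y" "rep z" E2] by simp
    qed simp
    with step.IH show ?case by (rule rtrancl_trans)
  qed simp
  then have "connected_graph (rep ` W, E2)" using cn by (auto simp: connected_graph_iff)
  from ex_spanning_tree[OF _ E2 this] finW
  obtain E3 where E3: "E3 \<subseteq> E2" "is_tree (rep ` W, E3)" by auto
  have V': "rep ` W \<subseteq> V - absorbed" using tree(2) rep_in_V rep_not_absorbed by auto
  then have es': "E2 \<subseteq> set es'" using E2 all_edges_mono G(4) by blast
  have c'nonneg: "0 \<le> c' e" if e: "e \<in> set es'" for e
  proof -
    obtain d where "d \<in> set es" "c d = c' e" using G(5)[OF e] by blast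
    then show ?thesis using nonneg[of d] set_es by simp
  qed
  have "finite E1" using finE by (simp add: E1_def)
  have "sum c' E3 \<le> sum c' E2"
    using E3(1) es' c'nonneg \<open>finite E1\<close> by (intro sum_mono2) (auto simp: E2_def)
  also have "\<dots> \<le> (\<Sum>e\<in>E1. c' (rep ` e))"
    using sum_image_le[OF \<open>finite E1\<close>, of c' "(`) rep"] es' c'nonneg by (auto simp: E2_def comp_def)
  also have "\<dots> \<le> sum c E1" using G(6) tree(3) by (intro sum_mono) (auto simp: E1_def)
  also have "\<dots> \<le> sum c E"
    using finE edge_nonneg[OF EW tree(2)] by (intro sum_mono2) (auto simp: E1_def)
  finally have "sum c' E3 \<le> sum c E" .
  moreover have "(hd \<circ> fst) ` set Cs \<subseteq> rep ` W"
    using R clusterD(6) rep_cluster by (force simp: image_iff)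
  ultimately show ?thesis
    using E3 V' es' G(3) by (intro exI[of _ "(rep ` W, E3)"]) (auto simp: steiner_tree_def subgraph_def)
qed

section \<open>Replacing the contracted clusters by the paths\<close>

definition path_ok :: "'v list \<times> 'v list \<Rightarrow> 'v list \<Rightarrow> bool" where
  "path_ok C p \<longleftrightarrow> distinct p \<and> set p = set (fst C) \<and> hd p \<notin> set (snd C) \<and> last p \<notin> set (snd C)"

lemma distinct_fst_Cs: "distinct (map fst Cs)"
proof -
  have "i = j" if "i < length Cs" "j < length Cs" "fst (Cs ! i) = fst (Cs ! j)" for i j
    using cluster_disjoint[of i j "hd (fst (Cs ! i))"] clusterD(6)[of "Cs ! i"] that by (simp add: cluster_def)
  then show ?thesis by (auto simp: distinct_conv_nth)
qed

text \<open>\<open>rev\<close> appears because the folds put each new list in front. Connectivity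
  and the edge count make the result a tree; the path of a cluster is itself the local tree, so its
  inner vertices are internal there.\<close>

lemma assembled_solution:
  assumes G: "contracted absorbed (vs', es', c')"
    and paths: "list_all2 path_ok Cs ps"
    and tree: "is_tree (set vT, set eT)" and dist: "distinct vT" "distinct eT"
    and sub: "set vT \<subseteq> set vs'" "set eT \<subseteq> set es'" and heads: "(hd \<circ> fst) ` set Cs \<subseteq> set vT"
    and ds: "list_all2 (\<lambda>e d. d \<in> set es \<and> c d = c' e \<and> rep ` d = e) eT ds"
  defines "vo \<equiv> concat (rev (map fst Cs)) @ filter (\<lambda>x. x \<notin> (hd \<circ> fst) ` set Cs) vT"
    and "eo \<equiv> concat (rev (map path_edges ps)) @ ds"
  shows "irredundant (vo, eo)"
    and "clustered_selected_internal_steiner_tree (V, set es) (length Cs) (cluster Cs) (selected Cs) (set vo, set eo)"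
    and "sum c (set eo) = sum_list (map (path_cost c) ps) + sum c' (set eT)"
proof -
  let ?k = "length Cs" and ?heads = "(hd \<circ> fst) ` set Cs"
  note G = contractedD[OF G, unfolded part_rep_absorbed]
  have lenps: "length ps = ?k" using list_all2_lengthD[OF paths] by simp
  have nth_ok: "path_ok (Cs ! i) (ps ! i)" if "i < ?k" for i using paths that by (simp add: list_all2_nthD)
  have p_cluster: "set (ps ! i) = cluster Cs i" "distinct (ps ! i)" "ps ! i \<noteq> []" if "i < ?k" for i
    using nth_ok[OF that] cluster_nonempty[OF that] by (auto simp: path_ok_def cluster_def)
  have nth_ps: "\<exists>i<?k. p = ps ! i" if "p \<in> set ps" for p using that lenps by (auto simp: in_set_conv_nth)
  define I where "I = (\<Union>p\<in>set ps. set (path_edges p))"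
  have I: "\<exists>i<?k. e \<in> set (path_edges (ps ! i)) \<and> e \<in> all_edges (cluster Cs i)" if e: "e \<in> I" for e
  proof -
    obtain p where p: "p \<in> set ps" "e \<in> set (path_edges p)" using e by (auto simp: I_def)
    obtain i where i: "i < ?k" "p = ps ! i" using nth_ps[OF p(1)] by blast
    then show ?thesis using p(2) path_edges_all_edges[OF p_cluster(2)[OF i(1)]] p_cluster(1)[OF i(1)] by auto
  qed
  have set_vo: "set vo = (\<Union>C\<in>set Cs. set (fst C)) \<union> (set vT - ?heads)" by (auto simp: vo_def)
  have set_eo: "set eo = I \<union> set ds" by (auto simp: eo_def I_def)
  have cl_vo: "cluster Cs i \<subseteq> set vo" if "i < ?k" for i using that by (auto simp: set_vo cluster_def)
  have ex_cluster: "\<exists>i<?k. x \<in> cluster Cs i" if "C \<in> set Cs" "x \<in> set (fst C)" for C x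
    using that by (auto simp: cluster_def in_set_conv_nth)
  have dsD: "\<exists>e\<in>set eT. d \<in> set es \<and> c d = c' e \<and> rep ` d = e" if "d \<in> set ds" for d
    using ds that by (auto simp: list_all2_conv_all_nth in_set_conv_nth)
  have eT_all: "set eT \<subseteq> all_edges (set vT)" using tree is_tree_iff_bridges by blast
  have vo_mem: "x \<in> set vo" if "x \<in> V" "rep x \<in> set vT" for x
  proof (cases "\<exists>C\<in>set Cs. x \<in> set (fst C)")
    case True
    then show ?thesis by (auto simp: set_vo)
  next
    case False
    then have "rep x = x" by (auto simp: rep_other)
    moreover have "x \<notin> ?heads" using False clusterD(6) by auto
    ultimately show ?thesis using that by (simp add: set_vo)
  qed
  have rep_vT: "rep x \<in> set vT" if "x \<in> set vo" for x
  proof (cases "\<exists>C\<in>set Cs. x \<in> set (fst C)")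
    case True
    then show ?thesis using rep_cluster heads by auto
  next
    case False
    then have "rep x = x" by (auto simp: rep_other)
    then show ?thesis using False that by (auto simp: set_vo)
  qed
  have vo_V: "set vo \<subseteq> V" using clusterD(4) sub(1) G(3) by (fastforce simp: set_vo)
  have eo_all: "set eo \<subseteq> all_edges (set vo)"
  proof
    fix e assume "e \<in> set eo"
    then consider "e \<in> I" | "e \<in> set ds" by (auto simp: set_eo)
    then show "e \<in> all_edges (set vo)"
    proof cases
      case 1
      then show ?thesis using I cl_vo all_edges_mono by blast
    next
      case 2
      then obtain e' where e': "e' \<in> set eT" "e \<in> set es" "rep ` e = e'" using dsD by blast
      then obtain x y where xy: "e = {x, y}" "x \<noteq> y" "x \<in> V" "y \<in> V" using set_es by (auto elim!: all_edgesE)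
      have "rep ` e \<subseteq> set vT" using e' eT_all by (auto simp: all_edges_def)
      then show ?thesis using xy vo_mem by auto
    qed
  qed
  \<comment> \<open>\<open>rep\<close> maps an edge inside a cluster to a single vertex, but maps
    \<open>d\<close> to an edge.\<close>
  have not_I: "d \<notin> I" if d: "d \<in> set ds" for d
  proof
    assume "d \<in> I"
    then obtain i where i: "i < ?k" "d \<in> all_edges (cluster Cs i)" using I by blast
    then have same: "rep x = hd (fst (Cs ! i))" if "x \<in> d" for x
      using rep_cluster[of "Cs ! i" x] that by (auto simp: all_edges_def cluster_def)
    obtain x y where "rep ` d = {x, y}" "x \<noteq> y" using dsD[OF d] eT_all by (auto elim!: all_edgesE)
    then have "x \<in> rep ` d" "y \<in> rep ` d" "x \<noteq> y" by simp_all
    then show False using same by auto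
  qed
  \<comment> \<open>Equal lifts would have equal images, and the images are the distinct entries of
    \<open>eT\<close>.\<close>
  have dist_ds: "distinct ds"
    unfolding distinct_conv_nth
  proof (intro allI impI)
    fix i j assume ij: "i < length ds" "j < length ds" "i \<noteq> j"
    then have "rep ` (ds ! i) = eT ! i" "rep ` (ds ! j) = eT ! j" "eT ! i \<noteq> eT ! j"
      using ds dist(2) by (auto simp: list_all2_conv_all_nth distinct_conv_nth)
    then show "ds ! i \<noteq> ds ! j" by auto
  qed
  \<comment> \<open>Two unselected vertices give every path an edge; otherwise the empty list could
    occur twice among the lists of path edges, and these would not be distinct.\<close>
  have pe_ne: "path_edges (ps ! i) \<noteq> []" if i: "i < ?k" for i
  proof -
    have "2 \<le> card (cluster Cs i - selected Cs i)" using unselected i by simp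
    also have "\<dots> \<le> card (cluster Cs i)" by (intro card_mono) (auto simp: cluster_def)
    also have "\<dots> = length (ps ! i)" using p_cluster[OF i] distinct_card by metis
    finally show ?thesis using length_path_edges[of "ps ! i"] by auto
  qed
  have pe_disj: "i = j" if "i < ?k" "j < ?k" "e \<in> set (path_edges (ps ! i))" "e \<in> set (path_edges (ps ! j))" for i j e
  proof -
    have "e \<in> all_edges (cluster Cs i)" "e \<subseteq> cluster Cs j"
      using that path_edges_all_edges p_cluster path_edges_subset by (metis subsetD)+
    then obtain x where "x \<in> cluster Cs i" "x \<in> cluster Cs j" by (auto elim!: all_edgesE)
    then show ?thesis using cluster_disjoint that by blast
  qed
  have "distinct (map path_edges ps)"
    unfolding distinct_conv_nth
  proof (intro allI impI)
    fix i j assume ij: "i < length (map path_edges ps)" "j < length (map path_edges ps)" "i \<noteq> j"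
    then show "map path_edges ps ! i \<noteq> map path_edges ps ! j"
      using pe_disj[of i j "hd (path_edges (ps ! i))"] pe_ne[of i] lenps by auto
  qed
  then have "distinct (concat (rev (map path_edges ps)))"
  proof (intro distinct_concat)
    fix xs ys assume xy: "xs \<in> set (rev (map path_edges ps))" "ys \<in> set (rev (map path_edges ps))" "xs \<noteq> ys"
    obtain i where i: "i < ?k" "xs = path_edges (ps ! i)" using xy(1) nth_ps by auto
    obtain j where j: "j < ?k" "ys = path_edges (ps ! j)" using xy(2) nth_ps by auto
    show "set xs \<inter> set ys = {}" using pe_disj[of i j] i j xy(3) by auto
  qed (use nth_ps p_cluster(2) distinct_path_edges in auto)
  then have dist_eo: "distinct eo" using dist_ds not_I by (auto simp: eo_def I_def)
  have dist_vo: "distinct vo"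
  proof -
    have "distinct (concat (rev (map fst Cs)))"
    proof (intro distinct_concat)
      show "distinct (rev (map fst Cs))" using distinct_fst_Cs by simp
      show "distinct xs" if "xs \<in> set (rev (map fst Cs))" for xs using that clusterD(1) by auto
      fix xs ys assume "xs \<in> set (rev (map fst Cs))" "ys \<in> set (rev (map fst Cs))" "xs \<noteq> ys"
      then show "set xs \<inter> set ys = {}" using cluster_unique by fastforce
    qed
    moreover have "x \<notin> set (fst C)" if "x \<in> set vT - ?heads" "C \<in> set Cs" for x C
    proof
      assume x: "x \<in> set (fst C)"
      have "x \<notin> absorbed" using that(1) sub(1) G(3) by auto
      then have "x = hd (fst C)" using rep_id rep_cluster[OF that(2) x] by simp
      then show False using that by auto
    qed
    ultimately show ?thesis using dist(1) by (auto simp: vo_def)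
  qed
  show "irredundant (vo, eo)" using dist_vo dist_eo by (simp add: irredundant_def)
  \<comment> \<open>Each path has one edge less than vertices, \<open>k\<close> in total, and
    expansion removes the \<open>k\<close> heads from the inter-cluster tree. The two corrections
    cancel, so the excess of one vertex over the edges is kept.\<close>
  have lens: "length (concat (rev (map fst Cs))) = length (concat (rev (map path_edges ps))) + ?k"
  proof -
    have "length (fst C) = length (path_edges p) + 1" if "path_ok C p" "C \<in> set Cs" for C p
    proof -
      have "length p = length (fst C)"
        using that clusterD(1) distinct_card by (metis path_ok_def)
      moreover have "fst C \<noteq> []" using clusterD(3)[OF that(2)] .
      ultimately show ?thesis by (cases "fst C") (auto simp: length_path_edges)
    qed
    then have *: "list_all2 (\<lambda>C p. length (fst C) = length (path_edges p) + 1) Cs ps"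
      using paths by (auto simp: list_all2_conv_all_nth)
    have "sum_list (map (length \<circ> fst) Ds) = sum_list (map (length \<circ> path_edges) qs) + length Ds"
      if "list_all2 (\<lambda>C p. length (fst C) = length (path_edges p) + 1) Ds qs" for Ds :: "('v list \<times> 'v list) list" and qs
      using that by (induction rule: list_all2_induct) auto
    from this[OF *] show ?thesis by (simp add: length_concat rev_map[symmetric])
  qed
  have "length (filter (\<lambda>x. x \<notin> ?heads) vT) + ?k = length vT"
  proof -
    have "inj_on (hd \<circ> fst) (set Cs)"
    proof (rule inj_onI)
      fix C D assume CD: "C \<in> set Cs" "D \<in> set Cs" "(hd \<circ> fst) C = (hd \<circ> fst) D"
      then have "hd (fst C) \<in> set (fst D)" using clusterD(6)[OF CD(2)] by simp
      then show "C = D" by (rule cluster_unique[OF CD(1,2) clusterD(6)[OF CD(1)]])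
    qed
    from card_image[OF this] have "card ?heads = ?k"
      using distinct_fst_Cs distinct_card[of Cs] by (simp add: distinct_map)
    moreover have "length (filter (\<lambda>x. x \<notin> ?heads) vT) = card (set vT - ?heads)"
      using distinct_card[of "filter (\<lambda>x. x \<notin> ?heads) vT"] dist(1) by (simp add: set_diff_eq)
    moreover have "card (set vT - ?heads) + card ?heads = card (set vT)"
      using heads by (simp add: card_Diff_subset card_mono)
    ultimately show ?thesis using distinct_card[OF dist(1)] by simp
  qed
  moreover have "length vT = length eT + 1"
    using tree distinct_card[OF dist(1)] distinct_card[OF dist(2)] by (simp add: is_tree_iff_card)
  moreover have "length ds = length eT" using list_all2_lengthD[OF ds] by simp
  ultimately have "length vo = length eo + 1" using lens by (simp add: vo_def eo_def)
  then have cards: "card (set vo) = card (set eo) + 1" using dist_vo dist_eo by (simp add: distinct_card)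
  have in_path: "(x, y) \<in> conn I" if "i < ?k" "x \<in> cluster Cs i" "y \<in> cluster Cs i" for i x y
  proof -
    let ?P = "set (path_edges (ps ! i))"
    have "(hd (ps ! i), x) \<in> conn ?P" "(hd (ps ! i), y) \<in> conn ?P"
      using path_edges_conn[of _ "ps ! i"] p_cluster(1)[OF that(1)] that by auto
    then have "(x, y) \<in> conn ?P" by (meson conn_sym rtrancl_trans)
    moreover have "ps ! i \<in> set ps" using that(1) lenps by simp
    then have "?P \<subseteq> I" unfolding I_def by blast
    ultimately show ?thesis by (rule conn_mono[rotated])
  qed
  have to_rep: "(x, rep x) \<in> conn (set eo)" if "x \<in> set vo" for x
  proof (cases "\<exists>C\<in>set Cs. x \<in> set (fst C)")
    case True
    then obtain C where C: "C \<in> set Cs" "x \<in> set (fst C)" by blast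
    then obtain i where "i < ?k" "C = Cs ! i" by (auto simp: in_set_conv_nth)
    then have "(x, rep x) \<in> conn I"
      using in_path[of i x "rep x"] C rep_cluster[OF C] clusterD(6)[OF C(1)] by (simp add: cluster_def)
    then show ?thesis using conn_mono[of I "set eo"] set_eo by blast
  next
    case False
    then have "rep x = x" by (auto simp: rep_other)
    then show ?thesis by simp
  qed
  \<comment> \<open>A lifted edge may end anywhere in its clusters. Path edges link its ends to
    their representatives, so an edge of the contracted tree still yields a connection.\<close>
  have eT_conn: "(x, y) \<in> conn (set eo)" if "(x, y) \<in> conn (set eT)" for x y
    using that
  proof (induction rule: rtrancl_induct)
    case (step y z)
    have "{y, z} \<in> set eT" using step.hyps by simp
    then obtain i where i: "i < length eT" "eT ! i = {y, z}" by (auto simp: in_set_conv_nth)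
    define d where "d = ds ! i"
    have d: "d \<in> set ds" "d \<in> set es" "rep ` d = {y, z}"
      using list_all2_nthD[OF ds i(1)] list_all2_lengthD[OF ds] i by (auto simp: d_def)
    have deo: "d \<in> set eo" using d set_eo by simp
    then have "d \<in> all_edges (set vo)" using eo_all by blast
    then obtain p q where pq: "d = {p, q}" "p \<in> set vo" "q \<in> set vo" by (auto elim!: all_edgesE)
    have "(rep p, rep q) \<in> conn (set eo)"
      using to_rep[OF pq(2)] to_rep[OF pq(3)] conn_edge[of p q "set eo"] deo pq(1) by (meson conn_sym rtrancl_trans)
    moreover have "rep p = y \<and> rep q = z \<or> rep p = z \<and> rep q = y"
      using d(3) pq(1) by (auto simp: doubleton_eq_iff)
    ultimately have "(y, z) \<in> conn (set eo)" using conn_sym by metis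
    with step.IH show ?case by (rule rtrancl_trans)
  qed simp
  obtain C0 where C0: "C0 \<in> set Cs" using inst by (cases Cs) auto
  let ?a = "hd (fst C0)"
  have a: "?a \<in> set vT" "?a \<in> set vo" using heads C0 clusterD(6)[OF C0] by (auto simp: set_vo)
  have "connected_graph (set vo, set eo)"
  proof (rule connected_graph_from[OF a(2)])
    fix x assume x: "x \<in> set vo"
    have "(?a, rep x) \<in> conn (set eT)"
      using tree a(1) rep_vT[OF x] by (simp add: is_tree_iff_card connected_graph_iff)
    then show "(?a, x) \<in> conn (set eo)"
      using eT_conn to_rep[OF x] by (meson conn_sym rtrancl_trans)
  qed
  then have out: "is_tree (set vo, set eo)" using eo_all cards by (simp add: is_tree_iff_card)
  have eo_es: "set eo \<subseteq> set es" using eo_all all_edges_mono[OF vo_V] set_es by auto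
  \<comment> \<open>Path edges never leave a cluster, so the paths alone join no two clusters, as
    the cutting lemma requires of \<open>I\<close>.\<close>
  have same: "y \<in> cluster Cs i" if "(x, y) \<in> conn I" "x \<in> cluster Cs i" "i < ?k" for i x y
    using that(1)
  proof (induction rule: rtrancl_induct)
    case (step y z)
    then have "{y, z} \<in> I" by simp
    then obtain j where j: "j < ?k" "{y, z} \<in> all_edges (cluster Cs j)" using I by blast
    then have "j = i" using cluster_disjoint[OF j(1) that(3), of y] step.IH by simp
    with j show ?case by simp
  qed (use that in simp)
  have "\<exists>F C. F \<subseteq> set eo \<and> card F = ?k - 1 \<and> bij_betw C {..<?k} (components (set vo, set eo - F)) \<and>
    (\<forall>i<?k. cluster Cs i \<subseteq> C i)"
  proof (rule ex_cut_into_clusters[OF out])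
    show "I \<subseteq> set eo" using set_eo by simp
    show "0 < ?k" using inst by auto
    show "(x, y) \<notin> conn I" if "i < ?k" "j < ?k" "i \<noteq> j" "x \<in> cluster Cs i" "y \<in> cluster Cs j" for i j x y
      using same[of x y i] cluster_disjoint[of i j y] that by blast
  qed (use cluster_nonempty cl_vo in_path in auto)
  moreover have "(\<Union>i<?k. cluster Cs i) \<subseteq> set vo" using cl_vo by auto
  ultimately have clustered: "clustered_steiner_tree (V, set es) ?k (cluster Cs) (set vo, set eo)"
    using out vo_V eo_es by (simp add: clustered_steiner_tree_def steiner_tree_def subgraph_def)
  have "\<exists>L. local_tree (set vo, set eo) (cluster Cs i) L \<and> (\<forall>v\<in>selected Cs i. internal_vertex L v)" if i: "i < ?k" for i
  proof -
    let ?p = "ps ! i" and ?L = "(set (ps ! i), set (path_edges (ps ! i)))"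
    have tL: "is_tree ?L" using is_tree_path p_cluster[OF i] by blast
    have "?p \<in> set ps" using i lenps by simp
    then have "set (path_edges ?p) \<subseteq> I" unfolding I_def by blast
    then have "steiner_tree (set vo, set eo) (cluster Cs i) ?L"
      using tL p_cluster(1)[OF i] cl_vo[OF i] set_eo by (auto simp: steiner_tree_def subgraph_def)
    moreover have "L' = ?L" if L': "steiner_tree (set vo, set eo) (cluster Cs i) L'" "subgraph L' ?L" for L'
    proof -
      obtain W' E' where L: "L' = (W', E')" by (cases L')
      have "W' = set ?p" "E' \<subseteq> set (path_edges ?p)" "is_tree (W', E')"
        using L' p_cluster(1)[OF i] L by (auto simp: steiner_tree_def subgraph_def)
      \<comment> \<open>A subtree on the same vertices has the same number of edges, which gives
        minimality of the path.\<close>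
      moreover from this have "E' = set (path_edges ?p)"
        using tL by (intro card_subset_eq) (auto simp: is_tree_iff_card)
      ultimately show ?thesis using L by simp
    qed
    ultimately have "local_tree (set vo, set eo) (cluster Cs i) ?L" by (auto simp: local_tree_def)
    moreover have "internal_vertex ?L v" if "v \<in> selected Cs i" for v
    proof (rule internal_vertex_path[OF p_cluster(2)[OF i]])
      have "set (snd (Cs ! i)) \<subseteq> set (fst (Cs ! i))" using clusterD(5) i by simp
      then show "v \<in> set ?p" "v \<noteq> hd ?p" "v \<noteq> last ?p"
        using that nth_ok[OF i] by (auto simp: path_ok_def selected_def)
    qed
    ultimately show ?thesis by blast
  qed
  with clustered show "clustered_selected_internal_steiner_tree (V, set es) ?k (cluster Cs) (selected Cs) (set vo, set eo)"
    by (simp add: clustered_selected_internal_steiner_tree_def)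
  have "sum c (set eo) = sum_list (map c eo)" using dist_eo by (simp add: sum_list_distinct_conv_sum_set)
  also have "\<dots> = sum_list (map c (concat (rev (map path_edges ps)))) + sum_list (map c ds)"
    by (simp add: eo_def)
  also have "map c ds = map c' eT" using ds by (auto simp: list_all2_conv_all_nth intro: nth_equalityI)
  also have "sum_list (map c' eT) = sum c' (set eT)" using dist(2) by (simp add: sum_list_distinct_conv_sum_set)
  also have "sum_list (map c (concat (rev (map path_edges ps)))) = sum_list (map (path_cost c) ps)"
  proof -
    have "sum_list (map c (path_edges p)) = path_cost c p" if "p \<in> set ps" for p
      using nth_ps[OF that] p_cluster(2) path_cost_eq[of p c] distinct_path_edges[of p]
      by (auto simp: sum_list_distinct_conv_sum_set)
    then have eq: "map (sum_list \<circ> map c \<circ> path_edges) ps = map (path_cost c) ps" by simp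
    have "sum_list (map c (concat (rev (map path_edges qs)))) = sum_list (map (sum_list \<circ> map c \<circ> path_edges) qs)" for qs
      by (induction qs) (simp_all add: add.commute)
    then show ?thesis unfolding eq[symmetric] .
  qed
  finally show "sum c (set eo) = sum_list (map (path_cost c) ps) + sum c' (set eT)" .
qed

end

section \<open>The approximation algorithm\<close>

lemma finite_subgraphs:
  assumes "finite (fst G)" "finite (snd G)"
  shows "finite {T. subgraph T G}"
  by (rule finite_subset[of _ "Pow (fst G) \<times> Pow (snd G)"]) (use assms in \<open>auto simp: subgraph_def\<close>)

lemma ex_arg_min_le:
  fixes f :: "'a \<Rightarrow> real"
  assumes "finite {x. P x}" "P y"
  shows "\<exists>x. is_arg_min f P x \<and> f x \<le> f y"
proof -
  obtain x where "is_arg_min f (\<lambda>x. x \<in> {x. P x}) x"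
    using ex_is_arg_min_if_finite[OF assms(1), of f] assms(2) by auto
  then show ?thesis using assms(2) by (auto simp: is_arg_min_def not_less)
qed

text \<open>The comparison with an arbitrary Steiner tree passes through a minimum one and
  multiplies an inequality by \<open>\<rho>\<close>; the premise \<open>0 \<le> \<rho>\<close> is
  kept inside and discharged later.\<close>

fun stp_solution :: "real \<Rightarrow> 'v stp \<Rightarrow> 'v graph_code \<Rightarrow> bool" where
  "stp_solution \<rho> ((vs, es, c), S) T \<longleftrightarrow> irredundant T \<and>
    steiner_tree (set vs, set es) (set S) (graph_of T) \<and>
    (\<forall>A. steiner_tree (set vs, set es) (set S) A \<longrightarrow> 0 \<le> \<rho> \<longrightarrow>
      sum c (set (snd T)) \<le> \<rho> * sum c (snd A))"

text \<open>There are finitely many subgraphs, so a minimum exists and the comparison extends to all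
  spanning trees. Monotonicity of the polynomial allows any \<open>N\<close> above the size.\<close>

lemma mst_spec:
  fixes mst :: "'v wgraph \<Rightarrow> 'v graph_code comp"
  assumes "poly_time_mst len mst"
  shows "\<exists>p. \<forall>H N. mst_instance H \<longrightarrow> wgraph_size len H \<le> N \<longrightarrow> spec (mst H) (poly p N) (mst_solution H)"
proof -
  obtain p where p: "\<And>G. mst_instance G \<Longrightarrow> spec (mst G) (poly p (wgraph_size len G))
      (\<lambda>T. irredundant T \<and> spanning_tree (wgraph G) (graph_of T) \<and>
        (\<forall>T_opt. is_arg_min (graph_cost (edge_cost G)) (spanning_tree (wgraph G)) T_opt \<longrightarrow>
          graph_cost (edge_cost G) (graph_of T) \<le> 1 * graph_cost (edge_cost G) T_opt))"
    using assms unfolding poly_time_mst_def poly_time_approximation_iff polyfun_def by blast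
  show ?thesis
  proof (intro exI[of _ p] allI impI)
    fix H :: "'v wgraph" and N
    assume inst': "mst_instance H" and N': "wgraph_size len H \<le> N"
    obtain vs es c where H: "H = (vs, es, c)" by (cases H)
    note inst = inst'[unfolded H] and N = N'[unfolded H]
    show "spec (mst H) (poly p N) (mst_solution H)"
      unfolding H
    proof (rule spec_mono[OF p[OF inst] poly_nat_mono[OF N]])
      fix T assume T: "irredundant T \<and> spanning_tree (wgraph (vs, es, c)) (graph_of T) \<and>
        (\<forall>T_opt. is_arg_min (graph_cost (edge_cost (vs, es, c))) (spanning_tree (wgraph (vs, es, c))) T_opt \<longrightarrow>
          graph_cost (edge_cost (vs, es, c)) (graph_of T) \<le> 1 * graph_cost (edge_cost (vs, es, c)) T_opt)"
      have "sum c (set (snd T)) \<le> sum c A" if A: "A \<subseteq> set es" "is_tree (set vs, A)" for A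
      proof -
        have "finite {T. spanning_tree (set vs, set es) T}"
          by (rule finite_subset[OF _ finite_subgraphs[of "(set vs, set es)"]]) (auto simp: spanning_tree_def)
        moreover have "spanning_tree (set vs, set es) (set vs, A)"
          using A by (simp add: spanning_tree_def subgraph_def)
        ultimately obtain T_opt where "is_arg_min (graph_cost c) (spanning_tree (set vs, set es)) T_opt"
          "graph_cost c T_opt \<le> graph_cost c (set vs, A)"
          using ex_arg_min_le[of "spanning_tree (set vs, set es)" "(set vs, A)" "graph_cost c"] by blast
        then show ?thesis using T by (fastforce simp: graph_cost_def graph_of_def)
      qed
      then show "mst_solution (vs, es, c) T" using T by simp
    qed
  qed
qed

lemma stp_spec:
  fixes stp :: "'v stp \<Rightarrow> 'v graph_code comp"
  assumes "poly_time_stp_approximation len \<rho> stp"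
  shows "\<exists>p. \<forall>I N. stp_instance I \<longrightarrow> stp_size len I \<le> N \<longrightarrow> spec (stp I) (poly p N) (stp_solution \<rho> I)"
proof -
  obtain p where p: "\<And>I. stp_instance I \<Longrightarrow> spec (stp I) (poly p (stp_size len I))
      (\<lambda>T. irredundant T \<and> (case I of (G, S) \<Rightarrow> steiner_tree (wgraph G) (set S)) (graph_of T) \<and>
        (\<forall>T_opt. is_arg_min (case I of (G, S) \<Rightarrow> graph_cost (edge_cost G))
            (case I of (G, S) \<Rightarrow> steiner_tree (wgraph G) (set S)) T_opt \<longrightarrow>
          (case I of (G, S) \<Rightarrow> graph_cost (edge_cost G)) (graph_of T) \<le>
            \<rho> * (case I of (G, S) \<Rightarrow> graph_cost (edge_cost G)) T_opt))"
    using assms unfolding poly_time_stp_approximation_def poly_time_approximation_iff polyfun_def by blast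
  show ?thesis
  proof (intro exI[of _ p] allI impI)
    fix I :: "'v stp" and N
    assume inst': "stp_instance I" and N': "stp_size len I \<le> N"
    obtain vs es c S where I: "I = ((vs, es, c), S)" by (cases I) auto
    note inst = inst'[unfolded I] and N = N'[unfolded I]
    note p' = p[OF inst, unfolded prod.case wgraph.simps edge_cost.simps]
    show "spec (stp I) (poly p N) (stp_solution \<rho> I)"
      unfolding I
    proof (rule spec_mono[OF p' poly_nat_mono[OF N]])
      fix T assume T: "irredundant T \<and> steiner_tree (set vs, set es) (set S) (graph_of T) \<and>
        (\<forall>T_opt. is_arg_min (graph_cost c) (steiner_tree (set vs, set es) (set S)) T_opt \<longrightarrow>
          graph_cost c (graph_of T) \<le> \<rho> * graph_cost c T_opt)"
      have "sum c (set (snd T)) \<le> \<rho> * sum c (snd A)"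
        if A: "steiner_tree (set vs, set es) (set S) A" and "0 \<le> \<rho>" for A
      proof -
        have "finite {T. steiner_tree (set vs, set es) (set S) T}"
          by (rule finite_subset[OF _ finite_subgraphs[of "(set vs, set es)"]]) (auto simp: steiner_tree_def)
        from ex_arg_min_le[OF this A, of "graph_cost c"] obtain T_opt where
          "is_arg_min (graph_cost c) (steiner_tree (set vs, set es) (set S)) T_opt"
          and le: "graph_cost c T_opt \<le> graph_cost c A" by blast
        then have "graph_cost c (graph_of T) \<le> \<rho> * graph_cost c T_opt" using T by blast
        also have "\<dots> \<le> \<rho> * graph_cost c A" using le \<open>0 \<le> \<rho>\<close> by (rule mult_left_mono)
        finally show ?thesis by (simp add: graph_cost_def graph_of_def)
      qed
      then show "stp_solution \<rho> ((vs, es, c), S) T"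
        using T unfolding stp_solution.simps by blast
    qed
  qed
qed

text \<open>On a single edge of cost 1 with both ends as terminals, every Steiner tree costs 1, so
  the guarantee reads \<open>1 \<le> \<rho> * 1\<close>. The instance requires two distinct elements
  of the vertex type.\<close>

lemma stp_ratio_ge_1:
  fixes stp :: "'v stp \<Rightarrow> 'v graph_code comp"
  assumes stp: "poly_time_stp_approximation len \<rho> stp" and ab: "(a :: 'v) \<noteq> b"
  shows "1 \<le> \<rho>"
proof -
  let ?I = "(([a, b], [{a, b}], \<lambda>_. 1), [a, b]) :: 'v stp"
  let ?F = "steiner_tree ({a, b}, {{a, b}}) {a, b}"
  have "?F ({a, b}, {{a, b}})"
    using is_tree_path[of "[a, b]"] ab by (simp add: steiner_tree_def subgraph_def)
  then have inst: "stp_instance ?I"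
    using ab by (auto simp: irredundant_def simple_graph_def)
  have one: "graph_cost (\<lambda>_. 1) T = 1" if T: "?F T" for T
  proof -
    obtain W E where WE: "T = (W, E)" by (cases T)
    then have "W = {a, b}" "is_tree (W, E)" using T by (auto simp: steiner_tree_def subgraph_def)
    then have "card E = 1" using ab by (simp add: is_tree_iff_card)
    then show ?thesis using WE by (simp add: graph_cost_def)
  qed
  have "\<exists>T. (?F T \<and> (\<forall>T_opt. is_arg_min (graph_cost (\<lambda>_. 1)) ?F T_opt \<longrightarrow>
      graph_cost (\<lambda>_. 1) T \<le> \<rho> * graph_cost (\<lambda>_. 1) T_opt))"
  proof -
    obtain f where "\<And>I. stp_instance I \<Longrightarrow> spec (stp I) (f (stp_size len I))
      (\<lambda>T. irredundant T \<and> (case I of (G, S) \<Rightarrow> steiner_tree (wgraph G) (set S)) (graph_of T) \<and>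
        (\<forall>T_opt. is_arg_min (case I of (G, S) \<Rightarrow> graph_cost (edge_cost G))
            (case I of (G, S) \<Rightarrow> steiner_tree (wgraph G) (set S)) T_opt \<longrightarrow>
          (case I of (G, S) \<Rightarrow> graph_cost (edge_cost G)) (graph_of T) \<le>
            \<rho> * (case I of (G, S) \<Rightarrow> graph_cost (edge_cost G)) T_opt))"
      using stp unfolding poly_time_stp_approximation_def poly_time_approximation_iff by blast
    from spec_ex[OF this[OF inst]] show ?thesis
      by (simp del: split_paired_All split_paired_Ex) blast
  qed
  then obtain T where T: "?F T" "\<And>T_opt. is_arg_min (graph_cost (\<lambda>_. 1)) ?F T_opt \<Longrightarrow>
      graph_cost (\<lambda>_. 1) T \<le> \<rho> * graph_cost (\<lambda>_. 1) T_opt" by blast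
  have "is_arg_min (graph_cost (\<lambda>_. 1 :: real)) ?F T" using T(1) one by (simp add: is_arg_min_def)
  from T(2)[OF this] one[OF T(1)] show ?thesis by simp
qed

section \<open>Sizes of intermediate data and running times\<close>

lemma csistp_size_bounds:
  assumes "csistp_size len ((vs, es, c), Cs) \<le> N"
  shows "wgraph_size len (vs, es, c) \<le> N" "C \<in> set Cs \<Longrightarrow> length (fst C) \<le> N"
    "C \<in> set Cs \<Longrightarrow> length (snd C) \<le> N" "(\<And>C. C \<in> set Cs \<Longrightarrow> fst C \<noteq> []) \<Longrightarrow> length Cs \<le> N"
proof -
  have "length (fst C) + length (snd C) \<le> (\<Sum>(R, R')\<leftarrow>Cs. length R + length R')" if "C \<in> set Cs"
    using that by (induction Cs) auto
  moreover have "length Cs \<le> (\<Sum>(R, R')\<leftarrow>Cs. length R + length R')" if "\<And>C. C \<in> set Cs \<Longrightarrow> fst C \<noteq> []"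
    using that
  proof (induction Cs)
    case (Cons C Cs)
    then have "length Cs \<le> (\<Sum>(R, R')\<leftarrow>Cs. length R + length R')" "fst C \<noteq> []" by auto
    then show ?case by (cases C; cases "fst C") auto
  qed simp
  ultimately show "wgraph_size len (vs, es, c) \<le> N" "C \<in> set Cs \<Longrightarrow> length (fst C) \<le> N"
    "C \<in> set Cs \<Longrightarrow> length (snd C) \<le> N" "(\<And>C. C \<in> set Cs \<Longrightarrow> fst C \<noteq> []) \<Longrightarrow> length Cs \<le> N"
    using assms by fastforce+
qed

text \<open>Costs in \<open>G/R\<close> are values of \<open>c\<close>, so each is encoded within
  \<open>N\<close>; the crude quadratic total is still polynomial.\<close>

lemma wgraph_size_le:
  assumes "length vs \<le> N" "length es \<le> N" "\<And>e. e \<in> set es \<Longrightarrow> len (c e) \<le> N"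
  shows "wgraph_size len (vs, es, c) \<le> N + N * (1 + N)"
proof -
  have "(\<Sum>e\<leftarrow>es. 1 + len (c e)) \<le> (\<Sum>e\<leftarrow>es. 1 + N)"
    using assms(3) by (intro sum_list_mono) simp
  also have "\<dots> = length es * (1 + N)" by (simp add: sum_list_triv)
  also have "\<dots> \<le> N * (1 + N)" using assms(2) by (rule mult_le_mono1)
  finally show ?thesis using assms(1) by simp
qed

definition path_time :: "nat poly \<Rightarrow> nat \<Rightarrow> nat" where
  "path_time p N = ((N * ((2 * N + 1) + 1 + 1) + 1) + 1) + (poly p N + ((N * (2 * N + 4) + 1) +
     (N + ((2 * N + 1) + (N + (2 * N + 1) * ham_step N)))))"

definition corresponding_time :: "nat \<Rightarrow> nat" where
  "corresponding_time N = (N * ((2 * N + 1) + 1 + 1) + 1) + N"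

definition assembly_time :: "nat \<Rightarrow> nat" where
  "assembly_time N = map_time N + ((N * (corresponding_time N + 1) + 1) +
     ((N * ((N + 1) + 1) + 1) + ((N * (2 * N + 4) + 1) + ((N * (N + 1) + 1) + ((N * (N + 1) + 1) + 1)))))"

definition apx_time :: "nat poly \<Rightarrow> nat poly \<Rightarrow> nat \<Rightarrow> nat" where
  "apx_time p q N = (N * (path_time p N + 1) + 1) + (contract_time N + ((N * (1 + 1) + 1) +
     (poly q ((N + N * (1 + N)) + N) + assembly_time N)))"

lemma wgraph_size_filter:
  "wgraph_size len (vs, filter P es, c) \<le> length vs + (\<Sum>e\<leftarrow>es. 1 + len (c e))"
  by (induction es) auto

context csistp_data
begin

text \<open>The comparison ranges over all trees on the cluster, so that it applies to the trees
  extracted from an optimal solution.\<close>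

definition path_best :: "'v list \<times> 'v list \<Rightarrow> 'v list \<Rightarrow> bool" where
  "path_best C p \<longleftrightarrow> path_ok C p \<and>
    (\<forall>A. is_tree (set (fst C), A) \<longrightarrow> path_cost c p \<le> 2 * sum c A)"

lemma spec_cluster_path_c:
  assumes mst: "\<And>H N. mst_instance H \<Longrightarrow> wgraph_size len H \<le> N \<Longrightarrow> spec (mst H) (poly p N) (mst_solution H)"
    and C: "C \<in> set Cs" and N: "csistp_size len ((vs, es, c), Cs) \<le> N"
  shows "spec (cluster_path_c mst (vs, es, c) C) (path_time p N) (path_best C)"
proof -
  obtain R R' where RR: "C = (R, R')" by (cases C)
  note R = clusterD[OF C, unfolded RR fst_conv snd_conv]
  note szG = csistp_size_bounds(1)[OF N]
  note szC = csistp_size_bounds(2,3)[OF N C, unfolded RR fst_conv snd_conv]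
  note szVE = wgraph_size_bounds[OF szG]
  let ?es = "filter (\<lambda>e. e \<subseteq> set R) es"
  have set_es': "set ?es = all_edges (set R)" using set_es R(4) by (auto simp: all_edges_def)
  have induced: "spec (induced_c R (vs, es, c)) ((N * ((2 * N + 1) + 1 + 1) + 1) + 1) (\<lambda>H. H = (R, ?es, c))"
  proof -
    have both: "spec (do {
         hits \<leftarrow> ends_in_c e R;
         return (case hits of [_, _] \<Rightarrow> True | _ \<Rightarrow> False)
       }) ((2 * N + 1) + 1) (\<lambda>r. r = (e \<subseteq> set R))" if e: "e \<in> set es" for e
    proof (rule spec_bind1[OF spec_ends_in_c[OF szC(1) order_refl]], rule spec_return1)
      fix hits assume hits: "hits = filter (\<lambda>x. x \<in> e) R"
      have "e \<in> all_edges V" using e set_es by simp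
      from hits_cases[OF R(1) this hits]
      show "(case hits of [_, _] \<Rightarrow> True | _ \<Rightarrow> False) = (e \<subseteq> set R)"
      proof cases
        case 2
        have "e \<noteq> {}" using \<open>e \<in> all_edges V\<close> by (auto simp: all_edges_def)
        with 2 show ?thesis by auto
      qed auto
    qed
    show ?thesis
      unfolding induced_c.simps
      by (rule spec_bind1[OF spec_filter_c[OF both szVE(2) order_refl]], assumption, rule spec_return1) simp
  qed
  have conn_R: "connected_graph (set R, set ?es)"
    unfolding set_es'
  proof (rule connected_graph_from)
    show "hd R \<in> set R" by (rule R(6))
    show "(hd R, x) \<in> conn (all_edges (set R))" if "x \<in> set R" for x
      using that R(6) by (cases "x = hd R") (auto intro: conn_edge)
  qed
  have inst_R: "mst_instance (R, ?es, c)"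
    using R(1) distinct_es set_es' conn_R nonneg set_es
    by (auto simp: mst_instance_def irredundant_def simple_graph_def)
  have sz_R: "wgraph_size len (R, ?es, c) \<le> N"
  proof -
    have "length R = card (set R)" using R(1) by (simp add: distinct_card)
    also have "\<dots> \<le> card V" using R(4) by (intro card_mono) auto
    also have "\<dots> = length vs" using distinct_vs by (simp add: distinct_card)
    finally show ?thesis using wgraph_size_filter[of len R "\<lambda>e. e \<subseteq> set R" es c] szG by simp
  qed
  have ham: "spec (ham_path_c eT u v) ((2 * N + 1) * ham_step N) (path_best C)"
    if T: "mst_solution (R, ?es, c) (vT, eT)"
      and uv: "u \<in> set R - set R'" "v \<in> set R - set R'" "u \<noteq> v" for vT eT u v
  proof -
    have tree: "is_tree (set R, set eT)" and sub: "set eT \<subseteq> set ?es" and dist: "distinct eT"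
      using T by (auto simp: spanning_tree_def subgraph_def graph_of_def irredundant_def)
    have len: "length eT \<le> N"
    proof -
      have "length eT = card (set eT)" using dist by (simp add: distinct_card)
      also have "\<dots> \<le> card (set es)" using sub by (intro card_mono) auto
      also have "\<dots> \<le> N" using szVE(2) card_length order_trans by blast
      finally show ?thesis .
    qed
    have "spec (ham_path_c eT u v) ((2 * length eT + 1) * ham_step N) (ham_post (set R) (set eT) u v)"
      by (rule spec_ham_path_c[OF tree dist R(4) _ _ uv(3) len order_refl]) (use uv in auto)
    then show ?thesis
    proof (rule spec_mono)
      show "(2 * length eT + 1) * ham_step N \<le> (2 * N + 1) * ham_step N"
        using len by (intro mult_le_mono1) simp
      fix q assume q: "ham_post (set R) (set eT) u v q"
      have "0 \<le> (if {u, v} \<in> set eT then c {u, v} else 0)"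
        using sub set_es' edge_nonneg[of "set ?es" "set R"] R(4) by auto
      then have cost: "path_cost c q \<le> 2 * sum c (set eT)" using q by (simp add: ham_post_def)
      have "path_cost c q \<le> 2 * sum c A" if "is_tree (set R, A)" for A
      proof -
        \<comment> \<open>Completeness of \<open>G\<close> makes every tree on the cluster a
          spanning tree of the induced subgraph.\<close>
        have "A \<subseteq> set ?es" using that set_es' by (simp add: is_tree_iff_card)
        then have "sum c (set eT) \<le> sum c A" using T that by simp
        then show ?thesis using cost by linarith
      qed
      then show "path_best C q" using q uv RR by (auto simp: path_best_def path_ok_def ham_post_def)
    qed
  qed
  obtain i where i: "i < length Cs" "C = Cs ! i" using C by (auto simp: in_set_conv_nth)
  have "2 \<le> card (cluster Cs i - selected Cs i)" using unselected i by simp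
  moreover have "Cs ! i = (R, R')" using i RR by simp
  \<comment> \<open>Two unselected vertices keep both uses of \<open>pick\<close> from failing,
    whichever vertex the first one returns.\<close>
  ultimately have two: "2 \<le> card (set R - set R')" by (simp add: cluster_def selected_def)
  let ?xs = "filter (\<lambda>x. x \<notin> set R') R"
  have set_xs: "set ?xs = set R - set R'" by auto
  have len_xs: "length ?xs \<le> N" using order_trans[OF length_filter_le szC(1)] .
  have tail: "spec (do { u \<leftarrow> pick ?xs; ys \<leftarrow> remove_c u ?xs; v \<leftarrow> pick ys; ham_path_c eT u v })
      (N + ((2 * N + 1) + (N + (2 * N + 1) * ham_step N))) (path_best C)"
    if T: "mst_solution (R, ?es, c) (vT, eT)" for vT eT
  proof (rule spec_bind1[OF spec_pick[where Q = "\<lambda>u. u \<in> set R - set R'"]])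
    have "set R - set R' \<noteq> {}" using two by (metis card.empty not_numeral_le_zero)
    then show "?xs \<noteq> []" unfolding set_xs[symmetric] by (simp only: set_empty not_False_eq_True)
    fix u assume u: "u \<in> set R - set R'"
    let ?ys = "filter (\<lambda>y. y \<noteq> u) ?xs"
    have set_ys: "set ?ys = set R - set R' - {u}" by auto
    show "spec (do { ys \<leftarrow> remove_c u ?xs; v \<leftarrow> pick ys; ham_path_c eT u v })
        ((2 * N + 1) + (N + (2 * N + 1) * ham_step N)) (path_best C)"
    proof (rule spec_bind1[OF spec_remove_c[OF len_xs order_refl]], hypsubst,
        rule spec_bind1[OF spec_pick[where Q = "\<lambda>v. v \<in> set R - set R' \<and> u \<noteq> v"]])
      have "card (set R - set R' - {u}) \<noteq> 0" using two u by (simp add: card_Diff_singleton)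
      then have "set R - set R' - {u} \<noteq> {}" by (metis card.empty)
      then show "?ys \<noteq> []" unfolding set_ys[symmetric] by (simp only: set_empty not_False_eq_True)
      show "length ?ys \<le> N" using order_trans[OF length_filter_le len_xs] .
      show "spec (ham_path_c eT u v) ((2 * N + 1) * ham_step N) (path_best C)"
        if "v \<in> set R - set R' \<and> u \<noteq> v" for v
        using ham[OF T u] that by blast
    qed auto
  qed (use len_xs in auto)
  show ?thesis
    unfolding RR cluster_path_c.simps path_time_def
  proof (rule spec_bind1[OF induced], hypsubst, rule spec_bind1[OF mst[OF inst_R sz_R]])
    fix T :: "'v graph_code"
    assume T: "mst_solution (R, ?es, c) T"
    obtain vT eT where vT: "T = (vT, eT)" by (cases T)
    show "spec (case T of (x, T) \<Rightarrow> do {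
        xs \<leftarrow> minus_c R R'; u \<leftarrow> pick xs; ys \<leftarrow> remove_c u xs; v \<leftarrow> pick ys; ham_path_c T u v })
      ((N * (2 * N + 4) + 1) + (N + ((2 * N + 1) + (N + (2 * N + 1) * ham_step N)))) (path_best (R, R'))"
      unfolding vT prod.case
      by (rule spec_bind1[OF spec_minus_c[OF szC order_refl]], hypsubst,
          rule tail[unfolded RR]) (use T vT in auto)
  qed
qed

text \<open>The invariant \<open>contracted\<close> supplies an edge of \<open>G\<close> with the
  same cost and image, so the list handed to \<open>pick\<close> is nonempty.\<close>

lemma spec_corresponding_edge_c:
  assumes G: "contracted absorbed (vs', es', c')" and f: "\<forall>x\<in>V. f x = rep x" and e: "e \<in> set es'"
    and N: "length es \<le> N" "\<And>e. e \<in> set es \<Longrightarrow> len (c e) \<le> N"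
  shows "spec (corresponding_edge_c len (vs, es, c) c' f e) (corresponding_time N)
    (\<lambda>d. d \<in> set es \<and> c d = c' e \<and> rep ` d = e)"
proof -
  note G' = contractedD[OF G, unfolded part_rep_absorbed]
  have len_e: "len (c' e) \<le> N" using contracted_cost_mem[OF G e] N(2) by auto
  let ?q = "\<lambda>d. c d = c' e \<and> rep ` d = e"
  have "spec (do { b \<leftarrow> num_eq len (c d) (c' e); return (b \<and> f ` d = e) }) ((2 * N + 1) + 1) (\<lambda>r. r = ?q d)"
    if d: "d \<in> set es" for d
  proof -
    have "f ` d = rep ` d" using f d set_es by (auto simp: all_edges_def intro!: image_cong)
    have num: "spec (num_eq len (c d) (c' e)) (2 * N + 1) (\<lambda>b. b = (c d = c' e))"
      using N(2)[OF d] len_e by (simp add: spec_def num_eq_def)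
    show ?thesis
      by (rule spec_bind1[OF num], rule spec_return1) (simp add: \<open>f ` d = rep ` d\<close>)
  qed
  then have filt: "spec (filter_c (\<lambda>d. do { b \<leftarrow> num_eq len (c d) (c' e); return (b \<and> f ` d = e) }) es)
      (N * ((2 * N + 1) + 1 + 1) + 1) (\<lambda>ds. ds = filter ?q es)"
    using N(1) by (intro spec_filter_c) auto
  show ?thesis
    unfolding corresponding_edge_c.simps corresponding_time_def
  proof (rule spec_bind1[OF filt], hypsubst, rule spec_pick)
    show "filter ?q es \<noteq> []" using G'(5)[OF e] by (auto simp: filter_empty_conv)
    show "length (filter ?q es) \<le> N" using order_trans[OF length_filter_le N(1)] .
  qed auto
qed

text \<open>\<open>G/R\<close> is again complete, hence connected, so it has a Steiner tree and
  forms a valid instance for the subroutine.\<close>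

lemma spec_stp_contracted:
  assumes stp: "\<And>I N. stp_instance I \<Longrightarrow> stp_size len I \<le> N \<Longrightarrow> spec (stp I) (poly q N) (stp_solution \<rho> I)"
    and G: "contracted absorbed (vs', es', c')" and N: "csistp_size len ((vs, es, c), Cs) \<le> N"
  defines "rs \<equiv> map (hd \<circ> fst) Cs"
  shows "spec (stp ((vs', es', c'), rs)) (poly q ((N + N * (1 + N)) + N))
    (stp_solution \<rho> ((vs', es', c'), rs))"
proof (rule stp)
  note G' = contractedD[OF G, unfolded part_rep_absorbed]
  note szVE = wgraph_size_bounds[OF csistp_size_bounds(1)[OF N]]
  have "hd (fst C) \<in> set vs'" if "C \<in> set Cs" for C
    using hd_not_absorbed[OF that] clusterD(4,6)[OF that] G'(3) by auto
  then have rs: "set rs \<subseteq> set vs'" by (auto simp: rs_def)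
  have "distinct rs"
    unfolding rs_def distinct_map
  proof
    show "distinct Cs" using distinct_fst_Cs by (simp add: distinct_map)
    show "inj_on (hd \<circ> fst) (set Cs)"
      using cluster_unique clusterD(6) by (intro inj_onI) (metis comp_apply)
  qed
  moreover have "rs \<noteq> []" using inst by (auto simp: rs_def)
  moreover have "nonneg_wgraph (vs', es', c')"
  proof -
    have "0 \<le> c' e" if "e \<in> set es'" for e
    proof -
      have "c' e \<in> c ` set es" by (rule contracted_cost_mem[OF G that])
      then show ?thesis using nonneg set_es by auto
    qed
    moreover have "distinct vs'" "distinct es'" using G'(1,2) distinct_vs distinct_es by simp_all
    ultimately show ?thesis using G'(3,4) by (auto simp: irredundant_def simple_graph_def)
  qed
  moreover have "\<exists>T. steiner_tree (set vs', set es') (set rs) T"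
  proof -
    obtain r where r: "r \<in> set vs'" using rs \<open>rs \<noteq> []\<close> by (cases rs) auto
    have "connected_graph (set vs', set es')"
    proof (rule connected_graph_from[OF r])
      show "(r, x) \<in> conn (set es')" if "x \<in> set vs'" for x
        using that r G'(3,4) by (cases "x = r") (auto intro: conn_edge)
    qed
    from ex_spanning_tree[OF _ _ this] obtain E where "E \<subseteq> set es'" "is_tree (set vs', E)" using G'(3,4) by auto
    then show ?thesis using rs by (intro exI[of _ "(set vs', E)"]) (auto simp: steiner_tree_def subgraph_def)
  qed
  ultimately show "stp_instance ((vs', es', c'), rs)" using rs by simp
  have "length vs' \<le> N" "length es' \<le> N"
    using G'(1,2) order_trans[OF length_filter_le szVE(1)] order_trans[OF length_filter_le szVE(2)] by simp_all
  moreover have "len (c' e) \<le> N" if "e \<in> set es'" for e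
    using contracted_cost_mem[OF G that] szVE(3) by auto
  ultimately have "wgraph_size len (vs', es', c') \<le> N + N * (1 + N)" by (rule wgraph_size_le)
  moreover have "length rs \<le> N" using csistp_size_bounds(4)[OF N] clusterD(3) by (simp add: rs_def)
  ultimately show "stp_size len ((vs', es', c'), rs) \<le> (N + N * (1 + N)) + N" by simp
qed

end

context csistp_data
begin

text \<open>\<open>w\<close> stands for the cost of the inter-cluster tree, and \<open>T_opt\<close>
  may be any feasible solution. The sign of \<open>\<rho>\<close> enters when the bound on the
  projected tree is scaled.\<close>

lemma assembled_cost_le:
  assumes G: "contracted absorbed (vs', es', c')" and ps: "list_all2 path_best Cs ps" and \<rho>: "0 \<le> \<rho>"
    and T: "\<And>A. steiner_tree (set vs', set es') ((hd \<circ> fst) ` set Cs) A \<Longrightarrow> w \<le> \<rho> * sum c' (snd A)"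
    and opt: "clustered_selected_internal_steiner_tree (V, set es) (length Cs) (cluster Cs) (selected Cs) T_opt"
  shows "sum_list (map (path_cost c) ps) + w \<le> (\<rho> + 4) * sum c (snd T_opt)"
proof -
  let ?k = "length Cs"
  obtain W E where WE: "T_opt = (W, E)" by (cases T_opt)
  have clustered: "clustered_steiner_tree (V, set es) ?k (cluster Cs) (W, E)"
    using opt WE by (simp add: clustered_selected_internal_steiner_tree_def)
  then have tree: "is_tree (W, E)" "W \<subseteq> V" "E \<subseteq> set es" "(\<Union>i<?k. cluster Cs i) \<subseteq> W"
    by (auto simp: clustered_steiner_tree_def steiner_tree_def subgraph_def)
  obtain A where A: "\<And>i. i < ?k \<Longrightarrow> is_tree (cluster Cs i, A i)" "(\<Sum>i<?k. sum c (A i)) \<le> 2 * sum c E"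
    using cluster_trees_le[OF clustered] by blast
  have len: "length ps = ?k" using list_all2_lengthD[OF ps] by simp
  have "sum_list (map (path_cost c) ps) = (\<Sum>i<?k. path_cost c (ps ! i))"
    by (simp add: sum_list_sum_nth len atLeast0LessThan)
  also have "\<dots> \<le> (\<Sum>i<?k. 2 * sum c (A i))"
  proof (rule sum_mono)
    fix i assume "i \<in> {..<?k}"
    then have i: "i < ?k" by simp
    show "path_cost c (ps ! i) \<le> 2 * sum c (A i)"
      using list_all2_nthD[OF ps i] A(1)[OF i] by (simp add: path_best_def cluster_def)
  qed
  also have "\<dots> = 2 * (\<Sum>i<?k. sum c (A i))" by (simp add: sum_distrib_left)
  finally have intra: "sum_list (map (path_cost c) ps) \<le> 4 * sum c E" using A(2) by simp
  have "set (fst C) \<subseteq> W" if C: "C \<in> set Cs" for C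
  proof -
    obtain i where "i < ?k" "C = Cs ! i" using C by (auto simp: in_set_conv_nth)
    then show ?thesis using tree(4) by (auto simp: cluster_def)
  qed
  from contracted_tree_le[OF G tree(1-3) this] obtain B where
    B: "steiner_tree (set vs', set es') ((hd \<circ> fst) ` set Cs) B" "sum c' (snd B) \<le> sum c E" by blast
  have "w \<le> \<rho> * sum c' (snd B)" by (rule T[OF B(1)])
  also have "\<dots> \<le> \<rho> * sum c E" using B(2) \<rho> by (rule mult_left_mono)
  finally have "w \<le> \<rho> * sum c E" .
  with intra show ?thesis using WE by (simp add: algebra_simps)
qed

text \<open>All lists and subroutine inputs are measured by one bound \<open>N\<close>. The
  comparison with every feasible solution contains the one with a minimum.\<close>

lemma spec_apx:
  assumes mst: "\<And>H N. mst_instance H \<Longrightarrow> wgraph_size len H \<le> N \<Longrightarrow> spec (mst H) (poly p N) (mst_solution H)"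
    and stp: "\<And>I N. stp_instance I \<Longrightarrow> stp_size len I \<le> N \<Longrightarrow> spec (stp I) (poly q N) (stp_solution \<rho> I)"
    and \<rho>: "0 \<le> \<rho>" and N: "csistp_size len ((vs, es, c), Cs) \<le> N"
  shows "spec (apx len mst stp ((vs, es, c), Cs)) (apx_time p q N) (\<lambda>T. irredundant T \<and>
    clustered_selected_internal_steiner_tree (V, set es) (length Cs) (cluster Cs) (selected Cs) (graph_of T) \<and>
    (\<forall>T_opt. clustered_selected_internal_steiner_tree (V, set es) (length Cs) (cluster Cs) (selected Cs) T_opt \<longrightarrow>
      sum c (snd (graph_of T)) \<le> (\<rho> + 4) * sum c (snd T_opt)))"
    (is "spec _ _ ?good")
proof -
  note szVE = wgraph_size_bounds[OF csistp_size_bounds(1)[OF N]]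
  note szC = csistp_size_bounds(2)[OF N]
  have szCs: "length Cs \<le> N" using csistp_size_bounds(4)[OF N] clusterD(3) by blast
  let ?rs = "map (hd \<circ> fst) Cs"
  have paths: "spec (map_c (cluster_path_c mst (vs, es, c)) Cs) (N * (path_time p N + 1) + 1) (list_all2 path_best Cs)"
    by (rule spec_map_c[OF spec_cluster_path_c[OF mst _ N] szCs order_refl])
  have contract: "spec (contract_clusters_c len Cs (vs, es, c)) (contract_time N) (contracted absorbed)"
    by (rule spec_contract_clusters_c[where len = len, OF szVE szCs szC])
  have heads: "spec (map_c (\<lambda>(R, R'). return (hd R)) Cs) (N * (1 + 1) + 1) (\<lambda>rs. rs = ?rs)"
  proof (rule spec_mono[OF spec_map_c[where Q = "\<lambda>C r. r = hd (fst C)", OF _ szCs order_refl] order_refl])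
    show "spec (case C of (R, R') \<Rightarrow> return (hd R)) 1 (\<lambda>r. r = hd (fst C))" for C :: "'v list \<times> 'v list"
      by (cases C) (auto intro: spec_return)
    show "rs = ?rs" if "list_all2 (\<lambda>C r. r = hd (fst C)) Cs rs" for rs
      using that by (auto simp: list_all2_conv_all_nth intro: nth_equalityI)
  qed
  have rep_map: "spec (contraction_map_c vs Cs) (map_time N) (\<lambda>f. \<forall>x\<in>V. f x = rep x)"
    by (rule spec_contraction_map_c[OF szVE(1) szCs szC])
  have finish: "spec (do {
      f \<leftarrow> contraction_map_c vs Cs;
      inter \<leftarrow> map_c (corresponding_edge_c len (vs, es, c) c' f) eT;
      intra \<leftarrow> map_c path_edges_c ps;
      steiner \<leftarrow> minus_c vT ?rs;
      vs_out \<leftarrow> fold_c (\<lambda>(R, R'). append_c R) Cs steiner;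
      es_out \<leftarrow> fold_c append_c intra inter;
      return (vs_out, es_out)
    }) (assembly_time N) ?good"
    if ps: "list_all2 path_best Cs ps" and G: "contracted absorbed (vs', es', c')"
      and T: "stp_solution \<rho> ((vs', es', c'), ?rs) (vT, eT)"
    for ps vs' es' c' vT eT
  proof -
    note G' = contractedD[OF G]
    have tree: "is_tree (set vT, set eT)" and sub: "set vT \<subseteq> set vs'" "set eT \<subseteq> set es'"
      and hs: "(hd \<circ> fst) ` set Cs \<subseteq> set vT" and dist: "distinct vT" "distinct eT"
      using T by (auto simp: steiner_tree_def subgraph_def graph_of_def irredundant_def)
    have sz': "length vs' \<le> N" "length es' \<le> N"
      using G'(1,2) order_trans[OF length_filter_le szVE(1)] order_trans[OF length_filter_le szVE(2)] by simp_all
    have "length vT \<le> length vs'" "length eT \<le> length es'"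
      using card_mono[OF _ sub(1)] card_mono[OF _ sub(2)] card_length[of vs'] card_length[of es'] dist
      by (simp_all add: distinct_card)
    then have szT: "length vT \<le> N" "length eT \<le> N" using sz' by simp_all
    have ok: "list_all2 path_ok Cs ps"
      using ps by (rule list_all2_mono) (simp add: path_best_def)
    have szps: "length ps \<le> N" using list_all2_lengthD[OF ps] szCs by simp
    have szp: "length x \<le> N" if x: "x \<in> set ps" for x
    proof -
      obtain i where i: "i < length ps" "x = ps ! i" using x by (auto simp: in_set_conv_nth)
      then have C: "Cs ! i \<in> set Cs" "path_ok (Cs ! i) x"
        using list_all2_nthD2[OF ok] list_all2_lengthD[OF ok] by auto
      then have "length x = length (fst (Cs ! i))"
        using distinct_card[of x] distinct_card[OF clusterD(1)[OF C(1)]] by (simp add: path_ok_def)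
      then show ?thesis using szC[OF C(1)] by simp
    qed
    have intra: "spec (map_c path_edges_c ps) (N * ((N + 1) + 1) + 1) (\<lambda>xs. xs = map path_edges ps)"
    proof (rule spec_mono[OF spec_map_c[where Q = "\<lambda>x e. e = path_edges x", OF _ szps order_refl] order_refl])
      show "spec (path_edges_c x) (N + 1) (\<lambda>e. e = path_edges x)" if "x \<in> set ps" for x
        by (rule spec_path_edges_c[OF szp[OF that] order_refl])
      show "xs = map path_edges ps" if "list_all2 (\<lambda>x e. e = path_edges x) ps xs" for xs
        using that by (auto simp: list_all2_conv_all_nth intro: nth_equalityI)
    qed
    let ?st = "filter (\<lambda>x. x \<notin> set ?rs) vT"
    have verts: "spec (fold_c (\<lambda>(R, R'). append_c R) Cs ?st) (N * (N + 1) + 1)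
        (\<lambda>xs. xs = concat (rev (map fst Cs)) @ ?st)"
    proof (rule spec_fold_c[where I = "\<lambda>ys xs. xs = concat (rev (map fst ys)) @ ?st", OF _ _ szCs order_refl])
      fix ys C zs xs assume "Cs = ys @ C # zs" and xs: "xs = concat (rev (map fst ys)) @ ?st"
      then have "length (fst C) + 1 \<le> N + 1" using szC[of C] by simp
      from spec_append_c[OF this, of xs]
      show "spec ((case C of (R, R') \<Rightarrow> append_c R) xs) (N + 1) (\<lambda>xs. xs = concat (rev (map fst (ys @ [C]))) @ ?st)"
        unfolding case_prod_unfold by (rule spec_mono) (simp_all add: xs)
    qed simp
    have edges: "spec (fold_c append_c (map path_edges ps) ds) (N * (N + 1) + 1)
        (\<lambda>xs. xs = concat (rev (map path_edges ps)) @ ds)" for ds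
    proof (rule spec_fold_c[where I = "\<lambda>ys xs. xs = concat (rev ys) @ ds" and N = N, OF _ _ _ order_refl])
      fix ys x zs xs assume split: "map path_edges ps = ys @ x # zs" and xs: "xs = concat (rev ys) @ ds"
      have "x \<in> set (map path_edges ps)" unfolding split by simp
      then obtain y where "y \<in> set ps" "x = path_edges y" by auto
      then have "length x + 1 \<le> N + 1" using szp[of y] by (simp add: length_path_edges)
      from spec_append_c[OF this, of xs]
      show "spec (append_c x xs) (N + 1) (\<lambda>xs. xs = concat (rev (ys @ [x])) @ ds)"
        by (rule spec_mono) (simp_all add: xs)
    qed (use szps in auto)
    have szrs: "length ?rs \<le> N" using szCs by simp
    show ?thesis
      unfolding assembly_time_def
    proof (rule spec_bind1[OF rep_map], rule spec_bind1[OF spec_map_c[OF spec_corresponding_edge_c[OF G]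
            szT(2) order_refl]], assumption, erule subsetD[OF sub(2)], rule szVE(2), erule szVE(3),
        rule spec_bind1[OF intra], hypsubst, rule spec_bind1[OF spec_minus_c[OF szT(1) szrs order_refl]], hypsubst,
        rule spec_bind1[OF verts], hypsubst, rule spec_bind1[OF edges], hypsubst, rule spec_return1)
      fix f ds assume ds: "list_all2 (\<lambda>e d. d \<in> set es \<and> c d = c' e \<and> rep ` d = e) eT ds"
      note out = assembled_solution[OF G ok tree dist sub hs ds]
      show "?good (concat (rev (map fst Cs)) @ ?st, concat (rev (map path_edges ps)) @ ds)"
      proof (intro conjI allI impI)
        fix T_opt
        assume "clustered_selected_internal_steiner_tree (V, set es) (length Cs) (cluster Cs) (selected Cs) T_opt"
        from assembled_cost_le[OF G ps \<rho> _ this, of "sum c' (set eT)"]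
        show "sum c (snd (graph_of (concat (rev (map fst Cs)) @ ?st, concat (rev (map path_edges ps)) @ ds)))
            \<le> (\<rho> + 4) * sum c (snd T_opt)"
          using out(3) T \<rho> by (simp add: graph_of_def del: split_paired_All)
      qed (use out(1,2) in \<open>simp_all add: graph_of_def\<close>)
    qed
  qed
  show ?thesis
    unfolding apx.simps apx_time_def
  proof (rule spec_bind1[OF paths], rule spec_bind1[OF contract])
    fix ps G assume ps: "list_all2 path_best Cs ps" and G: "contracted absorbed G"
    obtain vs' es' c' where g: "G = (vs', es', c')" by (cases G)
    show "spec (case G of (vs', es', c') \<Rightarrow> do {
        rs \<leftarrow> map_c (\<lambda>(R, R'). return (hd R)) Cs;
        (vT, eT) \<leftarrow> stp ((vs', es', c'), rs);
        f \<leftarrow> contraction_map_c vs Cs;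
        inter \<leftarrow> map_c (corresponding_edge_c len (vs, es, c) c' f) eT;
        intra \<leftarrow> map_c path_edges_c ps;
        steiner \<leftarrow> minus_c vT rs;
        vs_out \<leftarrow> fold_c (\<lambda>(R, R'). append_c R) Cs steiner;
        es_out \<leftarrow> fold_c append_c intra inter;
        return (vs_out, es_out)
      }) ((N * (1 + 1) + 1) + (poly q ((N + N * (1 + N)) + N) + assembly_time N)) ?good"
      unfolding g prod.case
    proof (rule spec_bind1[OF heads], hypsubst, rule spec_bind1[OF spec_stp_contracted[OF stp G[unfolded g] N]])
      fix T :: "'v graph_code"
      assume T: "stp_solution \<rho> ((vs', es', c'), ?rs) T"
      obtain vT eT where t: "T = (vT, eT)" by (cases T)
      show "spec (case T of (vT, eT) \<Rightarrow> do {
        f \<leftarrow> contraction_map_c vs Cs;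
        inter \<leftarrow> map_c (corresponding_edge_c len (vs, es, c) c' f) eT;
        intra \<leftarrow> map_c path_edges_c ps;
        steiner \<leftarrow> minus_c vT ?rs;
        vs_out \<leftarrow> fold_c (\<lambda>(R, R'). append_c R) Cs steiner;
        es_out \<leftarrow> fold_c append_c intra inter;
        return (vs_out, es_out)
      }) (assembly_time N) ?good"
        unfolding t prod.case
        by (rule finish[OF ps G[unfolded g]]) (use T t in auto)
    qed
  qed
qed

end

lemma polyfun_apx_time: "polyfun (apx_time p q)"
  unfolding apx_time_def[abs_def] path_time_def ham_step_def contract_time_def contract_edge_time_def
    corresponding_time_def assembly_time_def map_time_def first_time_def comp_time_def reach_time_def
  by (intro polyfun_intros)

text \<open>The first conjunct shows that exact polynomial-time spanning tree algorithms exist in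
  this model, so the second, which holds for any of them, is not vacuous.\<close>

theorem theorem1:
  fixes \<rho> :: real
    and len :: "real \<Rightarrow> nat"
    and stp :: "'v stp \<Rightarrow> 'v graph_code comp"
  assumes "poly_time_stp_approximation len \<rho> stp"
  shows "poly_time_mst len (prim len :: 'v wgraph \<Rightarrow> 'v graph_code comp) \<and>
    (\<forall>mst :: 'v wgraph \<Rightarrow> 'v graph_code comp.
       poly_time_mst len mst \<longrightarrow> poly_time_csistp_approximation len (\<rho> + 4) (apx len mst stp))"
proof (intro conjI allI impI)
  show "poly_time_mst len (prim len :: 'v wgraph \<Rightarrow> 'v graph_code comp)"
    by (rule poly_time_mst_prim)
  fix mst :: "'v wgraph \<Rightarrow> 'v graph_code comp"
  assume mst: "poly_time_mst len mst"
  obtain p where p: "\<And>H N. mst_instance H \<Longrightarrow> wgraph_size len H \<le> N \<Longrightarrow> spec (mst H) (poly p N) (mst_solution H)"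
    using mst_spec[OF mst] by blast
  obtain q where q: "\<And>I N. stp_instance I \<Longrightarrow> stp_size len I \<le> N \<Longrightarrow> spec (stp I) (poly q N) (stp_solution \<rho> I)"
    using stp_spec[OF assms] by blast
  show "poly_time_csistp_approximation len (\<rho> + 4) (apx len mst stp)"
    unfolding poly_time_csistp_approximation_def poly_time_approximation_iff
  proof (intro exI[of _ "apx_time p q"] conjI allI impI polyfun_apx_time)
    fix I :: "'v csistp"
    assume I: "csistp_instance I \<and> metric_instance I \<and> two_unselected I"
    obtain vs es c Cs where i: "I = ((vs, es, c), Cs)" by (cases I) auto
    interpret csistp_data vs es c Cs using I i by unfold_locales auto
    \<comment> \<open>Two unselected vertices of one cluster provide the distinct elements for the
      single-edge instance.\<close>
    have "0 \<le> \<rho>"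
    proof -
      have "2 \<le> card (cluster Cs 0 - selected Cs 0)" using unselected inst by simp
      then obtain a b :: 'v where "a \<noteq> b" by (metis card_le_Suc0_iff_eq card.infinite not_less_eq_eq numeral_2_eq_2 zero_le)
      from stp_ratio_ge_1[OF assms this] show ?thesis by simp
    qed
    from spec_apx[OF p q this order_refl]
    show "spec (apx len mst stp I) (apx_time p q (csistp_size len I)) (\<lambda>T. irredundant T \<and>
        (case I of (G, Cs) \<Rightarrow> clustered_selected_internal_steiner_tree (wgraph G) (length Cs)
          (cluster Cs) (selected Cs)) (graph_of T) \<and>
        (\<forall>T_opt. is_arg_min (case I of (G, Cs) \<Rightarrow> graph_cost (edge_cost G))
          (case I of (G, Cs) \<Rightarrow> clustered_selected_internal_steiner_tree (wgraph G) (length Cs)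
            (cluster Cs) (selected Cs)) T_opt \<longrightarrow>
          (case I of (G, Cs) \<Rightarrow> graph_cost (edge_cost G)) (graph_of T) \<le>
            (\<rho> + 4) * (case I of (G, Cs) \<Rightarrow> graph_cost (edge_cost G)) T_opt))"
      unfolding i prod.case wgraph.simps edge_cost.simps
      by (rule spec_mono) (simp_all add: is_arg_min_def graph_cost_def del: split_paired_All)
  qed
qed

end
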